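(* Let $V:\mathbb{R}^3\to\mathbb{C}$ belong to $L^{3/2}(\mathbb{R}^3)$. Then $$\sigma_{\mathrm p}(H_V)\subset\left\{\lambda\in\mathbb{C}:\ |\lambda|\le\frac18\,\frac{1}{(4\pi)^{2/3}}\,\|V\|_{L^{3/2}(\mathbb{R}^3)}^2\right\},$$ where $H_V=\Delta^2\dot{+}V$ in $L^2(\mathbb{R}^3)$.
   Context: Every complex-valued $V\in L^{3/2}(\mathbb{R}^3)$ satisfies the following: there exist $a\in(0,1)$ and $b\in\mathbb{R}$ with $\int_{\mathbb{R}^3}|V||\psi|^2\le a\int_{\mathbb{R}^3}|\Delta\psi|^2+b\int_{\mathbb{R}^3}|\psi|^2$ for all $\psi\in H^2(\mathbb{R}^3)$. Under this condition the operator $H_V=\Delta^2\dot{+}V$ is the m-sectorial operator in $L^2(\mathbb{R}^3)$ associated, via the representation theorem, with the closed sectorial form $h_V(\varphi,\psi)=\int_{\mathbb{R}^3}\overline{\Delta\varphi}\,\Delta\psi+\int_{\mathbb{R}^3}V\,\overline{\varphi}\,\psi$ with form domain $H^2(\mathbb{R}^3)$. That is, $\psi\in H^2(\mathbb{R}^3)$ belongs to the domain of $H_V$ with $H_V\psi=f\in L^2(\mathbb{R}^3)$ if and only if $h_V(\varphi,\psi)=\int_{\mathbb{R}^3}\overline{\varphi}f$ for all $\varphi\in H^2(\mathbb{R}^3)$. The point spectrum $\sigma_{\mathrm p}(H_V)$ is the set of all eigenvalues $\lambda\in\mathbb{C}$ of $H_V$ (including those lying in $[0,+\infty)$). *)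

theory Defs
  imports "HOL-Analysis.Analysis"
begin

type_synonym R3 = "real ^ 3"

text \<open>Elements of $L^p$ are represented by functions; equality in $L^p$ is equality almost
  everywhere.\<close>

definition Lp :: "real \<Rightarrow> (R3 \<Rightarrow> complex) set" where
  "Lp p = {f \<in> borel_measurable lebesgue. integrable lebesgue (\<lambda>x. cmod (f x) powr p)}"

definition Lp_norm :: "real \<Rightarrow> (R3 \<Rightarrow> complex) \<Rightarrow> real" where
  "Lp_norm p f = (\<integral>x. cmod (f x) powr p \<partial>lebesgue) powr (1 / p)"

definition partial_deriv :: "3 \<Rightarrow> (R3 \<Rightarrow> complex) \<Rightarrow> R3 \<Rightarrow> complex" where
  "partial_deriv i f x = frechet_derivative f (at x) (axis i 1)"

primrec C_k :: "nat \<Rightarrow> (R3 \<Rightarrow> complex) \<Rightarrow> bool" where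
  "C_k 0 f \<longleftrightarrow> continuous_on UNIV f"
| "C_k (Suc k) f \<longleftrightarrow> f differentiable_on UNIV \<and> (\<forall>i. C_k k (partial_deriv i f))"

definition test_functions :: "(R3 \<Rightarrow> complex) set" where
  "test_functions = {\<phi>. (\<forall>k. C_k k \<phi>) \<and> compact (closure {x. \<phi> x \<noteq> 0})}"

definition has_weak_partial :: "3 \<Rightarrow> (R3 \<Rightarrow> complex) \<Rightarrow> (R3 \<Rightarrow> complex) \<Rightarrow> bool" where
  "has_weak_partial i f g \<longleftrightarrow> f \<in> Lp 2 \<and> g \<in> Lp 2 \<and>
     (\<forall>\<phi>\<in>test_functions.
        (\<integral>x. f x * partial_deriv i \<phi> x \<partial>lebesgue) = - (\<integral>x. g x * \<phi> x \<partial>lebesgue))"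

text \<open>A weak derivative is unique up to a null set, so the choice below affects neither membership
  in the Sobolev spaces nor any integral in which the derivative occurs.\<close>

definition weak_partial :: "3 \<Rightarrow> (R3 \<Rightarrow> complex) \<Rightarrow> R3 \<Rightarrow> complex" where
  "weak_partial i f = (SOME g. has_weak_partial i f g)"

definition H1 :: "(R3 \<Rightarrow> complex) set" where
  "H1 = {\<psi> \<in> Lp 2. \<forall>i. \<exists>g. has_weak_partial i \<psi> g}"

definition H2 :: "(R3 \<Rightarrow> complex) set" where
  "H2 = {\<psi> \<in> H1. \<forall>i. weak_partial i \<psi> \<in> H1}"

definition laplacian :: "(R3 \<Rightarrow> complex) \<Rightarrow> R3 \<Rightarrow> complex" where
  "laplacian \<psi> x = (\<Sum>i\<in>UNIV. weak_partial i (weak_partial i \<psi>) x)"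

definition form_h :: "(R3 \<Rightarrow> complex) \<Rightarrow> (R3 \<Rightarrow> complex) \<Rightarrow> (R3 \<Rightarrow> complex) \<Rightarrow> complex" where
  "form_h V \<phi> \<psi> =
     (\<integral>x. cnj (laplacian \<phi> x) * laplacian \<psi> x \<partial>lebesgue) +
     (\<integral>x. V x * cnj (\<phi> x) * \<psi> x \<partial>lebesgue)"

text \<open>The operator $H_V = \Delta^2 \dot{+} V$ associated with the form, given by its graph. The graph
  is closed under changing the value $f = H_V \psi$ on a null set.\<close>

definition H_op :: "(R3 \<Rightarrow> complex) \<Rightarrow> ((R3 \<Rightarrow> complex) \<times> (R3 \<Rightarrow> complex)) set" where
  "H_op V = {(\<psi>, f). \<psi> \<in> H2 \<and> f \<in> Lp 2 \<and>
     (\<forall>\<phi>\<in>H2. form_h V \<phi> \<psi> = (\<integral>x. cnj (\<phi> x) * f x \<partial>lebesgue))}"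

definition point_spectrum :: "((R3 \<Rightarrow> complex) \<times> (R3 \<Rightarrow> complex)) set \<Rightarrow> complex set" where
  "point_spectrum T =
     {z. \<exists>\<psi>. \<not> (AE x in lebesgue. \<psi> x = 0) \<and> (\<psi>, \<lambda>x. z * \<psi> x) \<in> T}"

end

theory Submission
  imports Defs
begin

text \<open>
  Let $z \neq 0$ be an eigenvalue with eigenfunction $\psi$, and let $r$ be a fourth root of $z$ in
  the closed first quadrant.  Both $k_1 = i r$ and $k_2 = -r$ satisfy $k_j^4 = z$ and
  $\mathrm{Re}\, k_j \le 0$, and $k_1^2 = -k_2^2$.  Because $\Delta^2 - z = (\Delta - k_j^2)(\Delta + k_j^2)$,
  the functions $u_j = \Delta\psi + k_j^2\psi$ lie in $L^2$ and solve the second-order equations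
  $(\Delta - k_j^2) u_j = -V\psi$ in the sense of distributions, while $u_2 - u_1 = 2 r^2 \psi$.

  A square-integrable solution of $(\Delta - k^2) u = F$ with $F \in L^1$ and $\mathrm{Re}\, k \le 0$ is the
  potential $-\frac{1}{4\pi} \int e^{k|x-y|} |x-y|^{-1} F(y)\,dy$ (lemma helmholtz_representation).  This
  includes the case $\mathrm{Re}\, k = 0$, hence positive eigenvalues need no separate treatment: if the
  fundamental solution is cut off at distance $R$, the error is a kernel of size $R^{-2}(1 + 1/|x-y|)$
  on a ball of radius $R$, whose $L^2$ norm is of order $R^{-1/2}$.  The version with the cutoff in place is
  lemma parametrix; with $k = 0$ it also shows that $\psi$ is bounded, which makes $V\psi$ and
  $|V| |\psi|^2$ integrable.

  Subtracting the two representations gives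
  \[ |\psi(x)| \le \frac{c}{8\pi |z|^{1/2}} \int \frac{|V\psi|(y)}{|x-y|}\,dy, \qquad
     c^2 = \frac{33}{25} \ge \sup_{t \ge 0} |e^{k_1 t} - e^{k_2 t}|^2 . \]
  Multiplication by $|V\psi|$, integration and the Cauchy--Schwarz inequality lead to
  $1 \le \frac{c^2}{64 \pi^2 |z|} \iint |V(x)| |V(y)| |x-y|^{-2}\,dx\,dy$ (lemma birman_schwinger_bound).
  The double integral is at most $C \|V\|_{3/2}^2$ by a Hardy--Littlewood--Sobolev inequality (lemma
  hls_inequality).  The bound asserted for $|z|$ corresponds to $c^2 = 2$ and the optimal constant
  $C = 4^{1/3} \pi^{4/3} \approx 7.30$.  As $c^2$ is much smaller than $2$, the constant
  $C = 32/9 + 64\pi/27 \approx 11.0$, which has an elementary proof, is good enough.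
\<close>

section \<open>Smooth functions and smooth cutoffs\<close>

text \<open>The class is closed under partial derivatives by construction, so all its members satisfy every
  \<^const>\<open>C_k\<close> at once.  The rule for compositions takes the whole sequence of derivatives of the outer function,
  and only at the values that the inner function attains; this admits square roots and reciprocals of
  positive functions.\<close>

inductive smooth :: "(R3 \<Rightarrow> complex) \<Rightarrow> bool" where
  smooth_const: "smooth (\<lambda>x. c)"
| smooth_coord: "smooth (\<lambda>x. of_real (x $ i))"
| smooth_add: "smooth f \<Longrightarrow> smooth g \<Longrightarrow> smooth (\<lambda>x. f x + g x)"
| smooth_mult: "smooth f \<Longrightarrow> smooth g \<Longrightarrow> smooth (\<lambda>x. f x * g x)"
| smooth_comp: "smooth (\<lambda>x. of_real (q x)) \<Longrightarrow>
    (\<And>n x. (H n has_vector_derivative H (Suc n) (q x)) (at (q x))) \<Longrightarrow> smooth (\<lambda>x. H n (q x))"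

lemma partial_deriv_eqI:
  "(f has_derivative f') (at x) \<Longrightarrow> partial_deriv i f x = f' (axis i 1)"
  unfolding partial_deriv_def using frechet_derivative_at by metis

lemma has_derivative_radial:
  fixes H :: "real \<Rightarrow> complex"
  assumes "(H has_vector_derivative D) (at (q x))" "(q has_derivative q') (at x)"
  shows "((\<lambda>x. H (q x)) has_derivative (\<lambda>v. of_real (q' v) * D)) (at (x::R3))"
  using diff_chain_at[OF assms(2), of H "\<lambda>t. t *\<^sub>R D"] assms(1)
  by (simp add: has_vector_derivative_def o_def scaleR_conv_of_real)

lemma has_derivative_coord: "((\<lambda>x::R3. complex_of_real (x $ i)) has_derivative (\<lambda>v. of_real (v $ i))) (at x)"
  by (intro bounded_linear_imp_has_derivative bounded_linear_compose[OF bounded_linear_of_real]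
      bounded_linear_vec_nth)

text \<open>Each rule of the class has its product or chain rule, whose right-hand side is again in the
  class.\<close>

lemma smooth_differentiable: "smooth f \<Longrightarrow> f differentiable (at x)"
  and smooth_partial_deriv: "smooth f \<Longrightarrow> smooth (partial_deriv i f)"
proof -
  have "(\<forall>x. f differentiable (at x)) \<and> (\<forall>i. smooth (partial_deriv i f))" if "smooth f" for f
    using that
  proof induction
    case (smooth_const c)
    have "partial_deriv i (\<lambda>x. c) = (\<lambda>x. 0)" for i
      by (rule ext, subst partial_deriv_eqI[of _ "\<lambda>v. 0"]) auto
    then show ?case by (auto intro: smooth.smooth_const)
  next
    case (smooth_coord j)
    have "partial_deriv i (\<lambda>x. of_real (x $ j)) = (\<lambda>x. of_real (axis i 1 $ j))" for i
      by (rule ext, subst partial_deriv_eqI[OF has_derivative_coord]) auto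
    then show ?case
      using has_derivative_coord by (auto intro: smooth.smooth_const simp: differentiable_def)
  next
    case (smooth_add f g)
    then have d: "(f has_derivative frechet_derivative f (at x)) (at x)"
      "(g has_derivative frechet_derivative g (at x)) (at x)" for x
      by (simp_all add: frechet_derivative_works[symmetric])
    have "partial_deriv i (\<lambda>x. f x + g x) = (\<lambda>x. partial_deriv i f x + partial_deriv i g x)" for i
      by (rule ext, subst partial_deriv_eqI[OF has_derivative_add[OF d]]) (simp add: partial_deriv_def)
    then show ?case using smooth_add by (auto intro: smooth.smooth_add)
  next
    case (smooth_mult f g)
    then have d: "(f has_derivative frechet_derivative f (at x)) (at x)"
      "(g has_derivative frechet_derivative g (at x)) (at x)" for x
      by (simp_all add: frechet_derivative_works[symmetric])
    have "partial_deriv i (\<lambda>x. f x * g x) = (\<lambda>x. f x * partial_deriv i g x + partial_deriv i f x * g x)" for i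
      by (rule ext, subst partial_deriv_eqI[OF has_derivative_mult[OF d]]) (simp add: partial_deriv_def)
    moreover have "smooth (\<lambda>x. f x * partial_deriv i g x + partial_deriv i f x * g x)" for i
      by (intro smooth.smooth_add[OF smooth.smooth_mult smooth.smooth_mult]) (use smooth_mult in auto)
    ultimately show ?case using smooth_mult by (auto intro: differentiable_mult)
  next
    case (smooth_comp q H n)
    let ?q' = "\<lambda>x. frechet_derivative (\<lambda>x. complex_of_real (q x)) (at x)"
    have d: "((\<lambda>x. complex_of_real (q x)) has_derivative ?q' x) (at x)" for x
      using smooth_comp.IH by (simp add: frechet_derivative_works[symmetric])
    have "((\<lambda>x. Re (complex_of_real (q x))) has_derivative (\<lambda>v. Re (?q' x v))) (at x)" for x
      by (rule bounded_linear.has_derivative[OF bounded_linear_Re d])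
    then have dq: "(q has_derivative (\<lambda>v. Re (?q' x v))) (at x)" for x by simp
    have dq': "((\<lambda>x. complex_of_real (q x)) has_derivative (\<lambda>v. of_real (Re (?q' x v)))) (at x)" for x
      by (rule bounded_linear.has_derivative[OF bounded_linear_of_real dq])
    have eq: "?q' x = (\<lambda>v. of_real (Re (?q' x v)))" for x
      by (rule has_derivative_unique[OF d dq'])
    have dd: "((\<lambda>x. H n (q x)) has_derivative (\<lambda>v. of_real (Re (?q' x v)) * H (Suc n) (q x))) (at x)" for x n
      by (rule has_derivative_radial[OF smooth_comp.hyps(2) dq])
    have "partial_deriv i (\<lambda>x. H n (q x)) =
        (\<lambda>x. partial_deriv i (\<lambda>x. complex_of_real (q x)) x * H (Suc n) (q x))" for i
      by (rule ext, subst partial_deriv_eqI[OF dd]) (metis partial_deriv_def eq)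
    moreover have sm: "smooth (\<lambda>x. H n (q x))" for n
      by (rule smooth.smooth_comp[OF smooth_comp.hyps(1), of H n]) (rule smooth_comp.hyps(2))
    have "smooth (\<lambda>x. partial_deriv i (\<lambda>x. complex_of_real (q x)) x * H (Suc n) (q x))" for i
      by (intro smooth.smooth_mult sm) (use smooth_comp.IH in auto)
    ultimately show ?case using dd unfolding differentiable_def by metis
  qed
  then show "smooth f \<Longrightarrow> f differentiable (at x)" "smooth f \<Longrightarrow> smooth (partial_deriv i f)"
    by auto
qed

lemma smooth_imp_C_k: "smooth f \<Longrightarrow> C_k k f"
proof (induction k arbitrary: f)
  case 0
  then show ?case
    by (auto intro!: differentiable_imp_continuous_on simp: differentiable_on_def
        differentiable_at_withinI smooth_differentiable)
next
  case (Suc k)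
  then show ?case
    by (auto simp: differentiable_on_def smooth_differentiable smooth_partial_deriv
        differentiable_at_withinI)
qed

lemma smooth_test_function:
  assumes "smooth f" "\<And>x. norm (x - a) > r \<Longrightarrow> f x = 0"
  shows "f \<in> test_functions"
proof -
  have "{x. f x \<noteq> 0} \<subseteq> cball a r"
    using assms(2) by (force simp: dist_norm norm_minus_commute)
  then have "closure {x. f x \<noteq> 0} \<subseteq> cball a r"
    by (simp add: closure_minimal)
  then have "compact (closure {x. f x \<noteq> 0})"
    using compact_cball compact_Int_closed[OF compact_cball[of a r] closed_closure]
    by (metis inf.absorb_iff2)
  then show ?thesis using assms(1) by (simp add: test_functions_def smooth_imp_C_k)
qed

lemma smooth_of_real_add: "smooth (\<lambda>x. of_real (f x)) \<Longrightarrow> smooth (\<lambda>x. of_real (g x)) \<Longrightarrow> smooth (\<lambda>x. of_real (f x + g x))"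
  using smooth_add[of "\<lambda>x. of_real (f x)" "\<lambda>x. of_real (g x)"] by simp

lemma smooth_of_real_mult: "smooth (\<lambda>x. of_real (f x)) \<Longrightarrow> smooth (\<lambda>x. of_real (g x)) \<Longrightarrow> smooth (\<lambda>x. of_real (f x * g x))"
  using smooth_mult[of "\<lambda>x. of_real (f x)" "\<lambda>x. of_real (g x)"] by simp

lemma smooth_of_real_diff: "smooth (\<lambda>x. of_real (f x)) \<Longrightarrow> smooth (\<lambda>x. of_real (g x)) \<Longrightarrow> smooth (\<lambda>x. of_real (f x - g x))"
  using smooth_of_real_add[of f "\<lambda>x. (-1) * g x"] smooth_of_real_mult[of "\<lambda>x. -1" g] smooth_const[of "- 1"] by simp

lemma smooth_prod: "(\<And>i. i \<in> I \<Longrightarrow> smooth (f i)) \<Longrightarrow> smooth (\<lambda>x. \<Prod>i\<in>I. f i x)"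
  by (induction I rule: infinite_finite_induct) (auto intro: smooth_const smooth_mult)

lemma smooth_of_real_sum: "(\<And>i. i \<in> I \<Longrightarrow> smooth (\<lambda>x. of_real (f i x))) \<Longrightarrow> smooth (\<lambda>x. of_real (\<Sum>i\<in>I. f i x))"
  by (induction I rule: infinite_finite_induct) (auto intro: smooth_const smooth_of_real_add simp del: of_real_add of_real_sum)

lemma norm_vec3_power2: "(norm (x::R3))\<^sup>2 = (\<Sum>i\<in>UNIV. (x $ i)\<^sup>2)"
  by (simp add: norm_vec_def L2_set_def sum_nonneg)

lemma smooth_norm_square: "smooth (\<lambda>y. of_real ((norm (y - x))\<^sup>2))"
  unfolding norm_vec3_power2 vector_minus_component unfolding power2_eq_square
  by (intro smooth_of_real_sum smooth_of_real_mult smooth_of_real_diff smooth_coord smooth_const)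

text \<open>The $n$-th derivative of $e^{-1/t}$ is $P_n(1/t) e^{-1/t}$ with these polynomials $P_n$.\<close>

fun bump_poly :: "nat \<Rightarrow> real poly" where
  "bump_poly 0 = 1"
| "bump_poly (Suc n) = [:0,0,1:] * (bump_poly n - pderiv (bump_poly n))"

definition bump :: "nat \<Rightarrow> real \<Rightarrow> real" where
  "bump n t = (if t > 0 then poly (bump_poly n) (1/t) * exp (- (1/t)) else 0)"

lemma poly_exp_tendsto_0: "((\<lambda>u. poly p u * exp (- u)) \<longlongrightarrow> 0) at_top" for p :: "real poly"
proof -
  have "((\<lambda>u. \<Sum>i\<le>degree p. coeff p i * (u ^ i / exp u)) \<longlongrightarrow> (\<Sum>i\<le>degree p. coeff p i * 0)) at_top"
    by (intro tendsto_sum tendsto_mult tendsto_const tendsto_power_div_exp_0)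
  moreover have "(\<Sum>i\<le>degree p. coeff p i * (u ^ i / exp u)) = poly p u * exp (- u)" for u
    by (simp add: poly_altdef sum_distrib_left exp_minus divide_inverse mult_ac)
  ultimately show ?thesis by simp
qed

text \<open>At $t = 0$ the difference quotient from the right is a polynomial in $1/t$ times $e^{-1/t}$ and
  therefore tends to $0$.\<close>

lemma bump_has_derivative: "(bump n has_real_derivative bump (Suc n) t) (at t)"
proof -
  consider "t > 0" | "t < 0" | "t = 0" by linarith
  then show ?thesis
  proof cases
    case 1
    have "((\<lambda>t. poly (bump_poly n) (1/t) * exp (- (1/t))) has_real_derivative bump (Suc n) t) (at t)"
      using 1 by (auto intro!: derivative_eq_intros DERIV_chain2[OF poly_DERIV]
          simp: bump_def divide_simps power2_eq_square algebra_simps)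
    then show ?thesis
      by (rule DERIV_cong_ev[THEN iffD1, rotated -1])
        (use 1 eventually_nhds_in_open[of "{0<..}" t] in \<open>auto elim!: eventually_mono simp: bump_def\<close>)
  next
    case 2
    have "((\<lambda>t. 0) has_real_derivative bump (Suc n) t) (at t)"
      using 2 by (auto simp: bump_def)
    then show ?thesis
      by (rule DERIV_cong_ev[THEN iffD1, rotated -1])
        (use 2 eventually_nhds_in_open[of "{..<0}" t] in \<open>auto elim!: eventually_mono simp: bump_def\<close>)
  next
    case 3
    have "((\<lambda>h. bump n h / h) \<longlongrightarrow> 0) (at 0)"
    proof (rule filterlim_split_at)
      have "((\<lambda>h. 0) \<longlongrightarrow> 0) (at_left (0::real))" by simp
      then show "((\<lambda>h. bump n h / h) \<longlongrightarrow> 0) (at_left 0)"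
        by (rule Lim_transform_eventually) (auto simp: eventually_at_filter bump_def)
    next
      have "((\<lambda>h. poly ([:0,1:] * bump_poly n) (inverse h) * exp (- (inverse h))) \<longlongrightarrow> 0) (at_right 0)"
        by (rule filterlim_compose[OF poly_exp_tendsto_0 filterlim_inverse_at_top_right])
      then show "((\<lambda>h. bump n h / h) \<longlongrightarrow> 0) (at_right 0)"
        by (rule Lim_transform_eventually) (auto simp: eventually_at_filter bump_def divide_inverse)
    qed
    then show ?thesis using 3 by (simp add: DERIV_def bump_def)
  qed
qed

lemma continuous_bump: "continuous_on A (bump n)"
  by (meson DERIV_continuous_on bump_has_derivative has_field_derivative_at_within)

lemma bump_0: "t \<le> 0 \<Longrightarrow> bump n t = 0" by (simp add: bump_def)

lemma bump_bounds: "0 \<le> bump 0 t" "bump 0 t \<le> 1" by (auto simp: bump_def)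

lemma bump_bounded: "\<exists>C\<ge>0. \<forall>t\<le>1. \<bar>bump n t\<bar> \<le> C"
proof -
  have "compact (bump n ` {0..1})" by (intro compact_continuous_image continuous_bump) auto
  then obtain C where C: "\<forall>y\<in>bump n ` {0..1}. norm y \<le> C"
    using compact_imp_bounded bounded_iff by metis
  have "\<bar>bump n t\<bar> \<le> max C 0" if "t \<le> 1" for t
    using C that bump_0[of t n] by (cases "t \<le> 0") (auto simp: le_max_iff_disj)
  then show ?thesis by (intro exI[of _ "max C 0"]) auto
qed

lemma smooth_bump: "smooth (\<lambda>x. of_real (q x)) \<Longrightarrow> smooth (\<lambda>x. of_real (bump n (q x)))"
  by (rule smooth_comp[where H = "\<lambda>n t. of_real (bump n t)"])
    (auto intro!: has_vector_derivative_of_real bump_has_derivative)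

lemma smooth_powr:
  assumes "smooth (\<lambda>x. of_real (q x))" "\<And>x. q x > 0"
  shows "smooth (\<lambda>x. of_real (q x powr a))"
proof -
  define H where "H n t = complex_of_real ((\<Prod>j<n. a - real j) * t powr (a - real n))" for n t
  have "(H n has_vector_derivative H (Suc n) (q x)) (at (q x))" for n x
    unfolding H_def using assms(2)[of x]
    by (auto intro!: has_vector_derivative_of_real derivative_eq_intros simp: algebra_simps)
  then have "smooth (\<lambda>x. H 0 (q x))" by (rule smooth_comp[OF assms(1)])
  then show ?thesis by (simp add: H_def)
qed

lemma smooth_exp:
  assumes "smooth (\<lambda>x. of_real (q x))"
  shows "smooth (\<lambda>x. exp (k * of_real (q x)))"
proof -
  define H where "H n t = k ^ n * exp (k * of_real t)" for n and t :: real
  have "(H n has_vector_derivative H (Suc n) (q x)) (at (q x))" for n x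
    unfolding H_def
    by (rule has_vector_derivative_real_field)
      (auto intro!: derivative_eq_intros)
  then have "smooth (\<lambda>x. H 0 (q x))" by (rule smooth_comp[OF assms(1)])
  then show ?thesis by (simp add: H_def)
qed

section \<open>Integration of radial functions\<close>

lemma emeasure_cball_R3: "r \<ge> 0 \<Longrightarrow> emeasure lborel (cball (c::R3) r) = ennreal (4 / 3 * pi * r ^ 3)"
  by (subst emeasure_cball) (auto simp: unit_ball_vol_numeral(2)[of "Num.One"] eval_unit_ball_vol)

text \<open>Polar coordinates for radial integrands: the volume of balls determines the distribution of the
  norm, because half-lines form an intersection-stable generator.\<close>

lemma distr_norm_R3:
  "distr lborel borel (norm :: R3 \<Rightarrow> real) = density lborel (\<lambda>r. ennreal (4 * pi * r\<^sup>2) * indicator {0..} r)"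
    (is "?M = ?N")
proof (rule measure_eqI_generator_eq[where E = "range (\<lambda>a. {..a})" and A = "\<lambda>i. {..real i}" and \<Omega> = UNIV])
  have M: "emeasure ?M {..a} = (if a < 0 then 0 else ennreal (4 / 3 * pi * a ^ 3))" for a
  proof -
    have "emeasure ?M {..a} = emeasure lborel (norm -` {..a} :: R3 set)"
      by (subst emeasure_distr) auto
    also have "(norm -` {..a} :: R3 set) = cball 0 a" by auto
    finally show ?thesis by (auto simp: emeasure_cball_R3)
  qed
  have N: "emeasure ?N {..a} = (if a < 0 then 0 else ennreal (4 / 3 * pi * a ^ 3))" for a
  proof -
    have "emeasure ?N {..a} = (\<integral>\<^sup>+r. ennreal (4 * pi * r\<^sup>2) * indicator {0..a} r \<partial>lborel)"
      by (subst emeasure_density) (auto intro!: nn_integral_cong simp: indicator_def)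
    also have "\<dots> = (if a < 0 then 0 else ennreal (4 / 3 * pi * a ^ 3))"
    proof (cases "a < 0")
      case False
      have "(\<integral>\<^sup>+r. ennreal (4 * pi * r\<^sup>2) * indicator {0..a} r \<partial>lborel)
          = ennreal (4 / 3 * pi * a ^ 3 - 4 / 3 * pi * 0 ^ 3)"
        using False by (intro nn_integral_FTC_Icc) (auto intro!: derivative_eq_intros)
      then show ?thesis using False by simp
    qed auto
    finally show ?thesis .
  qed
  show "Int_stable (range (\<lambda>a::real. {..a}))"
    by (auto simp: Int_stable_def min_def intro!: image_eqI)
  show "emeasure ?M X = emeasure ?N X" if "X \<in> range (\<lambda>a. {..a})" for X
    using that M N by auto
  show "sets ?M = sigma_sets UNIV (range (\<lambda>a. {..a}))" "sets ?N = sigma_sets UNIV (range (\<lambda>a. {..a}))"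
    by (simp_all add: borel_eq_atMost)
  show "(\<Union>i. {..real i}) = UNIV" by (auto intro: real_arch_simple)
  show "emeasure ?M {..real i} \<noteq> \<infinity>" for i by (simp add: M)
qed auto

lemma nn_integral_radial:
  assumes [measurable]: "g \<in> borel_measurable borel"
  shows "(\<integral>\<^sup>+x. g (norm (x::R3)) \<partial>lborel) = (\<integral>\<^sup>+r. ennreal (4 * pi * r\<^sup>2) * indicator {0..} r * g r \<partial>lborel)"
proof -
  have "(\<integral>\<^sup>+x. g (norm (x::R3)) \<partial>lborel) = (\<integral>\<^sup>+r. g r \<partial>distr lborel borel (norm :: R3 \<Rightarrow> real))"
    by (subst nn_integral_distr) auto
  also have "\<dots> = (\<integral>\<^sup>+r. ennreal (4 * pi * r\<^sup>2) * indicator {0..} r * g r \<partial>lborel)"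
    unfolding distr_norm_R3 by (subst nn_integral_density) auto
  finally show ?thesis .
qed

lemma nn_integral_radial_FTC:
  assumes [measurable]: "g \<in> borel_measurable borel" and "0 \<le> a" "a \<le> b"
  and "\<And>r. a \<le> r \<Longrightarrow> r \<le> b \<Longrightarrow> (G has_real_derivative 4 * pi * r\<^sup>2 * g r) (at r)"
  and "\<And>r. a \<le> r \<Longrightarrow> r \<le> b \<Longrightarrow> 0 \<le> g r"
  shows "(\<integral>\<^sup>+x. ennreal (g (norm (x::R3))) * indicator {a..b} (norm x) \<partial>lborel) = ennreal (G b - G a)"
proof -
  have "(\<integral>\<^sup>+x. ennreal (g (norm (x::R3))) * indicator {a..b} (norm x) \<partial>lborel)
     = (\<integral>\<^sup>+r. ennreal (4 * pi * r\<^sup>2) * indicator {0..} r * (ennreal (g r) * indicator {a..b} r) \<partial>lborel)"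
    by (subst nn_integral_radial) auto
  also have "\<dots> = (\<integral>\<^sup>+r. ennreal (4 * pi * r\<^sup>2 * g r) * indicator {a..b} r \<partial>lborel)"
    using assms by (intro nn_integral_cong) (auto simp: indicator_def ennreal_mult)
  also have "\<dots> = ennreal (G b - G a)"
    using assms by (intro nn_integral_FTC_Icc) auto
  finally show ?thesis .
qed

lemma nn_integral_radial_FTC_at_top:
  assumes [measurable]: "g \<in> borel_measurable borel" and "0 \<le> a"
  and "\<And>r. a \<le> r \<Longrightarrow> (G has_real_derivative 4 * pi * r\<^sup>2 * g r) (at r)"
  and "\<And>r. a \<le> r \<Longrightarrow> 0 \<le> g r" and "(G \<longlongrightarrow> L) at_top"
  shows "(\<integral>\<^sup>+x. ennreal (g (norm (x::R3))) * indicator {a..} (norm x) \<partial>lborel) = ennreal (L - G a)"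
proof -
  have "(\<integral>\<^sup>+x. ennreal (g (norm (x::R3))) * indicator {a..} (norm x) \<partial>lborel)
     = (\<integral>\<^sup>+r. ennreal (4 * pi * r\<^sup>2) * indicator {0..} r * (ennreal (g r) * indicator {a..} r) \<partial>lborel)"
    by (subst nn_integral_radial) auto
  also have "\<dots> = (\<integral>\<^sup>+r. ennreal (4 * pi * r\<^sup>2 * g r) * indicator {a..} r \<partial>lborel)"
    using assms by (intro nn_integral_cong) (auto simp: indicator_def ennreal_mult)
  also have "\<dots> = ennreal (L - G a)"
    using assms by (intro nn_integral_FTC_atLeast) auto
  finally show ?thesis .
qed

section \<open>The fundamental lemma of the calculus of variations\<close>

text \<open>Integrability with respect to \<^const>\<open>lborel\<close> rather than its completion makes these functions Borel
  measurable, so that Fubini's theorem applies to products with convolution kernels.\<close>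

definition locally_integrable :: "(R3 \<Rightarrow> complex) \<Rightarrow> bool" where
  "locally_integrable f \<longleftrightarrow> (\<forall>r. set_integrable lborel (cball 0 r) f)"

text \<open>The factors $e^{-1/(n s)}$, for $s > 0$, increase to the indicator of the positive half-line; a box is
  cut out by six of them.\<close>

lemma smooth_box_approx:
  fixes a b :: R3
  obtains h where "\<And>n::nat. h n \<in> test_functions"
    "\<And>n x. norm (h n x) \<le> indicator (box a b) x"
    "\<And>x. (\<lambda>n. h n x) \<longlonglongrightarrow> indicator (box a b) x"
proof
  define s where "s n t = bump 0 (real (Suc n) * t)" for n t
  define h where "h n x = (\<Prod>i\<in>UNIV. complex_of_real (s n (x $ i - a $ i) * s n (b $ i - x $ i)))" for n and x :: R3
  have s0: "s n t = 0" if "t \<le> 0" for n t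
    using that by (simp add: s_def bump_def mult_nonneg_nonpos2 zero_less_mult_iff)
  have s1: "0 \<le> s n t" "s n t \<le> 1" for n t using bump_bounds by (simp_all add: s_def)
  have lim: "(\<lambda>n. s n t) \<longlonglongrightarrow> 1" if "t > 0" for t
  proof -
    have "(\<lambda>n. exp (- (inverse (real (Suc n)) * (1/t)))) \<longlonglongrightarrow> exp (- (0 * (1/t)))"
      by (intro tendsto_intros LIMSEQ_inverse_real_of_nat)
    moreover have "s n t = exp (- (inverse (real (Suc n)) * (1/t)))" for n
      using that by (simp add: s_def bump_def divide_simps add_pos_nonneg)
    ultimately show ?thesis by simp
  qed
  have box: "x \<in> box a b \<longleftrightarrow> (\<forall>i. a $ i < x $ i \<and> x $ i < b $ i)" for x :: R3
    by (simp add: mem_box_cart)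
  have out: "h n x = 0" if nin: "x \<notin> box a b" for n x
  proof -
    obtain i where "x $ i \<le> a $ i \<or> b $ i \<le> x $ i" using nin by (auto simp: box not_less)
    then have "s n (x $ i - a $ i) * s n (b $ i - x $ i) = 0" using s0 by auto
    then show ?thesis unfolding h_def by (intro prod_zero) (auto simp del: of_real_mult)
  qed
  obtain r where r: "box a b \<subseteq> cball 0 r"
    using bounded_subset_ballD[OF bounded_box[of a b], of 0] ball_subset_cball by blast
  show "h n \<in> test_functions" for n
  proof (rule smooth_test_function[of _ r 0])
    show "smooth (h n)" unfolding h_def s_def
      by (intro smooth_prod smooth_of_real_mult smooth_bump smooth_of_real_diff smooth_coord smooth_const)
    show "h n x = 0" if "norm (x - 0) > r" for x
      by (rule out) (use r that in force)
  qed
  show "norm (h n x) \<le> indicator (box a b) x" for n x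
  proof (cases "x \<in> box a b")
    case True
    have "norm (h n x) = (\<Prod>i\<in>UNIV. s n (x $ i - a $ i) * s n (b $ i - x $ i))"
      unfolding h_def prod_norm[symmetric] by (intro prod.cong) (auto simp: norm_mult s1)
    also have "\<dots> \<le> (\<Prod>i\<in>(UNIV::3 set). 1)"
      by (intro prod_mono conjI mult_nonneg_nonneg mult_le_one s1)
    finally show ?thesis using True by simp
  qed (simp add: out)
  show "(\<lambda>n. h n x) \<longlonglongrightarrow> indicator (box a b) x" for x
  proof (cases "x \<in> box a b")
    case True
    have "(\<lambda>n. h n x) \<longlonglongrightarrow> (\<Prod>i\<in>(UNIV::3 set). complex_of_real (1 * 1))"
      unfolding h_def using True box by (intro tendsto_prod tendsto_of_real tendsto_mult lim) auto
    then show ?thesis using True by simp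
  qed (simp add: out)
qed

lemma test_functionD:
  assumes "\<phi> \<in> test_functions"
  shows "\<phi> differentiable (at x)" "continuous_on UNIV \<phi>" "partial_deriv i \<phi> \<in> test_functions"
    "\<exists>C\<ge>0. \<forall>x. norm (\<phi> x) \<le> C" "\<exists>r>0. \<forall>x. norm x > r \<longrightarrow> \<phi> x = 0"
    "\<phi> \<in> borel_measurable borel"
proof -
  have C: "C_k k \<phi>" for k using assms by (simp add: test_functions_def)
  have cpt: "compact (closure {x. \<phi> x \<noteq> 0})" using assms by (simp add: test_functions_def)
  show diff: "\<phi> differentiable (at x)" for x
    using C[of 1] by (auto simp: differentiable_on_def)
  show cont: "continuous_on UNIV \<phi>" using C[of 0] by simp
  then show "\<phi> \<in> borel_measurable borel" by (rule borel_measurable_continuous_onI)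
  obtain r where r: "r > 0" "closure {x. \<phi> x \<noteq> 0} \<subseteq> ball 0 r"
    using bounded_subset_ballD[OF compact_imp_bounded[OF cpt], of 0] by blast
  show "\<exists>r>0. \<forall>x. norm x > r \<longrightarrow> \<phi> x = 0"
  proof (intro exI[of _ r] conjI allI impI)
    fix x :: R3 assume "r < norm x"
    then have "x \<notin> closure {x. \<phi> x \<noteq> 0}" using r by auto
    then show "\<phi> x = 0" using closure_subset[of "{x. \<phi> x \<noteq> 0}"] by auto
  qed fact
  show "\<exists>C\<ge>0. \<forall>x. norm (\<phi> x) \<le> C"
  proof -
    have "compact (\<phi> ` closure {x. \<phi> x \<noteq> 0})"
      by (rule compact_continuous_image[OF continuous_on_subset[OF cont] cpt]) simp
    then obtain C where C: "C > 0" "\<And>y. y \<in> \<phi> ` closure {x. \<phi> x \<noteq> 0} \<Longrightarrow> norm y \<le> C"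
      using compact_imp_bounded[of "\<phi> ` closure {x. \<phi> x \<noteq> 0}"] unfolding bounded_pos by blast
    have "norm (\<phi> x) \<le> C" for x
      using C closure_subset[of "{x. \<phi> x \<noteq> 0}"] by (cases "\<phi> x = 0") auto
    then show ?thesis using C(1) by (intro exI[of _ C]) auto
  qed
  have zero: "partial_deriv i \<phi> x = 0" if "x \<notin> closure {x. \<phi> x \<noteq> 0}" for x
  proof -
    have "(\<phi> has_derivative (\<lambda>v. 0)) (at x)"
    proof (rule has_derivative_transform_within_open[OF has_derivative_const[of 0]])
      show "x \<in> - closure {x. \<phi> x \<noteq> 0}" using that by simp
      show "0 = \<phi> y" if "y \<in> - closure {x. \<phi> x \<noteq> 0}" for y
        using that closure_subset[of "{x. \<phi> x \<noteq> 0}"] by auto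
    qed (simp add: open_Compl)
    then show ?thesis by (subst partial_deriv_eqI) auto
  qed
  have "closure {x. partial_deriv i \<phi> x \<noteq> 0} \<subseteq> closure {x. \<phi> x \<noteq> 0}"
    using zero by (intro closure_minimal) auto
  then have "compact (closure {x. partial_deriv i \<phi> x \<noteq> 0})"
    using compact_Int_closed[OF cpt closed_closure, of "{x. partial_deriv i \<phi> x \<noteq> 0}"]
    by (simp add: Int_absorb1)
  moreover have "C_k k (partial_deriv i \<phi>)" for k using C[of "Suc k"] by simp
  ultimately show "partial_deriv i \<phi> \<in> test_functions"
    by (simp add: test_functions_def)
qed

lemma integrable_mult_test:
  assumes "locally_integrable f" "\<phi> \<in> test_functions"
  shows "integrable lborel (\<lambda>x. f x * \<phi> x)"
proof -
  obtain r where r: "\<And>x. norm x > r \<Longrightarrow> \<phi> x = 0" using test_functionD(5)[OF assms(2)] by auto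
  obtain C where C: "C \<ge> 0" "\<And>x. norm (\<phi> x) \<le> C" using test_functionD(4)[OF assms(2)] by auto
  have int: "integrable lborel (\<lambda>x. indicator (cball 0 r) x *\<^sub>R f x)"
    using assms(1) by (simp add: locally_integrable_def set_integrable_def)
  have [measurable]: "\<phi> \<in> borel_measurable borel" by (rule test_functionD[OF assms(2)])
  have "integrable lborel (\<lambda>x. (indicator (cball 0 r) x *\<^sub>R f x) * \<phi> x)"
  proof (rule Bochner_Integration.integrable_bound[OF integrable_mult_right[OF integrable_norm[OF int], of C]])
    show "(\<lambda>x. indicator (cball 0 r) x *\<^sub>R f x * \<phi> x) \<in> borel_measurable lborel"
      using borel_measurable_integrable[OF int] by (intro borel_measurable_times) auto
  qed (use C in \<open>auto simp: norm_mult mult.commute[of C] intro!: mult_left_mono split: split_indicator\<close>)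
  also have "(\<lambda>x. (indicator (cball 0 r) x *\<^sub>R f x) * \<phi> x) = (\<lambda>x. f x * \<phi> x)"
    using r by (force simp: indicator_def)
  finally show ?thesis .
qed

lemma locally_integrable_measurable:
  assumes "locally_integrable f" shows "f \<in> borel_measurable borel"
proof -
  have m: "(\<lambda>x. indicator (cball 0 (real n)) x *\<^sub>R f x) \<in> borel_measurable borel" for n
    using assms borel_measurable_integrable[of lborel] by (auto simp: locally_integrable_def set_integrable_def)
  have "(\<lambda>n. indicator (cball 0 (real n)) x *\<^sub>R f x) \<longlonglongrightarrow> f x" for x
  proof (rule tendsto_eventually)
    obtain N where "norm x \<le> real N" using real_arch_simple by blast
    then show "\<forall>\<^sub>F n in sequentially. indicator (cball 0 (real n)) x *\<^sub>R f x = f x"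
      by (intro eventually_sequentiallyI[of N]) (auto simp: indicator_def)
  qed
  then show ?thesis by (rule borel_measurable_LIMSEQ_metric[OF m])
qed

lemma sets_borel_box: "sets (borel :: R3 measure) = sigma_sets UNIV (range (\<lambda>(a, b). box a b))"
  by (subst borel_eq_box) (simp add: sets_measure_of)

text \<open>By dominated convergence, the integrals of $f$ over all boxes vanish.  Boxes are stable under
  intersection and generate the Borel sets, so the integrals over all bounded Borel sets vanish.\<close>

lemma du_Bois_Reymond:
  assumes f: "locally_integrable f"
    and orth: "\<And>\<phi>. \<phi> \<in> test_functions \<Longrightarrow> (\<integral>x. f x * \<phi> x \<partial>lborel) = 0"
  shows "AE x in lborel. f x = 0"
proof -
  have [measurable]: "f \<in> borel_measurable borel" by (rule locally_integrable_measurable[OF f])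
  have ibox: "integrable lborel (\<lambda>x. indicator (box a b) x *\<^sub>R f x)" for a b
  proof -
    obtain r where r: "box a b \<subseteq> cball 0 r"
      using bounded_subset_ballD[OF bounded_box[of a b], of 0] ball_subset_cball by blast
    have "set_integrable lborel (box a b) f"
      by (rule set_integrable_subset[OF _ _ r]) (use f in \<open>auto simp: locally_integrable_def\<close>)
    then show ?thesis by (simp add: set_integrable_def)
  qed
  have box0: "(\<integral>x. indicator (box a b) x *\<^sub>R f x \<partial>lborel) = 0" for a b
  proof -
    obtain h where h: "\<And>n::nat. h n \<in> test_functions"
      "\<And>n x. norm (h n x) \<le> indicator (box a b) x"
      "\<And>x. (\<lambda>n. h n x) \<longlonglongrightarrow> indicator (box a b) x"
      using smooth_box_approx by blast
    have [measurable]: "h n \<in> borel_measurable borel" for n by (rule test_functionD[OF h(1)])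
    have "(\<lambda>n. \<integral>x. f x * h n x \<partial>lborel) \<longlonglongrightarrow> (\<integral>x. f x * indicator (box a b) x \<partial>lborel)"
    proof (rule integral_dominated_convergence[where w = "\<lambda>x. norm (indicator (box a b) x *\<^sub>R f x)"])
      show "integrable lborel (\<lambda>x. norm (indicator (box a b) x *\<^sub>R f x))"
        by (intro integrable_norm ibox)
      show "AE x in lborel. (\<lambda>n. f x * h n x) \<longlonglongrightarrow> f x * indicator (box a b) x"
        by (intro AE_I2 tendsto_mult tendsto_const h)
      show "AE x in lborel. norm (f x * h n x) \<le> norm (indicator (box a b) x *\<^sub>R f x)" for n
        using mult_left_mono[OF h(2), of "norm (f _)"] by (intro AE_I2) (auto simp: norm_mult mult.commute)
    qed auto
    moreover have "(\<integral>x. f x * h n x \<partial>lborel) = 0" for n by (rule orth[OF h(1)])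
    moreover have "f x * indicator (box a b) x = indicator (box a b) x *\<^sub>R f x" for x
      by (auto simp: indicator_def)
    ultimately show ?thesis by (simp add: LIMSEQ_const_iff)
  qed
  have "AE x in lborel. indicator (box (- (\<chi> i. real n)) (\<chi> i. real n)) x *\<^sub>R f x = 0" for n
  proof (rule sigma_finite_measure.density_zero[OF sigma_finite_lborel ibox])
    let ?B = "box (- (\<chi> i. real n)) (\<chi> i. real n) :: R3 set"
    define g where "g x = indicator ?B x *\<^sub>R f x" for x
    have g: "integrable lborel g" unfolding g_def by (rule ibox)
    have gA: "integrable lborel (\<lambda>x. indicator A x *\<^sub>R g x)" if "A \<in> sets borel" for A
      using integrable_mult_indicator[OF _ g] that by auto
    fix A :: "R3 set" assume "A \<in> sets lborel"
    then have A: "A \<in> sigma_sets UNIV (range (\<lambda>(a, b). box a b :: R3 set))"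
      unfolding sets_lborel sets_borel_box .
    have stable: "Int_stable (range (\<lambda>(a, b). box a b :: R3 set))"
    proof (rule Int_stableI)
      fix X Y :: "R3 set" assume "X \<in> range (\<lambda>(a, b). box a b)" "Y \<in> range (\<lambda>(a, b). box a b)"
      then obtain a b c d where "X = box a b" "Y = box c d" by auto
      then have "X \<inter> Y = (\<lambda>(a, b). box a b) (\<Sum>i\<in>Basis. max (a \<bullet> i) (c \<bullet> i) *\<^sub>R i, \<Sum>i\<in>Basis. min (b \<bullet> i) (d \<bullet> i) *\<^sub>R i)"
        by (simp add: box_Int_box)
      then show "X \<inter> Y \<in> range (\<lambda>(a, b). box a b)" by (rule range_eqI)
    qed
    have "range (\<lambda>(a, b). box a b :: R3 set) \<subseteq> Pow UNIV" by simp
    with stable have "(\<integral>x. indicator A x *\<^sub>R g x \<partial>lborel) = 0"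
      using A
    proof (induction rule: sigma_sets_induct_disjoint)
      case (basic A)
      then obtain a b where A: "A = box a b" by auto
      obtain c d where "box a b \<inter> ?B = box c d" using box_Int_box[of a b] by blast
      then have "(\<lambda>x. indicator A x *\<^sub>R g x) = (\<lambda>x. indicator (box c d) x *\<^sub>R f x)"
        unfolding g_def A by (auto simp: indicator_def fun_eq_iff)
      then show ?case using box0 by simp
    next
      case (compl A)
      then have [measurable]: "A \<in> sets borel" by (simp only: sets_borel_box)
      have "(\<integral>x. indicator (UNIV - A) x *\<^sub>R g x \<partial>lborel) = (\<integral>x. g x - indicator A x *\<^sub>R g x \<partial>lborel)"
        by (intro Bochner_Integration.integral_cong) (auto simp: indicator_def)
      also have "\<dots> = (\<integral>x. g x \<partial>lborel) - (\<integral>x. indicator A x *\<^sub>R g x \<partial>lborel)"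
        by (intro Bochner_Integration.integral_diff g gA) auto
      finally show ?case using compl box0 by (simp add: g_def)
    next
      case (union A)
      have [measurable]: "A i \<in> sets borel" for i using union(2) by (auto simp only: sets_borel_box)
      have "(\<integral>x\<in>(\<Union>i. A i). g x \<partial>lborel) = (\<Sum>i. \<integral>x\<in>A i. g x \<partial>lborel)"
      proof (rule lebesgue_integral_countable_add)
        show "set_integrable lborel (\<Union>i. A i) g" unfolding set_integrable_def by (rule gA) auto
      qed (use union(1) in \<open>auto simp: disjoint_family_on_def\<close>)
      then show ?case using union(3) by (simp add: set_lebesgue_integral_def)
    qed simp
    then show "set_lebesgue_integral lborel A (\<lambda>x. indicator ?B x *\<^sub>R f x) = 0"
      by (simp add: set_lebesgue_integral_def g_def)
  qed
  then have "AE x in lborel. \<forall>n. indicator (box (- (\<chi> i. real n)) (\<chi> i. real n)) x *\<^sub>R f x = 0"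
    unfolding AE_all_countable by blast
  then show ?thesis
  proof eventually_elim
    case (elim x)
    obtain n where n: "norm x < real n" using reals_Archimedean2 by blast
    have "x \<in> box (- (\<chi> i. real n)) (\<chi> i. real n)"
    proof (simp add: mem_box_cart, intro allI)
      fix i show "- real n < x $ i \<and> x $ i < real n"
        using component_le_norm_cart[of x i] n by auto
    qed
    then show ?case using spec[OF elim, of n] by simp
  qed
qed

section \<open>Weak derivatives and the weak eigenvalue equation\<close>

lemma cball_borel [measurable]: "cball c r \<in> sets (borel :: R3 measure)"
  by (simp add: borel_closed)

lemma integrable_indicator_cball: "integrable lborel (indicator (cball c r) :: R3 \<Rightarrow> real)"
  by (rule integrable_real_indicator) (use emeasure_lborel_cball_finite[of c r] in auto)

lemma lborel_integral_shift: "(\<integral>x. f (x + c) \<partial>lborel) = (\<integral>x. f (x::R3) \<partial>lborel)"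
  if [measurable]: "f \<in> borel_measurable borel" for f :: "R3 \<Rightarrow> complex"
proof -
  have "(\<integral>x. f x \<partial>lborel) = (\<integral>x. f x \<partial>distr lborel borel ((+) c))" by (simp add: lborel_distr_plus)
  also have "\<dots> = (\<integral>x. f (c + x) \<partial>lborel)" by (subst integral_distr) auto
  finally show ?thesis by (simp add: add.commute)
qed

lemma partial_deriv_line:
  assumes "f differentiable (at (x + t *\<^sub>R axis i 1))"
  shows "((\<lambda>t. f (x + t *\<^sub>R axis i 1)) has_vector_derivative partial_deriv i f (x + t *\<^sub>R axis i 1)) (at t)"
proof -
  have "(f has_derivative frechet_derivative f (at (x + t *\<^sub>R axis i 1))) (at (x + t *\<^sub>R axis i 1))"
    using assms frechet_derivative_works by blast
  moreover have "((\<lambda>t. x + t *\<^sub>R axis i 1) has_derivative (\<lambda>h. h *\<^sub>R axis i 1)) (at t)"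
    by (auto intro!: derivative_eq_intros)
  ultimately have "((\<lambda>t. f (x + t *\<^sub>R axis i 1)) has_derivative
      (\<lambda>h. frechet_derivative f (at (x + t *\<^sub>R axis i 1)) (h *\<^sub>R axis i 1))) (at t)"
    using diff_chain_at[of "\<lambda>t. x + t *\<^sub>R axis i 1"] by (simp add: o_def)
  moreover have "linear (frechet_derivative f (at (x + t *\<^sub>R axis i 1)))"
    using assms linear_frechet_derivative by blast
  ultimately show ?thesis
    by (simp add: has_vector_derivative_def partial_deriv_def linear_scale)
qed

lemma test_function_integrable: "\<phi> \<in> test_functions \<Longrightarrow> integrable lborel \<phi>"
proof -
  assume \<phi>: "\<phi> \<in> test_functions"
  have "locally_integrable (\<lambda>x. 1)" by (auto simp: locally_integrable_def set_integrable_def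
        intro!: integrable_scaleR_left integrable_indicator_cball)
  from integrable_mult_test[OF this \<phi>] show ?thesis by simp
qed

text \<open>The integral is the limit of the integrals of difference quotients, which vanish by translation
  invariance.  The mean value inequality supplies the majorant.\<close>

lemma integral_partial_deriv_0:
  assumes f: "f \<in> test_functions"
  shows "(\<integral>x. partial_deriv i f x \<partial>lborel) = 0"
proof -
  let ?e = "axis i 1 :: R3"
  define h where "h n = 1 / real (Suc n)" for n
  have h: "0 < h n" "h n \<le> 1" for n by (auto simp: h_def)
  obtain r where r: "\<And>x. norm x > r \<Longrightarrow> f x = 0" using test_functionD(5)[OF f] by auto
  obtain C where C: "C \<ge> 0" "\<And>x. norm (partial_deriv i f x) \<le> C"
    using test_functionD(4)[OF test_functionD(3)[OF f]] by metis
  have [measurable]: "f \<in> borel_measurable borel" "partial_deriv i f \<in> borel_measurable borel"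
    using test_functionD[OF f] test_functionD(6) by auto
  have fint: "integrable lborel f" by (rule test_function_integrable[OF f])
  define q where "q n x = (f (x + h n *\<^sub>R ?e) - f x) / of_real (h n)" for n x
  have [measurable]: "q n \<in> borel_measurable borel" for n unfolding q_def by measurable
  have bound: "norm (q n x) \<le> C * indicator (cball 0 (r + 1)) x" for n x
  proof (cases "x \<in> cball 0 (r + 1)")
    case True
    have "norm (f (x + h n *\<^sub>R ?e) - f (x + 0 *\<^sub>R ?e)) \<le> C * norm (h n - 0)"
    proof (rule differentiable_bound[where S = UNIV and f' = "\<lambda>t h. h *\<^sub>R partial_deriv i f (x + t *\<^sub>R ?e)"])
      show "((\<lambda>t. f (x + t *\<^sub>R ?e)) has_derivative (\<lambda>h. h *\<^sub>R partial_deriv i f (x + t *\<^sub>R ?e))) (at t within UNIV)" for t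
        using partial_deriv_line[OF test_functionD(1)[OF f]] by (simp add: has_vector_derivative_def)
      show "onorm (\<lambda>h. h *\<^sub>R partial_deriv i f (x + t *\<^sub>R ?e)) \<le> C" for t
        by (rule onorm_le) (use C in \<open>auto simp: mult.commute[of C] intro!: mult_left_mono\<close>)
    qed auto
    then show ?thesis using h[of n] True by (simp add: q_def norm_divide divide_simps)
  next
    case False
    have "norm x - norm (h n *\<^sub>R ?e) \<le> norm (x + h n *\<^sub>R ?e)" by (rule norm_diff_ineq)
    then have "f (x + h n *\<^sub>R ?e) = 0" "f x = 0" using False r h[of n] by auto
    then show ?thesis using C by (simp add: q_def)
  qed
  have lim: "(\<lambda>n. q n x) \<longlonglongrightarrow> partial_deriv i f x" for x
  proof -
    have "((\<lambda>t. f (x + t *\<^sub>R ?e)) has_vector_derivative partial_deriv i f (x + 0 *\<^sub>R ?e)) (at 0)"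
      by (rule partial_deriv_line[OF test_functionD(1)[OF f]])
    then have "((\<lambda>t. norm (f (x + t *\<^sub>R ?e) - f x - t *\<^sub>R partial_deriv i f x) / norm t) \<longlongrightarrow> 0) (at 0)"
      unfolding has_vector_derivative_def has_derivative_at by simp
    then have "((\<lambda>t. norm ((f (x + t *\<^sub>R ?e) - f x) /\<^sub>R t - partial_deriv i f x)) \<longlongrightarrow> 0) (at 0)"
    proof (rule Lim_transform_eventually)
      have "norm (a - t *\<^sub>R d) / norm t = norm (a /\<^sub>R t - d)" if "t \<noteq> 0" for a d :: complex and t
      proof -
        have "a /\<^sub>R t - d = (a - t *\<^sub>R d) /\<^sub>R t" using that by (simp add: scaleR_diff_right)
        then show ?thesis by (simp add: divide_inverse)
      qed
      then show "\<forall>\<^sub>F t in at 0. norm (f (x + t *\<^sub>R ?e) - f x - t *\<^sub>R partial_deriv i f x) / norm t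
          = norm ((f (x + t *\<^sub>R ?e) - f x) /\<^sub>R t - partial_deriv i f x)"
        by (auto simp: eventually_at_filter)
    qed
    then have "((\<lambda>t. (f (x + t *\<^sub>R ?e) - f x) /\<^sub>R t) \<longlongrightarrow> partial_deriv i f x) (at 0)"
      by (rule LIM_zero_cancel[OF tendsto_norm_zero_cancel])
    moreover have "filterlim h (at 0) sequentially"
      unfolding filterlim_at using h LIMSEQ_inverse_real_of_nat
      by (auto simp: h_def[abs_def] inverse_eq_divide intro!: always_eventually dest: less_imp_neq)
    ultimately have "(\<lambda>n. (f (x + h n *\<^sub>R ?e) - f x) /\<^sub>R h n) \<longlonglongrightarrow> partial_deriv i f x"
      by (rule filterlim_compose)
    then show ?thesis by (simp add: q_def scaleR_conv_of_real divide_inverse mult.commute)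
  qed
  have "(\<lambda>n. \<integral>x. q n x \<partial>lborel) \<longlonglongrightarrow> (\<integral>x. partial_deriv i f x \<partial>lborel)"
    by (rule integral_dominated_convergence[where w = "\<lambda>x. C * indicator (cball 0 (r + 1)) x"])
      (auto intro!: lim bound integrable_indicator_cball)
  moreover have "(\<integral>x. q n x \<partial>lborel) = 0" for n
  proof -
    have "integrable lborel (\<lambda>x. f (h n *\<^sub>R ?e + x))"
      using lborel_distr_plus[of "h n *\<^sub>R ?e"] fint by (subst integrable_distr_eq[symmetric, where N = borel]) auto
    then have "(\<integral>x. f (x + h n *\<^sub>R ?e) - f x \<partial>lborel) = 0"
      using fint by (subst Bochner_Integration.integral_diff) (auto simp: add.commute lborel_integral_shift[of f, simplified add.commute])
    then show ?thesis unfolding q_def by simp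
  qed
  ultimately show ?thesis by (simp add: LIMSEQ_const_iff)
qed

lemma partial_deriv_add:
  assumes "f differentiable (at x)" "g differentiable (at x)"
  shows "partial_deriv i (\<lambda>x. f x + g x) x = partial_deriv i f x + partial_deriv i g x"
proof -
  have "(f has_derivative frechet_derivative f (at x)) (at x)" "(g has_derivative frechet_derivative g (at x)) (at x)"
    using assms by (auto simp: frechet_derivative_works[symmetric])
  from partial_deriv_eqI[OF has_derivative_add[OF this]] show ?thesis by (simp add: partial_deriv_def)
qed

lemma partial_deriv_mult:
  assumes "f differentiable (at x)" "g differentiable (at x)"
  shows "partial_deriv i (\<lambda>x. f x * g x) x = f x * partial_deriv i g x + partial_deriv i f x * g x"
proof -
  have "(f has_derivative frechet_derivative f (at x)) (at x)" "(g has_derivative frechet_derivative g (at x)) (at x)"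
    using assms by (auto simp: frechet_derivative_works[symmetric])
  from partial_deriv_eqI[OF has_derivative_mult[OF this]] show ?thesis by (simp add: partial_deriv_def)
qed


lemma AE_lebesgue_iff: "(AE x in lebesgue. P x) \<longleftrightarrow> (AE x in lborel. P x)"
  by (simp add: AE_completion_iff)

lemma measurable_lebesgueI: "f \<in> borel_measurable borel \<Longrightarrow> f \<in> borel_measurable lebesgue"
  by (rule measurable_completion) simp

lemma lebesgue_borel_representative:
  fixes f :: "R3 \<Rightarrow> complex"
  assumes "f \<in> borel_measurable lebesgue"
  obtains g where "g \<in> borel_measurable borel" "AE x in lborel. f x = g x"
proof -
  have "(\<lambda>x. Re (f x)) \<in> borel_measurable lebesgue" "(\<lambda>x. Im (f x)) \<in> borel_measurable lebesgue"
    using assms by measurable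
  from this[THEN completion_ex_borel_measurable_real]
  obtain u v where uv: "u \<in> borel_measurable lborel" "AE x in lborel. Re (f x) = u x"
    "v \<in> borel_measurable lborel" "AE x in lborel. Im (f x) = v x" by blast
  show ?thesis
  proof
    show "(\<lambda>x. Complex (u x) (v x)) \<in> borel_measurable borel"
      using uv unfolding borel_measurable_complex_iff by simp
    show "AE x in lborel. f x = Complex (u x) (v x)"
      using uv(2,4) by eventually_elim (simp add: complex_eq_iff)
  qed
qed

lemma integral_lebesgue_eq:
  fixes f g :: "R3 \<Rightarrow> complex"
  assumes "f \<in> borel_measurable lebesgue" "g \<in> borel_measurable borel" "AE x in lborel. f x = g x"
  shows "(\<integral>x. f x \<partial>lebesgue) = (\<integral>x. g x \<partial>lborel)"
proof -
  have "(\<integral>x. f x \<partial>lebesgue) = (\<integral>x. g x \<partial>lebesgue)"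
    using assms(3) by (intro integral_cong_AE[OF assms(1) measurable_lebesgueI[OF assms(2)]]) (simp add: AE_lebesgue_iff)
  then show ?thesis using assms(2) by (simp add: integral_completion)
qed

lemma integrable_lebesgue_eq:
  fixes f g :: "R3 \<Rightarrow> real"
  assumes "f \<in> borel_measurable lebesgue" "g \<in> borel_measurable borel" "AE x in lborel. f x = g x"
  shows "integrable lebesgue f \<longleftrightarrow> integrable lborel g"
proof -
  have "integrable lebesgue f \<longleftrightarrow> integrable lebesgue g"
    using assms(3) by (intro integrable_cong_AE[OF assms(1) measurable_lebesgueI[OF assms(2)]]) (simp add: AE_lebesgue_iff)
  then show ?thesis using assms(2) by (simp add: integrable_completion)
qed

text \<open>Borel representatives of the elements of $L^2$; integrands on the product of two copies of the space
  are then measurable.\<close>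

definition square_integrable :: "(R3 \<Rightarrow> complex) \<Rightarrow> bool" where
  "square_integrable f \<longleftrightarrow> f \<in> borel_measurable borel \<and> integrable lborel (\<lambda>x. (norm (f x))\<^sup>2)"

lemma Lp2_iff: "f \<in> Lp 2 \<longleftrightarrow> f \<in> borel_measurable lebesgue \<and> integrable lebesgue (\<lambda>x. (norm (f x))\<^sup>2)"
  by (simp add: Lp_def)

lemma Lp2_representative:
  assumes "f \<in> Lp 2"
  obtains g where "square_integrable g" "AE x in lborel. f x = g x"
proof -
  have f: "f \<in> borel_measurable lebesgue" "integrable lebesgue (\<lambda>x. (norm (f x))\<^sup>2)"
    using assms by (auto simp: Lp2_iff)
  obtain g where g: "g \<in> borel_measurable borel" "AE x in lborel. f x = g x"
    using lebesgue_borel_representative[OF f(1)] .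
  have "integrable lborel (\<lambda>x. (norm (g x))\<^sup>2)"
    by (subst integrable_lebesgue_eq[symmetric, of "\<lambda>x. (norm (f x))\<^sup>2"])
      (use f g in \<open>auto elim: eventually_mono\<close>)
  then show ?thesis using g by (intro that[of g]) (auto simp: square_integrable_def)
qed

lemma square_integrable_imp_Lp2: assumes "square_integrable f" shows "f \<in> Lp 2"
proof -
  have [measurable]: "f \<in> borel_measurable borel" using assms by (simp add: square_integrable_def)
  have "integrable lebesgue (\<lambda>x. (norm (f x))\<^sup>2)"
    by (subst integrable_completion) (use assms in \<open>simp_all add: square_integrable_def\<close>)
  then show ?thesis by (simp add: Lp2_iff measurable_lebesgueI)
qed

lemma square_integrable_add:
  assumes "square_integrable f" "square_integrable g" shows "square_integrable (\<lambda>x. f x + g x)"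
proof -
  have [measurable]: "f \<in> borel_measurable borel" "g \<in> borel_measurable borel" using assms by (auto simp: square_integrable_def)
  have "integrable lborel (\<lambda>x. (norm (f x + g x))\<^sup>2)"
  proof (rule Bochner_Integration.integrable_bound)
    show "integrable lborel (\<lambda>x. 2 * (norm (f x))\<^sup>2 + 2 * (norm (g x))\<^sup>2)"
      using assms by (auto simp: square_integrable_def)
    have "(norm (f x + g x))\<^sup>2 \<le> 2 * (norm (f x))\<^sup>2 + 2 * (norm (g x))\<^sup>2" for x
      using power_mono[OF norm_triangle_ineq[of "f x" "g x"], of 2] sum_squares_bound[of "norm (f x)" "norm (g x)"]
      by (auto simp: power2_sum)
    then show "AE x in lborel. norm ((norm (f x + g x))\<^sup>2) \<le> norm (2 * (norm (f x))\<^sup>2 + 2 * (norm (g x))\<^sup>2)"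
      by auto
  qed auto
  then show ?thesis by (auto simp: square_integrable_def)
qed

lemma square_integrable_cmult: "square_integrable f \<Longrightarrow> square_integrable (\<lambda>x. c * f x)"
  by (auto simp: square_integrable_def norm_mult power_mult_distrib)

lemma square_integrable_diff: "square_integrable f \<Longrightarrow> square_integrable g \<Longrightarrow> square_integrable (\<lambda>x. f x - g x)"
  using square_integrable_add[of f "\<lambda>x. (-1) * g x"] square_integrable_cmult[of g "-1"] by simp

lemma square_integrable_sum: "finite I \<Longrightarrow> (\<And>i. i \<in> I \<Longrightarrow> square_integrable (f i)) \<Longrightarrow> square_integrable (\<lambda>x. \<Sum>i\<in>I. f i x)"
  by (induction I rule: finite_induct) (auto simp: square_integrable_add, simp add: square_integrable_def)

lemma square_integrable_imp_locally_integrable: assumes "square_integrable f" shows "locally_integrable f"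
  unfolding locally_integrable_def
proof
  fix r
  have [measurable]: "f \<in> borel_measurable borel" using assms by (auto simp: square_integrable_def)
  show "set_integrable lborel (cball 0 r) f"
    unfolding set_integrable_def
  proof (rule Bochner_Integration.integrable_bound)
    show "integrable lborel (\<lambda>x. indicator (cball 0 r) x + (norm (f x))\<^sup>2)"
      using assms by (intro Bochner_Integration.integrable_add integrable_indicator_cball) (auto simp: square_integrable_def)
    have "norm (f x) \<le> 1 + (norm (f x))\<^sup>2" for x
    proof -
      have "2 * norm (f x) \<le> 1 + (norm (f x))\<^sup>2" using sum_squares_bound[of 1 "norm (f x)"] by simp
      then show ?thesis using norm_ge_zero[of "f x"] by linarith
    qed
    then show "AE x in lborel. norm (indicator (cball 0 r) x *\<^sub>R f x) \<le> norm (indicator (cball 0 r) x + (norm (f x))\<^sup>2)"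
      by (auto simp: indicator_def)
  qed (auto intro!: borel_measurable_scaleR borel_measurable_indicator)
qed

lemma square_integrable_mult:
  assumes "square_integrable f" "square_integrable g" shows "integrable lborel (\<lambda>x. f x * g x)"
proof -
  have [measurable]: "f \<in> borel_measurable borel" "g \<in> borel_measurable borel" using assms by (auto simp: square_integrable_def)
  show ?thesis
  proof (rule Bochner_Integration.integrable_bound)
    show "integrable lborel (\<lambda>x. (norm (f x))\<^sup>2 + (norm (g x))\<^sup>2)"
      using assms by (auto simp: square_integrable_def)
    have "norm (f x) * norm (g x) \<le> (norm (f x))\<^sup>2 + (norm (g x))\<^sup>2" for x
      using sum_squares_bound[of "norm (f x)" "norm (g x)"] mult_nonneg_nonneg[OF norm_ge_zero[of "f x"] norm_ge_zero[of "g x"]]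
      by linarith
    then show "AE x in lborel. norm (f x * g x) \<le> norm ((norm (f x))\<^sup>2 + (norm (g x))\<^sup>2)"
      by (auto simp: norm_mult)
  qed auto
qed

lemma test_function_square_integrable: "\<phi> \<in> test_functions \<Longrightarrow> square_integrable \<phi>"
proof -
  assume \<phi>: "\<phi> \<in> test_functions"
  have [measurable]: "\<phi> \<in> borel_measurable borel" by (rule test_functionD[OF \<phi>])
  obtain C where C: "C \<ge> 0" "\<And>x. norm (\<phi> x) \<le> C" using test_functionD(4)[OF \<phi>] by auto
  have "integrable lborel (\<lambda>x. (norm (\<phi> x))\<^sup>2)"
  proof (rule Bochner_Integration.integrable_bound)
    show "integrable lborel (\<lambda>x. C * norm (\<phi> x))" using test_function_integrable[OF \<phi>] by simp
    show "AE x in lborel. norm ((norm (\<phi> x))\<^sup>2) \<le> norm (C * norm (\<phi> x))"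
      using C by (auto simp: power2_eq_square intro!: mult_right_mono)
  qed auto
  then show ?thesis by (auto simp: square_integrable_def)
qed

lemma test_function_mult:
  assumes "\<phi> \<in> test_functions" "\<eta> \<in> test_functions"
  shows "(\<integral>x. \<phi> x * partial_deriv i \<eta> x \<partial>lborel) = - (\<integral>x. partial_deriv i \<phi> x * \<eta> x \<partial>lborel)"
proof -
  have Ck: "C_k k (\<lambda>x. f x * g x)" if "f \<in> test_functions" "g \<in> test_functions" for k f g
    using that
  proof (induction k arbitrary: f g)
    case 0
    then show ?case by (simp add: continuous_on_mult test_functionD(2))
  next
    case (Suc k)
    have add: "C_k k (\<lambda>x. f x + g x)" if "C_k k f" "C_k k g" for k f g
      using that
    proof (induction k arbitrary: f g)
      case (Suc k)
      then have d: "f differentiable (at x)" "g differentiable (at x)" for x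
        by (auto simp: differentiable_on_def)
      then have "partial_deriv i (\<lambda>x. f x + g x) = (\<lambda>x. partial_deriv i f x + partial_deriv i g x)" for i
        by (intro ext partial_deriv_add)
      then show ?case using Suc d by (auto simp: differentiable_on_def intro: differentiable_add differentiable_at_withinI)
    qed (auto intro: continuous_intros)
    have "partial_deriv i (\<lambda>x. f x * g x) = (\<lambda>x. f x * partial_deriv i g x + partial_deriv i f x * g x)" for i
      using Suc.prems test_functionD(1) by (auto simp: partial_deriv_mult)
    moreover have "C_k k (\<lambda>x. f x * partial_deriv i g x + partial_deriv i f x * g x)" for i
      by (intro add Suc.IH Suc.prems test_functionD(3))
    ultimately show ?case using Suc.prems test_functionD(1)
      by (auto simp: differentiable_on_def intro: differentiable_mult differentiable_at_withinI)
  qed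
  have "closure {x. \<phi> x * \<eta> x \<noteq> 0} \<subseteq> closure {x. \<phi> x \<noteq> 0}" by (intro closure_mono) auto
  moreover have "compact (closure {x. \<phi> x \<noteq> 0})" using assms by (simp add: test_functions_def)
  ultimately have "compact (closure {x. \<phi> x * \<eta> x \<noteq> 0})"
    using compact_Int_closed[OF _ closed_closure, of "closure {x. \<phi> x \<noteq> 0}" "{x. \<phi> x * \<eta> x \<noteq> 0}"]
    by (simp add: Int_absorb1)
  then have "(\<lambda>x. \<phi> x * \<eta> x) \<in> test_functions" using Ck assms by (simp add: test_functions_def)
  from integral_partial_deriv_0[OF this, of i]
  have "0 = (\<integral>x. \<phi> x * partial_deriv i \<eta> x + partial_deriv i \<phi> x * \<eta> x \<partial>lborel)"
    using assms by (simp add: partial_deriv_mult test_functionD(1))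
  also have "\<dots> = (\<integral>x. \<phi> x * partial_deriv i \<eta> x \<partial>lborel) + (\<integral>x. partial_deriv i \<phi> x * \<eta> x \<partial>lborel)"
    by (intro Bochner_Integration.integral_add square_integrable_mult test_function_square_integrable test_functionD(3) assms)
  finally show ?thesis by (simp add: eq_neg_iff_add_eq_0)
qed

definition test_laplacian :: "(R3 \<Rightarrow> complex) \<Rightarrow> R3 \<Rightarrow> complex" where
  "test_laplacian \<phi> x = (\<Sum>i\<in>UNIV. partial_deriv i (partial_deriv i \<phi>) x)"

lemma integral_lebesgue_mult:
  assumes "f \<in> Lp 2" "AE x in lborel. f x = g x" "g \<in> borel_measurable borel" "h \<in> borel_measurable borel"
  shows "(\<integral>x. f x * h x \<partial>lebesgue) = (\<integral>x. g x * h x \<partial>lborel)"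
proof (rule integral_lebesgue_eq)
  show "(\<lambda>x. f x * h x) \<in> borel_measurable lebesgue"
    using assms measurable_lebesgueI by (intro borel_measurable_times) (auto simp: Lp_def)
  show "AE x in lborel. f x * h x = g x * h x" using assms(2) by eventually_elim simp
qed (use assms in simp)

text \<open>Passing to Borel representatives turns integrals with respect to the completed measure into
  integrals with respect to \<^const>\<open>lborel\<close>.\<close>

lemma has_weak_partial_iff:
  assumes "f \<in> Lp 2" "g \<in> Lp 2" "square_integrable f'" "square_integrable g'" "AE x in lborel. f x = f' x" "AE x in lborel. g x = g' x"
  shows "has_weak_partial i f g \<longleftrightarrow>
    (\<forall>\<phi>\<in>test_functions. (\<integral>x. f' x * partial_deriv i \<phi> x \<partial>lborel) = - (\<integral>x. g' x * \<phi> x \<partial>lborel))"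
proof -
  have "(\<integral>x. f x * partial_deriv i \<phi> x \<partial>lebesgue) = (\<integral>x. f' x * partial_deriv i \<phi> x \<partial>lborel)"
    "(\<integral>x. g x * \<phi> x \<partial>lebesgue) = (\<integral>x. g' x * \<phi> x \<partial>lborel)" if "\<phi> \<in> test_functions" for \<phi>
    using assms that by (auto intro!: integral_lebesgue_mult test_functionD(6) test_functionD(3) simp: square_integrable_def)
  then show ?thesis using assms(1,2) by (simp add: has_weak_partial_def)
qed

lemma has_weak_partial_unique:
  assumes "has_weak_partial i f g" "has_weak_partial i f h"
  shows "AE x in lborel. g x = h x"
proof -
  have Lp: "f \<in> Lp 2" "g \<in> Lp 2" "h \<in> Lp 2" using assms by (auto simp: has_weak_partial_def)
  obtain f' where f': "square_integrable f'" "AE x in lborel. f x = f' x" using Lp2_representative[OF Lp(1)] .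
  obtain g' where g': "square_integrable g'" "AE x in lborel. g x = g' x" using Lp2_representative[OF Lp(2)] .
  obtain h' where h': "square_integrable h'" "AE x in lborel. h x = h' x" using Lp2_representative[OF Lp(3)] .
  have "AE x in lborel. g' x - h' x = 0"
  proof (rule du_Bois_Reymond)
    show "locally_integrable (\<lambda>x. g' x - h' x)" by (intro square_integrable_imp_locally_integrable square_integrable_diff g' h')
    fix \<phi> assume \<phi>: "\<phi> \<in> test_functions"
    have "(\<integral>x. (g' x - h' x) * \<phi> x \<partial>lborel) = (\<integral>x. g' x * \<phi> x \<partial>lborel) - (\<integral>x. h' x * \<phi> x \<partial>lborel)"
      unfolding left_diff_distrib
      by (intro Bochner_Integration.integral_diff square_integrable_mult test_function_square_integrable \<phi> g' h')
    also have "\<dots> = 0"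
      using assms \<phi> has_weak_partial_iff[OF Lp(1,2) f'(1) g'(1) f'(2) g'(2)]
        has_weak_partial_iff[OF Lp(1,3) f'(1) h'(1) f'(2) h'(2)] by simp
    finally show "(\<integral>x. (g' x - h' x) * \<phi> x \<partial>lborel) = 0" .
  qed
  then show ?thesis using g'(2) h'(2) by eventually_elim simp
qed

lemma weak_partial_works: "has_weak_partial i f g \<Longrightarrow> has_weak_partial i f (weak_partial i f)"
  unfolding weak_partial_def by (rule someI[of "has_weak_partial i f"])

lemma test_function_weak_partial:
  assumes "\<phi> \<in> test_functions"
  shows "has_weak_partial i \<phi> (partial_deriv i \<phi>)"
proof -
  note L2 = test_function_square_integrable[OF assms] test_function_square_integrable[OF test_functionD(3)[OF assms]]
  show ?thesis
    using assms L2 by (subst has_weak_partial_iff[of _ _ \<phi> "partial_deriv i \<phi>"])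
      (auto intro!: square_integrable_imp_Lp2 test_function_mult)
qed

lemma has_weak_partial_cong_AE:
  assumes "has_weak_partial i f g" "f' \<in> Lp 2" "AE x in lborel. f x = f' x"
  shows "has_weak_partial i f' g"
proof -
  have Lp: "f \<in> Lp 2" "g \<in> Lp 2" using assms by (auto simp: has_weak_partial_def)
  obtain k where k: "square_integrable k" "AE x in lborel. f x = k x" using Lp2_representative[OF Lp(1)] .
  obtain l where l: "square_integrable l" "AE x in lborel. g x = l x" using Lp2_representative[OF Lp(2)] .
  have "AE x in lborel. f' x = k x" using k(2) assms(3) by eventually_elim simp
  then show ?thesis
    using assms(1) has_weak_partial_iff[OF Lp k(1) l(1) k(2) l(2)]
      has_weak_partial_iff[OF assms(2) Lp(2) k(1) l(1) _ l(2)] by simp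
qed

text \<open>The weak derivatives in the definition of $H^2$ and of the Laplacian are arbitrary choices; by
  uniqueness they agree with the classical derivatives of a test function almost everywhere.\<close>

lemma test_function_H2:
  assumes "\<phi> \<in> test_functions"
  shows "\<phi> \<in> H2" "AE x in lborel. laplacian \<phi> x = test_laplacian \<phi> x"
proof -
  have w: "has_weak_partial i \<phi> (weak_partial i \<phi>)" for i
    using weak_partial_works test_function_weak_partial[OF assms] by blast
  have eq: "AE x in lborel. partial_deriv i \<phi> x = weak_partial i \<phi> x" for i
    using has_weak_partial_unique[OF test_function_weak_partial[OF assms] w] .
  have Lp: "weak_partial i \<phi> \<in> Lp 2" for i using w by (auto simp: has_weak_partial_def)
  have w2: "has_weak_partial j (weak_partial i \<phi>) (partial_deriv j (partial_deriv i \<phi>))" for i j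
    by (rule has_weak_partial_cong_AE[OF test_function_weak_partial[OF test_functionD(3)[OF assms]] Lp eq])
  have "AE x in lborel. weak_partial i (weak_partial i \<phi>) x = partial_deriv i (partial_deriv i \<phi>) x" for i
    using has_weak_partial_unique[OF weak_partial_works[OF w2] w2] .
  then have "AE x in lborel. \<forall>i. weak_partial i (weak_partial i \<phi>) x = partial_deriv i (partial_deriv i \<phi>) x"
    by (simp add: eventually_all_finite)
  then show "AE x in lborel. laplacian \<phi> x = test_laplacian \<phi> x"
    by eventually_elim (simp add: laplacian_def test_laplacian_def)
  show "\<phi> \<in> H2"
    using w w2 Lp square_integrable_imp_Lp2[OF test_function_square_integrable[OF assms]] unfolding H2_def H1_def by blast
qed

lemma test_laplacian_test: "\<phi> \<in> test_functions \<Longrightarrow> square_integrable (test_laplacian \<phi>)"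
  unfolding test_laplacian_def[abs_def]
  by (intro square_integrable_sum test_function_square_integrable test_functionD(3)) auto

lemma H2_laplacian:
  assumes "\<psi> \<in> H2"
  obtains p l where "square_integrable p" "square_integrable l" "AE x in lborel. \<psi> x = p x" "AE x in lborel. laplacian \<psi> x = l x"
    "\<psi> \<in> Lp 2" "laplacian \<psi> \<in> borel_measurable lebesgue"
    "\<forall>\<phi>\<in>test_functions. (\<integral>x. p x * test_laplacian \<phi> x \<partial>lborel) = (\<integral>x. l x * \<phi> x \<partial>lborel)"
proof -
  have w: "has_weak_partial i \<psi> (weak_partial i \<psi>)" for i
    using assms weak_partial_works unfolding H2_def H1_def by blast
  have w2: "has_weak_partial i (weak_partial i \<psi>) (weak_partial i (weak_partial i \<psi>))" for i
    using assms weak_partial_works unfolding H2_def H1_def by blast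
  have Lp: "\<psi> \<in> Lp 2" "weak_partial i \<psi> \<in> Lp 2" "weak_partial i (weak_partial i \<psi>) \<in> Lp 2" for i
    using w w2 by (auto simp: has_weak_partial_def)
  obtain p where p: "square_integrable p" "AE x in lborel. \<psi> x = p x" using Lp2_representative[OF Lp(1)] .
  have "\<exists>g. square_integrable g \<and> (AE x in lborel. weak_partial i \<psi> x = g x)" for i
    using Lp2_representative[OF Lp(2)] by metis
  then obtain g where g: "\<And>i. square_integrable (g i)" "\<And>i. AE x in lborel. weak_partial i \<psi> x = g i x" by metis
  have "\<exists>g. square_integrable g \<and> (AE x in lborel. weak_partial i (weak_partial i \<psi>) x = g x)" for i
    using Lp2_representative[OF Lp(3)] by metis
  then obtain k where k: "\<And>i. square_integrable (k i)" "\<And>i. AE x in lborel. weak_partial i (weak_partial i \<psi>) x = k i x" by metis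
  define l where "l x = (\<Sum>i\<in>UNIV. k i x)" for x
  have "AE x in lborel. \<forall>i. weak_partial i (weak_partial i \<psi>) x = k i x"
    using k(2) by (simp add: eventually_all_finite)
  then have 1: "AE x in lborel. laplacian \<psi> x = l x"
    by eventually_elim (simp add: laplacian_def l_def)
  have 2: "square_integrable l" unfolding l_def by (intro square_integrable_sum k) auto
  have 3: "laplacian \<psi> \<in> borel_measurable lebesgue"
    unfolding laplacian_def[abs_def] using Lp(3) by (intro borel_measurable_sum) (auto simp: Lp_def)
  have "(\<integral>x. p x * test_laplacian \<phi> x \<partial>lborel) = (\<integral>x. l x * \<phi> x \<partial>lborel)" if \<phi>: "\<phi> \<in> test_functions" for \<phi>
  proof -
    have "(\<integral>x. p x * partial_deriv i (partial_deriv i \<phi>) x \<partial>lborel) = (\<integral>x. k i x * \<phi> x \<partial>lborel)" for i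
      using w[of i] w2[of i] has_weak_partial_iff[OF Lp(1,2) p(1) g(1) p(2) g(2), of i i]
        has_weak_partial_iff[OF Lp(2,3) g(1) k(1) g(2) k(2), of i i] \<phi> test_functionD(3)[OF \<phi>] by simp
    then show ?thesis
      unfolding test_laplacian_def l_def sum_distrib_left sum_distrib_right
      by (subst (1 2) Bochner_Integration.integral_sum)
        (auto intro!: square_integrable_mult p k test_function_square_integrable test_functionD(3) \<phi>)
  qed
  then have "\<forall>\<phi>\<in>test_functions. (\<integral>x. p x * test_laplacian \<phi> x \<partial>lborel) = (\<integral>x. l x * \<phi> x \<partial>lborel)" ..
  then show ?thesis by (rule that[OF p(1) 2 p(2) 1 Lp(1) 3])
qed

lemma test_function_cnj:
  assumes "\<phi> \<in> test_functions"
  shows "(\<lambda>x. cnj (\<phi> x)) \<in> test_functions" "test_laplacian (\<lambda>x. cnj (\<phi> x)) x = cnj (test_laplacian \<phi> x)"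
proof -
  have pd: "partial_deriv i (\<lambda>x. cnj (f x)) = (\<lambda>x. cnj (partial_deriv i f x))" if "\<And>x. f differentiable (at x)" for i f
  proof
    fix x
    have "(f has_derivative frechet_derivative f (at x)) (at x)" using that frechet_derivative_works by blast
    from partial_deriv_eqI[OF bounded_linear.has_derivative[OF bounded_linear_cnj this]]
    show "partial_deriv i (\<lambda>x. cnj (f x)) x = cnj (partial_deriv i f x)" by (simp add: partial_deriv_def)
  qed
  have dcnj: "(\<lambda>x. cnj (f x)) differentiable (at x)" if "f differentiable (at x)" for f and x :: R3
    using that bounded_linear.has_derivative[OF bounded_linear_cnj] unfolding differentiable_def by blast
  have "C_k k (\<lambda>x. cnj (f x))" if "C_k k f" for k f
    using that
  proof (induction k arbitrary: f)
    case (Suc k)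
    then have d: "f differentiable (at x)" for x by (auto simp: differentiable_on_def)
    then show ?case using Suc dcnj[OF d] by (auto simp: pd differentiable_on_def differentiable_at_withinI)
  qed (auto intro: continuous_intros)
  then show "(\<lambda>x. cnj (\<phi> x)) \<in> test_functions" using assms by (auto simp: test_functions_def)
  show "test_laplacian (\<lambda>x. cnj (\<phi> x)) x = cnj (test_laplacian \<phi> x)"
    unfolding test_laplacian_def using assms by (simp add: pd test_functionD)
qed

text \<open>The form equation, tested with conjugates of test functions, is the equation
  $\Delta^2\psi + V\psi = z\psi$ in the sense of distributions.  Here $p$, $l$ and $W$ are Borel
  representatives of $\psi$, $\Delta\psi$ and $V$.\<close>

lemma eigenfunction_weak_equation:
  assumes V: "V \<in> borel_measurable lebesgue" and z: "(\<psi>, \<lambda>x. z * \<psi> x) \<in> H_op V"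
  obtains p l W where "square_integrable p" "square_integrable l" "W \<in> borel_measurable borel"
    "AE x in lborel. V x = W x" "AE x in lborel. \<psi> x = p x"
    "\<forall>\<phi>\<in>test_functions. (\<integral>x. p x * test_laplacian \<phi> x \<partial>lborel) = (\<integral>x. l x * \<phi> x \<partial>lborel)"
    "\<forall>\<phi>\<in>test_functions. (\<integral>x. l x * test_laplacian \<phi> x \<partial>lborel) + (\<integral>x. W x * p x * \<phi> x \<partial>lborel)
       = z * (\<integral>x. p x * \<phi> x \<partial>lborel)"
proof -
  have H2: "\<psi> \<in> H2" and eq: "\<And>\<phi>. \<phi> \<in> H2 \<Longrightarrow> form_h V \<phi> \<psi> = (\<integral>x. cnj (\<phi> x) * (z * \<psi> x) \<partial>lebesgue)"
    using z by (auto simp: H_op_def)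
  obtain p l where pl: "square_integrable p" "square_integrable l" "AE x in lborel. \<psi> x = p x" "AE x in lborel. laplacian \<psi> x = l x"
    "\<psi> \<in> Lp 2" "laplacian \<psi> \<in> borel_measurable lebesgue"
    "\<forall>\<phi>\<in>test_functions. (\<integral>x. p x * test_laplacian \<phi> x \<partial>lborel) = (\<integral>x. l x * \<phi> x \<partial>lborel)"
    using H2_laplacian[OF H2] .
  obtain W where W: "W \<in> borel_measurable borel" "AE x in lborel. V x = W x"
    using lebesgue_borel_representative[OF V] .
  have "(\<integral>x. l x * test_laplacian \<phi> x \<partial>lborel) + (\<integral>x. W x * p x * \<phi> x \<partial>lborel)
       = z * (\<integral>x. p x * \<phi> x \<partial>lborel)" if \<phi>: "\<phi> \<in> test_functions" for \<phi>
  proof -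
    define \<eta> where "\<eta> x = cnj (\<phi> x)" for x
    have \<eta>: "\<eta> \<in> test_functions" unfolding \<eta>_def by (rule test_function_cnj[OF \<phi>])
    have m: "\<phi> \<in> borel_measurable borel" "p \<in> borel_measurable borel" "l \<in> borel_measurable borel"
      "test_laplacian \<phi> \<in> borel_measurable borel" "\<psi> \<in> borel_measurable lebesgue"
      using test_functionD(6)[OF \<phi>] test_laplacian_test[OF \<phi>] pl(1,2,5) by (auto simp: square_integrable_def Lp_def)
    have m\<phi>: "\<phi> \<in> borel_measurable lebesgue" by (rule measurable_lebesgueI[OF m(1)])
    have lap: "AE x in lborel. cnj (laplacian \<eta> x) = test_laplacian \<phi> x"
      using test_function_H2(2)[OF \<eta>] by eventually_elim (simp add: \<eta>_def[abs_def] test_function_cnj(2)[OF \<phi>])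
    have lm: "laplacian \<eta> \<in> borel_measurable lebesgue"
      using H2_laplacian[OF test_function_H2(1)[OF \<eta>]] by metis
    have 1: "(\<integral>x. cnj (laplacian \<eta> x) * laplacian \<psi> x \<partial>lebesgue) = (\<integral>x. l x * test_laplacian \<phi> x \<partial>lborel)"
    proof (rule integral_lebesgue_eq)
      show "(\<lambda>x. cnj (laplacian \<eta> x) * laplacian \<psi> x) \<in> borel_measurable lebesgue"
        by (intro borel_measurable_times pl(6) measurable_compose[OF lm borel_measurable_continuous_onI])
          (auto intro: continuous_intros)
      show "AE x in lborel. cnj (laplacian \<eta> x) * laplacian \<psi> x = l x * test_laplacian \<phi> x"
        using lap pl(4) by eventually_elim simp
      show "(\<lambda>x. l x * test_laplacian \<phi> x) \<in> borel_measurable borel"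
        by (intro borel_measurable_times m)
    qed
    have 2: "(\<integral>x. V x * cnj (\<eta> x) * \<psi> x \<partial>lebesgue) = (\<integral>x. W x * p x * \<phi> x \<partial>lborel)"
    proof (rule integral_lebesgue_eq)
      show "AE x in lborel. V x * cnj (\<eta> x) * \<psi> x = W x * p x * \<phi> x"
        using W(2) pl(3) by eventually_elim (simp add: \<eta>_def)
      show "(\<lambda>x. V x * cnj (\<eta> x) * \<psi> x) \<in> borel_measurable lebesgue"
        unfolding \<eta>_def complex_cnj_cnj by (intro borel_measurable_times V m\<phi> m)
      show "(\<lambda>x. W x * p x * \<phi> x) \<in> borel_measurable borel"
        by (intro borel_measurable_times W m)
    qed
    have 3: "(\<integral>x. cnj (\<eta> x) * (z * \<psi> x) \<partial>lebesgue) = (\<integral>x. z * (p x * \<phi> x) \<partial>lborel)"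
    proof (rule integral_lebesgue_eq)
      show "AE x in lborel. cnj (\<eta> x) * (z * \<psi> x) = z * (p x * \<phi> x)"
        using pl(3) by eventually_elim (simp add: \<eta>_def)
      show "(\<lambda>x. cnj (\<eta> x) * (z * \<psi> x)) \<in> borel_measurable lebesgue"
        unfolding \<eta>_def complex_cnj_cnj by (intro borel_measurable_times borel_measurable_const m\<phi> m)
      show "(\<lambda>x. z * (p x * \<phi> x)) \<in> borel_measurable borel"
        by (intro borel_measurable_times borel_measurable_const m)
    qed
    show ?thesis
      using eq[OF test_function_H2(1)[OF \<eta>]] unfolding form_h_def 1 2 3 by simp
  qed
  then have "\<forall>\<phi>\<in>test_functions. (\<integral>x. l x * test_laplacian \<phi> x \<partial>lborel) + (\<integral>x. W x * p x * \<phi> x \<partial>lborel)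
       = z * (\<integral>x. p x * \<phi> x \<partial>lborel)" ..
  then show ?thesis by (rule that[OF pl(1,2) W pl(3,7)])
qed

section \<open>A smooth radial parametrix of the Helmholtz operator\<close>

text \<open>The derivatives of $t \mapsto e \cdot e^{-1/(1-t)}$.  The argument will be $|w|^2 / R^2$; the function
  equals $1$ only at the origin, which suffices because it tends to $1$ pointwise as $R \to \infty$.\<close>

definition cutoff :: "nat \<Rightarrow> real \<Rightarrow> real" where
  "cutoff n t = exp 1 * (-1) ^ n * bump n (1 - t)"

lemma cutoff_has_derivative: "(cutoff n has_real_derivative cutoff (Suc n) t) (at t)"
  unfolding cutoff_def[abs_def]
  by (auto intro!: derivative_eq_intros DERIV_chain2[OF bump_has_derivative])

lemma cutoff_eq_0: "t \<ge> 1 \<Longrightarrow> cutoff n t = 0" by (simp add: cutoff_def bump_0)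

lemma cutoff_0_0: "cutoff 0 0 = 1" by (simp add: cutoff_def bump_def exp_minus)

lemma cutoff_bounded: "\<exists>C\<ge>0. \<forall>t\<ge>0. \<bar>cutoff n t\<bar> \<le> C"
proof -
  obtain C where "C \<ge> 0" "\<And>t. t \<le> 1 \<Longrightarrow> \<bar>bump n t\<bar> \<le> C" using bump_bounded by blast
  then show ?thesis
    by (intro exI[of _ "exp 1 * C"]) (auto simp: cutoff_def abs_mult power_abs)
qed

lemma continuous_cutoff: "continuous_on A (cutoff n)"
  by (meson DERIV_continuous_on cutoff_has_derivative has_field_derivative_at_within)

lemma cutoff_borel [measurable]: "cutoff n \<in> borel_measurable borel"
  by (intro borel_measurable_continuous_onI continuous_cutoff)

text \<open>The function $e^{ks}/s$ is $4\pi$ times the fundamental solution of $k^2 - \Delta$; the two functions after it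
  are its first two derivatives with respect to $s^2$.  Radial functions are treated as functions of $|w|^2$, which is smooth also at the
  origin.\<close>

definition helmholtz_kernel :: "complex \<Rightarrow> real \<Rightarrow> complex" where
  "helmholtz_kernel k s = exp (k * of_real s) / of_real s"
definition helmholtz_kernel1 :: "complex \<Rightarrow> real \<Rightarrow> complex" where
  "helmholtz_kernel1 k s = exp (k * of_real s) * (k / of_real s ^ 2 - 1 / of_real s ^ 3) / 2"
definition helmholtz_kernel2 :: "complex \<Rightarrow> real \<Rightarrow> complex" where
  "helmholtz_kernel2 k s = exp (k * of_real s) * (k\<^sup>2 / of_real s ^ 3 - 3 * k / of_real s ^ 4 + 3 / of_real s ^ 5) / 4"

lemma helmholtz_kernel_borel [measurable]:
  "helmholtz_kernel k \<in> borel_measurable borel" "helmholtz_kernel1 k \<in> borel_measurable borel" "helmholtz_kernel2 k \<in> borel_measurable borel"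
  unfolding helmholtz_kernel_def[abs_def] helmholtz_kernel1_def[abs_def] helmholtz_kernel2_def[abs_def]
  by (measurable; (intro borel_measurable_continuous_onI continuous_intros)?)+

lemma helmholtz_kernel_has_derivative: "s > 0 \<Longrightarrow> (helmholtz_kernel k has_vector_derivative of_real (2 * s) * helmholtz_kernel1 k s) (at s)"
  unfolding helmholtz_kernel_def[abs_def] helmholtz_kernel1_def
  by (rule has_vector_derivative_real_field)
    (auto intro!: derivative_eq_intros simp: field_simps power2_eq_square power3_eq_cube)

lemma helmholtz_kernel1_has_derivative: "s > 0 \<Longrightarrow> (helmholtz_kernel1 k has_vector_derivative of_real (2 * s) * helmholtz_kernel2 k s) (at s)"
  unfolding helmholtz_kernel1_def[abs_def] helmholtz_kernel2_def
  by (rule has_vector_derivative_real_field)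
    (auto intro!: derivative_eq_intros simp: field_simps power2_eq_square power3_eq_cube eval_nat_numeral)

text \<open>A derivative with respect to $s^2$ is a derivative with respect to $t$ if $s^2 = t + e^2$.\<close>

lemma regularised_radius_chain:
  fixes f g :: "real \<Rightarrow> complex"
  assumes "e > 0" "t \<ge> 0"
    and "\<And>s. s > 0 \<Longrightarrow> (f has_vector_derivative of_real (2 * s) * g s) (at s)"
  shows "((\<lambda>t. f (sqrt (t + e\<^sup>2))) has_vector_derivative g (sqrt (t + e\<^sup>2))) (at t)"
proof -
  have pos: "t + e\<^sup>2 > 0" using assms by (simp add: add_nonneg_pos)
  have "((\<lambda>t. sqrt (t + e\<^sup>2)) has_vector_derivative inverse (2 * sqrt (t + e\<^sup>2))) (at t)"
    unfolding has_real_derivative_iff_has_vector_derivative[symmetric]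
    using pos by (auto intro!: derivative_eq_intros simp: divide_simps)
  from vector_diff_chain_at[OF this assms(3)]
  have "(f \<circ> (\<lambda>t. sqrt (t + e\<^sup>2)) has_vector_derivative
     inverse (2 * sqrt (t + e\<^sup>2)) *\<^sub>R (of_real (2 * sqrt (t + e\<^sup>2)) * g (sqrt (t + e\<^sup>2)))) (at t)"
    using pos by simp
  moreover have "inverse r *\<^sub>R (of_real r * z) = z" if "r \<noteq> 0" for r and z :: complex
    using that by (simp add: scaleR_conv_of_real)
  then have "inverse (2 * sqrt (t + e\<^sup>2)) *\<^sub>R (of_real (2 * sqrt (t + e\<^sup>2)) * g (sqrt (t + e\<^sup>2))) = g (sqrt (t + e\<^sup>2))"
    using pos by (metis mult_eq_0_iff real_sqrt_eq_zero_cancel_iff less_irrefl zero_neq_numeral)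
  ultimately show ?thesis by (simp add: o_def)
qed

text \<open>In terms of $t = |y-x|^2$ the Laplacian in three dimensions is $4 t H'' + 6 H'$.\<close>

lemma test_laplacian_radial:
  fixes H0 H1 H2 :: "real \<Rightarrow> complex"
  assumes "\<And>t. t \<ge> 0 \<Longrightarrow> (H0 has_vector_derivative H1 t) (at t)"
    and "\<And>t. t \<ge> 0 \<Longrightarrow> (H1 has_vector_derivative H2 t) (at t)"
  shows "test_laplacian (\<lambda>y. H0 ((norm (y - x))\<^sup>2)) y
    = of_real (4 * (norm (y - x))\<^sup>2) * H2 ((norm (y - x))\<^sup>2) + 6 * H1 ((norm (y - x))\<^sup>2)"
proof -
  define q where "q y = (norm (y - x))\<^sup>2" for y
  have q0: "q y \<ge> 0" for y by (simp add: q_def)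
  have dq: "(q has_derivative (\<lambda>v. 2 * ((y - x) \<bullet> v))) (at y)" for y
    unfolding q_def power2_norm_eq_inner
    by (auto intro!: derivative_eq_intros simp: inner_commute)
  have ax: "v \<bullet> axis i 1 = v $ i" for v :: R3 and i by (simp add: inner_axis)
  have p1: "partial_deriv i (\<lambda>y. H0 (q y)) = (\<lambda>y. of_real (2 * (y - x) $ i) * H1 (q y))" for i
    by (rule ext, subst partial_deriv_eqI[OF has_derivative_radial[OF assms(1)[OF q0] dq]]) (simp add: ax)
  have lin: "((\<lambda>y. complex_of_real (2 * (y - x) $ i)) has_derivative (\<lambda>v. of_real (2 * v $ i))) (at y)" for i y
  proof -
    have "((\<lambda>y::R3. 2 * (y - x) $ i) has_derivative (\<lambda>v. 2 * v $ i)) (at y)"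
      by (auto intro!: derivative_eq_intros bounded_linear.has_derivative[OF bounded_linear_vec_nth])
    from bounded_linear.has_derivative[OF bounded_linear_of_real this] show ?thesis .
  qed
  have p2: "partial_deriv i (partial_deriv i (\<lambda>y. H0 (q y))) y
      = of_real (4 * ((y - x) $ i)\<^sup>2) * H2 (q y) + 2 * H1 (q y)" for i
    unfolding p1
    by (subst partial_deriv_eqI[OF has_derivative_mult[OF lin has_derivative_radial[OF assms(2)[OF q0] dq]]])
      (simp add: ax power2_eq_square algebra_simps)
  have "test_laplacian (\<lambda>y. H0 (q y)) y = (\<Sum>i\<in>UNIV. of_real (4 * ((y - x) $ i)\<^sup>2) * H2 (q y)) + (\<Sum>i\<in>(UNIV::3 set). 2 * H1 (q y))"
    unfolding test_laplacian_def p2 by (rule sum.distrib)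
  also have "(\<Sum>i\<in>UNIV. of_real (4 * ((y - x) $ i)\<^sup>2) * H2 (q y)) = of_real (4 * q y) * H2 (q y)"
    unfolding q_def norm_vec3_power2 by (simp add: sum_distrib_left sum_distrib_right)
  finally show ?thesis by (simp add: q_def)
qed

text \<open>Replacing $|w|$ by $\sqrt{|w|^2 + e^2}$ makes the fundamental solution smooth.  The Helmholtz operator
  applied to the truncated kernel then yields an error from the cutoff, which has a limit as $e \to 0$,
  minus an approximation of $4\pi\delta$.\<close>

definition cutoff_kernel :: "complex \<Rightarrow> real \<Rightarrow> real \<Rightarrow> R3 \<Rightarrow> complex" where
  "cutoff_kernel k R e w = of_real (cutoff 0 ((norm w)\<^sup>2 / R\<^sup>2)) * helmholtz_kernel k (sqrt ((norm w)\<^sup>2 + e\<^sup>2))"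

definition approx_delta :: "complex \<Rightarrow> real \<Rightarrow> real \<Rightarrow> R3 \<Rightarrow> complex" where
  "approx_delta k R e w = of_real (4 * e\<^sup>2 * cutoff 0 ((norm w)\<^sup>2 / R\<^sup>2)) * helmholtz_kernel2 k (sqrt ((norm w)\<^sup>2 + e\<^sup>2))"

definition cutoff_error :: "complex \<Rightarrow> real \<Rightarrow> real \<Rightarrow> R3 \<Rightarrow> complex" where
  "cutoff_error k R e w =
     of_real (4 * (norm w)\<^sup>2 * cutoff 2 ((norm w)\<^sup>2 / R\<^sup>2) / R ^ 4 + 6 * cutoff 1 ((norm w)\<^sup>2 / R\<^sup>2) / R\<^sup>2)
       * helmholtz_kernel k (sqrt ((norm w)\<^sup>2 + e\<^sup>2))
   + of_real (8 * (norm w)\<^sup>2 * cutoff 1 ((norm w)\<^sup>2 / R\<^sup>2) / R\<^sup>2) * helmholtz_kernel1 k (sqrt ((norm w)\<^sup>2 + e\<^sup>2))"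

lemma cutoff_kernel_borel [measurable]: "cutoff_kernel k R e \<in> borel_measurable borel"
  and approx_delta_borel [measurable]: "approx_delta k R e \<in> borel_measurable borel"
  and cutoff_error_borel [measurable]: "cutoff_error k R e \<in> borel_measurable borel"
  unfolding cutoff_kernel_def[abs_def] approx_delta_def[abs_def] cutoff_error_def[abs_def] by measurable

lemma cutoff_kernel_test_function:
  assumes "e > 0" "R > 0"
  shows "(\<lambda>y. cutoff_kernel k R e (y - x)) \<in> test_functions"
    "test_laplacian (\<lambda>y. cutoff_kernel k R e (y - x)) y - k\<^sup>2 * cutoff_kernel k R e (y - x) = cutoff_error k R e (y - x) - approx_delta k R e (y - x)"
proof -
  let ?q = "\<lambda>y. (norm (y - x))\<^sup>2 + e\<^sup>2"
  have q: "?q y > 0" for y using assms by (simp add: add_nonneg_pos)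
  have "smooth (\<lambda>y. of_real (?q y powr (1/2)))" "smooth (\<lambda>y. of_real (?q y powr (-1/2)))"
    by (intro smooth_powr q smooth_of_real_add smooth_norm_square smooth_const)+
  moreover have "?q y powr (1/2) = sqrt (?q y)" "?q y powr (-1/2) = 1 / sqrt (?q y)" for y
    using powr_half_sqrt[of "?q y"] powr_minus_divide[of "?q y" "1/2"] q[of y] by simp_all
  ultimately have s: "smooth (\<lambda>y. of_real (sqrt (?q y)))" "smooth (\<lambda>y. of_real (1 / sqrt (?q y)))" by simp_all
  have c: "smooth (\<lambda>y. of_real (exp 1 * bump 0 (1 - 1 / R\<^sup>2 * (norm (y - x))\<^sup>2)))"
    by (intro smooth_of_real_mult smooth_bump smooth_of_real_diff smooth_norm_square smooth_const)
  have "smooth (\<lambda>y. of_real (exp 1 * bump 0 (1 - 1 / R\<^sup>2 * (norm (y - x))\<^sup>2)) *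
      (exp (k * of_real (sqrt (?q y))) * of_real (1 / sqrt (?q y))))"
    by (intro smooth_mult c smooth_exp s)
  then have sm: "smooth (\<lambda>y. cutoff_kernel k R e (y - x))"
    by (simp add: cutoff_kernel_def cutoff_def helmholtz_kernel_def)
  show "(\<lambda>y. cutoff_kernel k R e (y - x)) \<in> test_functions"
  proof (rule smooth_test_function[OF sm, of R x])
    fix y assume "norm (y - x) > R"
    then have "(norm (y - x))\<^sup>2 / R\<^sup>2 \<ge> 1" using assms by (simp add: power_mono)
    then show "cutoff_kernel k R e (y - x) = 0" by (simp add: cutoff_kernel_def cutoff_eq_0)
  qed
  define f0 f1 f2 where "f0 t = helmholtz_kernel k (sqrt (t + e\<^sup>2))" "f1 t = helmholtz_kernel1 k (sqrt (t + e\<^sup>2))" "f2 t = helmholtz_kernel2 k (sqrt (t + e\<^sup>2))" for t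
  define c0 c1 c2 where "c0 t = complex_of_real (cutoff 0 (t / R\<^sup>2))"
    "c1 t = complex_of_real (cutoff 1 (t / R\<^sup>2) / R\<^sup>2)" "c2 t = complex_of_real (cutoff 2 (t / R\<^sup>2) / R ^ 4)" for t
  have f: "(f0 has_vector_derivative f1 t) (at t)" "(f1 has_vector_derivative f2 t) (at t)" if "t \<ge> 0" for t
    unfolding f0_f1_f2_def[abs_def] using assms(1) that
    by (auto intro!: regularised_radius_chain helmholtz_kernel_has_derivative helmholtz_kernel1_has_derivative)
  have c: "(c0 has_vector_derivative c1 t) (at t)" "(c1 has_vector_derivative c2 t) (at t)" for t
    unfolding c0_c1_c2_def[abs_def] using assms
    by (auto intro!: has_vector_derivative_of_real derivative_eq_intros DERIV_chain2[OF cutoff_has_derivative]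
        simp: eval_nat_numeral field_simps)
  define H0 H1 H2 where "H0 t = c0 t * f0 t" "H1 t = c0 t * f1 t + c1 t * f0 t"
    "H2 t = c0 t * f2 t + 2 * c1 t * f1 t + c2 t * f0 t" for t
  have H: "(H0 has_vector_derivative H1 t) (at t)" "(H1 has_vector_derivative H2 t) (at t)" if "t \<ge> 0" for t
  proof -
    show "(H0 has_vector_derivative H1 t) (at t)"
      unfolding H0_H1_H2_def[abs_def] by (intro has_vector_derivative_mult f c that)
    have "((\<lambda>t. c0 t * f1 t + c1 t * f0 t) has_vector_derivative
        (c0 t * f2 t + c1 t * f1 t) + (c1 t * f1 t + c2 t * f0 t)) (at t)"
      by (intro has_vector_derivative_add has_vector_derivative_mult f c that)
    then show "(H1 has_vector_derivative H2 t) (at t)"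
      unfolding H0_H1_H2_def[abs_def] by (simp add: algebra_simps)
  qed
  define t where "t = (norm (y - x))\<^sup>2"
  have e1: "(\<lambda>y. cutoff_kernel k R e (y - x)) = (\<lambda>y. H0 ((norm (y - x))\<^sup>2))"
    by (simp add: cutoff_kernel_def H0_H1_H2_def c0_c1_c2_def f0_f1_f2_def)
  define s where "s = complex_of_real (sqrt (t + e\<^sup>2))"
  have s0: "s \<noteq> 0" using q[of y] unfolding s_def t_def
    by (metis of_real_eq_0_iff real_sqrt_eq_zero_cancel_iff less_irrefl)
  have s2: "s\<^sup>2 = of_real t + (of_real e)\<^sup>2"
    using q[of y] by (simp add: s_def t_def flip: of_real_power of_real_add)
  \<comment> \<open>With $s^2 = t + e^2$ in place of $t$ the left-hand side vanishes, because $e^{ks}/s$ solves the Helmholtz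
     equation; the difference is the approximate delta.\<close>
  have helm: "4 * of_real t * f2 t + 6 * f1 t - k\<^sup>2 * f0 t = - 4 * (of_real e)\<^sup>2 * f2 t"
  proof -
    have "4 * s\<^sup>2 * f2 t + 6 * f1 t - k\<^sup>2 * f0 t = 0"
      using s0 unfolding f0_f1_f2_def helmholtz_kernel_def helmholtz_kernel1_def helmholtz_kernel2_def s_def[symmetric]
      by (simp add: field_simps eval_nat_numeral)
    then show ?thesis unfolding s2 by (simp add: algebra_simps)
  qed
  have "test_laplacian (\<lambda>y. cutoff_kernel k R e (y - x)) y - k\<^sup>2 * cutoff_kernel k R e (y - x) = 4 * of_real t * H2 t + 6 * H1 t - k\<^sup>2 * H0 t"
    using test_laplacian_radial[OF H] unfolding e1 t_def by (simp add: fun_cong[OF e1])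
  also have "\<dots> = c0 t * (4 * of_real t * f2 t + 6 * f1 t - k\<^sup>2 * f0 t) + (4 * of_real t * c2 t + 6 * c1 t) * f0 t + 8 * of_real t * c1 t * f1 t"
    unfolding H0_H1_H2_def by (simp add: algebra_simps)
  also have "\<dots> = cutoff_error k R e (y - x) - approx_delta k R e (y - x)"
    unfolding helm cutoff_error_def approx_delta_def t_def[symmetric] by (simp add: c0_c1_c2_def f0_f1_f2_def)
  finally show "test_laplacian (\<lambda>y. cutoff_kernel k R e (y - x)) y - k\<^sup>2 * cutoff_kernel k R e (y - x) = cutoff_error k R e (y - x) - approx_delta k R e (y - x)" .
qed

lemma sqrt_ge_norm: "norm w \<le> sqrt ((norm w)\<^sup>2 + e\<^sup>2)" "\<bar>e\<bar> \<le> sqrt ((norm w)\<^sup>2 + e\<^sup>2)"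
  by (rule real_le_rsqrt; simp)+

lemma norm_exp_le: "Re k \<le> 0 \<Longrightarrow> s \<ge> 0 \<Longrightarrow> norm (exp (k * of_real s)) \<le> 1"
  by (simp add: mult_nonpos_nonneg)

lemma helmholtz_kernel_bounds:
  assumes "Re k \<le> 0" "s > 0"
  shows "norm (helmholtz_kernel k s) \<le> 1 / s" "norm (helmholtz_kernel1 k s) \<le> (norm k / s\<^sup>2 + 1 / s ^ 3) / 2"
    "norm (helmholtz_kernel2 k s) \<le> ((norm k)\<^sup>2 / s ^ 3 + 3 * norm k / s ^ 4 + 3 / s ^ 5) / 4"
proof -
  have e: "norm (exp (k * of_real s)) \<le> 1" using norm_exp_le assms by simp
  show "norm (helmholtz_kernel k s) \<le> 1 / s"
    using assms e by (simp add: helmholtz_kernel_def norm_divide divide_right_mono)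
  have "norm (k / of_real s ^ 2 - 1 / of_real s ^ 3) \<le> norm k / s\<^sup>2 + 1 / s ^ 3"
    using assms norm_triangle_ineq4[of "k / of_real s ^ 2" "1 / of_real s ^ 3"] by (simp add: norm_divide norm_power)
  then show "norm (helmholtz_kernel1 k s) \<le> (norm k / s\<^sup>2 + 1 / s ^ 3) / 2"
    using mult_mono[OF e] by (fastforce simp: helmholtz_kernel1_def norm_divide norm_mult)
  have "norm (k\<^sup>2 / of_real s ^ 3 - 3 * k / of_real s ^ 4 + 3 / of_real s ^ 5) \<le>
      norm (k\<^sup>2 / of_real s ^ 3) + norm (3 * k / of_real s ^ 4) + norm (3 / complex_of_real s ^ 5)"
    by (intro norm_triangle_le add_mono norm_triangle_ineq4) simp
  then have "norm (k\<^sup>2 / of_real s ^ 3 - 3 * k / of_real s ^ 4 + 3 / of_real s ^ 5) \<le> (norm k)\<^sup>2 / s ^ 3 + 3 * norm k / s ^ 4 + 3 / s ^ 5"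
    using assms by (simp add: norm_divide norm_power norm_mult)
  then show "norm (helmholtz_kernel2 k s) \<le> ((norm k)\<^sup>2 / s ^ 3 + 3 * norm k / s ^ 4 + 3 / s ^ 5) / 4"
    using mult_mono[OF e] by (fastforce simp: helmholtz_kernel2_def norm_divide norm_mult)
qed

lemma kernels_vanish_outside:
  assumes "R > 0" "norm w > R"
  shows "cutoff_kernel k R e w = 0" "approx_delta k R e w = 0" "cutoff_error k R e w = 0"
proof -
  have "(norm w)\<^sup>2 / R\<^sup>2 \<ge> 1" using assms by (simp add: power_mono)
  then show "cutoff_kernel k R e w = 0" "approx_delta k R e w = 0" "cutoff_error k R e w = 0"
    by (simp_all add: cutoff_kernel_def approx_delta_def cutoff_error_def cutoff_eq_0)
qed

lemma cutoff_kernel_bound: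
  assumes "Re k \<le> 0" shows "\<exists>C\<ge>0. \<forall>R>0. \<forall>e. \<forall>w. w \<noteq> 0 \<longrightarrow> norm (cutoff_kernel k R e w) \<le> C / norm w"
proof -
  obtain C where C: "C \<ge> 0" "\<And>t. t \<ge> 0 \<Longrightarrow> \<bar>cutoff 0 t\<bar> \<le> C" using cutoff_bounded by blast
  have "norm (cutoff_kernel k R e w) \<le> C / norm w" if "w \<noteq> 0" "R > 0" for R e w
  proof -
    let ?s = "sqrt ((norm w)\<^sup>2 + e\<^sup>2)"
    have s: "norm w \<le> ?s" "0 < norm w" using sqrt_ge_norm that by auto
    have sp: "0 < ?s" using s by linarith
    have "norm (helmholtz_kernel k ?s) \<le> 1 / norm w"
      by (rule order_trans[OF helmholtz_kernel_bounds(1)[OF assms sp] frac_le]) (use s in auto)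
    then have "norm (cutoff_kernel k R e w) \<le> C * (1 / norm w)"
      unfolding cutoff_kernel_def norm_mult using C by (intro mult_mono) auto
    then show ?thesis by simp
  qed
  then show ?thesis using C(1) by blast
qed

text \<open>On the support of the cutoff its first and second derivatives with respect to $|w|^2$ are of order
  $R^{-2}$ and $R^{-4}$, and they come with factors $|w|^2 \le R^2$.  In the term with the derivative of the
  kernel the factor $|w|^2$ absorbs two powers of the singularity $|w|^{-3}$.\<close>

lemma cutoff_error_bound:
  assumes "Re k \<le> 0"
  shows "\<exists>C\<ge>0. \<forall>R>0. \<forall>e w. w \<noteq> 0 \<longrightarrow> norm (cutoff_error k R e w) \<le> C / R\<^sup>2 * (1 + 1 / norm w)"
proof -
  obtain C1 where C1: "C1 \<ge> 0" "\<And>t. t \<ge> 0 \<Longrightarrow> \<bar>cutoff 1 t\<bar> \<le> C1" using cutoff_bounded by blast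
  obtain C2 where C2: "C2 \<ge> 0" "\<And>t. t \<ge> 0 \<Longrightarrow> \<bar>cutoff 2 t\<bar> \<le> C2" using cutoff_bounded by blast
  define C where "C = 4 * C2 + 10 * C1 + 4 * C1 * norm k"
  have C0: "C \<ge> 0" using C1 C2 by (simp add: C_def)
  have "norm (cutoff_error k R e w) \<le> C / R\<^sup>2 * (1 + 1 / norm w)" if "w \<noteq> 0" "R > 0" for R e w
  proof (cases "norm w > R")
    case True
    then show ?thesis using kernels_vanish_outside that C0 by simp
  next
    case False
    let ?s = "sqrt ((norm w)\<^sup>2 + e\<^sup>2)" and ?t = "(norm w)\<^sup>2"
    have s: "norm w \<le> ?s" "0 < norm w" using sqrt_ge_norm that by auto
    have sp: "0 < ?s" using s by linarith
    have t: "?t \<le> R\<^sup>2" using False that by (simp add: power_mono)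
    have "norm (helmholtz_kernel k ?s) \<le> 1 / norm w"
      by (rule order_trans[OF helmholtz_kernel_bounds(1)[OF assms sp] frac_le]) (use s in auto)
    moreover have "\<bar>4 * ?t * cutoff 2 (?t / R\<^sup>2) / R ^ 4 + 6 * cutoff 1 (?t / R\<^sup>2) / R\<^sup>2\<bar> \<le> (4 * C2 + 6 * C1) / R\<^sup>2"
    proof -
      have "\<bar>4 * ?t * cutoff 2 (?t / R\<^sup>2) / R ^ 4\<bar> \<le> 4 * R\<^sup>2 * C2 / R ^ 4"
        unfolding abs_divide abs_mult using t C2 that by (intro frac_le mult_mono) auto
      moreover have "4 * R\<^sup>2 * C2 / R ^ 4 = 4 * C2 / R\<^sup>2" using that by (simp add: field_simps eval_nat_numeral)
      moreover have "\<bar>6 * cutoff 1 (?t / R\<^sup>2) / R\<^sup>2\<bar> \<le> 6 * C1 / R\<^sup>2"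
        unfolding abs_divide abs_mult using C1 that by (intro frac_le mult_mono) auto
      ultimately show ?thesis unfolding add_divide_distrib by linarith
    qed
    ultimately have 1: "norm (of_real (4 * ?t * cutoff 2 (?t / R\<^sup>2) / R ^ 4 + 6 * cutoff 1 (?t / R\<^sup>2) / R\<^sup>2) * helmholtz_kernel k ?s)
        \<le> (4 * C2 + 6 * C1) / R\<^sup>2 * (1 / norm w)"
      unfolding norm_mult norm_of_real using C1 C2 by (intro mult_mono) auto
    have "?t * norm (helmholtz_kernel1 k ?s) \<le> ?s\<^sup>2 * ((norm k / ?s\<^sup>2 + 1 / ?s ^ 3) / 2)"
      using s by (intro mult_mono helmholtz_kernel_bounds assms power_mono sp) auto
    also have "\<dots> = (norm k + 1 / ?s) / 2"
      using s by (simp add: field_simps eval_nat_numeral del: real_sqrt_pow2 real_sqrt_mult_self real_sqrt_power_even)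
    also have "\<dots> \<le> (norm k + 1 / norm w) / 2"
      using s by (intro divide_right_mono add_mono frac_le) auto
    finally have "?t * norm (helmholtz_kernel1 k ?s) \<le> (norm k + 1 / norm w) / 2" .
    moreover have "\<bar>8 * cutoff 1 (?t / R\<^sup>2) / R\<^sup>2\<bar> \<le> 8 * C1 / R\<^sup>2"
      unfolding abs_divide abs_mult using C1 that by (intro frac_le mult_mono) auto
    ultimately have "\<bar>8 * cutoff 1 (?t / R\<^sup>2) / R\<^sup>2\<bar> * (?t * norm (helmholtz_kernel1 k ?s)) \<le> 8 * C1 / R\<^sup>2 * ((norm k + 1 / norm w) / 2)"
      using C1 by (intro mult_mono) auto
    moreover have "norm (of_real (8 * ?t * cutoff 1 (?t / R\<^sup>2) / R\<^sup>2) * helmholtz_kernel1 k ?s)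
        = \<bar>8 * cutoff 1 (?t / R\<^sup>2) / R\<^sup>2\<bar> * (?t * norm (helmholtz_kernel1 k ?s))"
      unfolding norm_mult norm_of_real abs_divide abs_mult by simp
    moreover have "8 * C1 / R\<^sup>2 * ((norm k + 1 / norm w) / 2) = 4 * C1 / R\<^sup>2 * (norm k + 1 / norm w)" by simp
    ultimately have 2: "norm (of_real (8 * ?t * cutoff 1 (?t / R\<^sup>2) / R\<^sup>2) * helmholtz_kernel1 k ?s) \<le> 4 * C1 / R\<^sup>2 * (norm k + 1 / norm w)"
      by (simp only:)
    have "norm (cutoff_error k R e w) \<le> (4 * C2 + 6 * C1) / R\<^sup>2 * (1 / norm w) + 4 * C1 / R\<^sup>2 * (norm k + 1 / norm w)"
      unfolding cutoff_error_def by (rule order_trans[OF norm_triangle_ineq add_mono[OF 1 2]])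
    also have "\<dots> = ((4 * C2 + 10 * C1) * (1 / norm w) + 4 * C1 * norm k * 1) / R\<^sup>2"
    proof -
      have "(4 * C2 + 6 * C1) / D * X + 4 * C1 / D * (n + X) = ((4 * C2 + 10 * C1) * X + 4 * C1 * n * 1) / D"
        for D X n :: real by (cases "D = 0") (simp_all add: field_simps)
      then show ?thesis .
    qed
    also have "\<dots> \<le> ((4 * C2 + 10 * C1) * (1 + 1 / norm w) + 4 * C1 * norm k * (1 + 1 / norm w)) / R\<^sup>2"
      using C1 C2 by (intro divide_right_mono add_mono mult_left_mono) auto
    also have "\<dots> = C / R\<^sup>2 * (1 + 1 / norm w)" by (simp add: C_def field_simps)
    finally show ?thesis .
  qed
  then show ?thesis using C0 by blast
qed

section \<open>Convolution with a compactly supported kernel\<close>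

lemma integral_lborel_affine:
  fixes f :: "R3 \<Rightarrow> complex"
  assumes "c \<noteq> 0" and [measurable]: "f \<in> borel_measurable borel"
  shows "(\<integral>x. f x \<partial>lborel) = (\<integral>x. of_real (\<bar>c\<bar> ^ 3) * f (t + c *\<^sub>R x) \<partial>lborel)"
proof -
  have "(\<integral>x. f x \<partial>lborel) = (\<integral>x. f x \<partial>density (distr lborel borel (\<lambda>x. t + c *\<^sub>R x)) (\<lambda>_. ennreal (\<bar>c\<bar> ^ 3)))"
    by (subst lborel_affine[OF assms(1), of t]) (simp add: ennreal_power)
  also have "\<dots> = (\<integral>x. \<bar>c\<bar> ^ 3 *\<^sub>R f (t + c *\<^sub>R x) \<partial>lborel)"
    by (subst integral_density) (auto simp: integral_distr)
  finally show ?thesis by (simp add: scaleR_conv_of_real)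
qed

lemma nn_integral_lborel_reflect:
  fixes f :: "R3 \<Rightarrow> ennreal"
  assumes [measurable]: "f \<in> borel_measurable borel"
  shows "(\<integral>\<^sup>+x. f (y - x) \<partial>lborel) = (\<integral>\<^sup>+x. f x \<partial>lborel)"
proof -
  have "(\<integral>\<^sup>+x. f x \<partial>lborel) = (\<integral>\<^sup>+x. f x \<partial>density (distr lborel borel (\<lambda>x. y + (-1) *\<^sub>R x)) (\<lambda>_. ennreal (\<bar>-1\<bar> ^ DIM(R3))))"
    by (subst lborel_affine[of "-1" y]) (simp_all add: ennreal_power)
  also have "\<dots> = (\<integral>\<^sup>+x. f (y - x) \<partial>lborel)"
    by (subst nn_integral_density) (auto simp: nn_integral_distr)
  finally show ?thesis ..
qed

lemma nn_integral_lborel_shift: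
  fixes f :: "R3 \<Rightarrow> ennreal"
  assumes [measurable]: "f \<in> borel_measurable borel"
  shows "(\<integral>\<^sup>+x. f (x - y) \<partial>lborel) = (\<integral>\<^sup>+x. f x \<partial>lborel)"
proof -
  have "(\<integral>\<^sup>+x. f x \<partial>lborel) = (\<integral>\<^sup>+x. f x \<partial>distr lborel borel ((+) (- y)))"
    by (simp add: lborel_distr_plus)
  also have "\<dots> = (\<integral>\<^sup>+x. f (x - y) \<partial>lborel)"
    by (subst nn_integral_distr) (auto simp: algebra_simps)
  finally show ?thesis ..
qed

lemma convolution_measurable:
  fixes h u k :: "R3 \<Rightarrow> complex"
  assumes [measurable]: "h \<in> borel_measurable borel" "u \<in> borel_measurable borel" "k \<in> borel_measurable borel"
  shows "(\<lambda>(x, y). h x * u y * k (y - x)) \<in> borel_measurable (lborel \<Otimes>\<^sub>M lborel)"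
  by measurable

text \<open>The integral over $x$ is at most a constant, and only $y$ in a bounded set contribute.\<close>

lemma convolution_integrable:
  fixes h u k :: "R3 \<Rightarrow> complex"
  assumes u: "locally_integrable u" and h[measurable]: "h \<in> borel_measurable borel"
    and hb: "\<And>x. norm (h x) \<le> C" "\<And>x. norm x > r \<Longrightarrow> h x = 0"
    and k: "integrable lborel k" "\<And>w. norm w > R \<Longrightarrow> k w = 0"
  shows "integrable (lborel \<Otimes>\<^sub>M lborel) (\<lambda>(x, y). h x * u y * k (y - x))"
proof (rule integrableI_bounded)
  have [measurable]: "u \<in> borel_measurable borel" "k \<in> borel_measurable borel"
    using locally_integrable_measurable[OF u] borel_measurable_integrable[OF k(1)] by auto
  show m: "(\<lambda>(x, y). h x * u y * k (y - x)) \<in> borel_measurable (lborel \<Otimes>\<^sub>M lborel)"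
    by (intro convolution_measurable) measurable
  have C: "C \<ge> 0" using norm_ge_zero[of "h 0"] hb(1)[of 0] by linarith
  define K where "K = (\<integral>\<^sup>+w. norm (k w) \<partial>lborel)"
  have K: "K < \<infinity>" unfolding K_def using k(1) by (simp add: integrable_iff_bounded)
  define U where "U y = C * norm (indicator (cball 0 (r + R)) y *\<^sub>R u y)" for y
  have U: "integrable lborel U" unfolding U_def
    by (intro integrable_mult_right integrable_norm) (use u in \<open>simp add: locally_integrable_def set_integrable_def\<close>)
  have [measurable]: "U \<in> borel_measurable borel" using borel_measurable_integrable[OF U] by simp
  have U0: "U y \<ge> 0" for y using C by (simp add: U_def)
  have "(\<integral>\<^sup>+p. ennreal (norm (case p of (x, y) \<Rightarrow> h x * u y * k (y - x))) \<partial>(lborel \<Otimes>\<^sub>M lborel))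
      = (\<integral>\<^sup>+y. \<integral>\<^sup>+x. ennreal (norm (h x * u y * k (y - x))) \<partial>lborel \<partial>lborel)"
    using m by (subst lborel_pair.nn_integral_snd[symmetric]) auto
  also have "\<dots> \<le> (\<integral>\<^sup>+y. \<integral>\<^sup>+x. ennreal (U y) * ennreal (norm (k (y - x))) \<partial>lborel \<partial>lborel)"
  proof (intro nn_integral_mono)
    fix x y :: R3
    have "norm (h x * u y * k (y - x)) \<le> U y * norm (k (y - x))"
    proof (cases "norm (y - x) \<le> R \<and> norm x \<le> r")
      case True
      then have "norm y \<le> r + R" using norm_triangle_ineq[of x "y - x"] by simp
      then show ?thesis using hb(1) by (auto simp: U_def norm_mult intro!: mult_right_mono)
    next
      case False
      then have "h x = 0 \<or> k (y - x) = 0" using hb(2) k(2) by force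
      then show ?thesis using U0 by auto
    qed
    then show "ennreal (norm (h x * u y * k (y - x))) \<le> ennreal (U y) * ennreal (norm (k (y - x)))"
      using U0 by (simp add: ennreal_mult[symmetric] ennreal_leI)
  qed
  also have "\<dots> = (\<integral>\<^sup>+y. ennreal (U y) * K \<partial>lborel)"
    unfolding K_def using nn_integral_lborel_reflect[of "\<lambda>w. ennreal (norm (k w))"]
    by (simp add: nn_integral_cmult)
  also have "\<dots> = (\<integral>\<^sup>+y. ennreal (U y) \<partial>lborel) * K" by (simp add: nn_integral_multc)
  also have "\<dots> < \<infinity>" using U K U0 by (simp add: integrable_iff_bounded ennreal_mult_less_top)
  finally show "(\<integral>\<^sup>+p. ennreal (norm (case p of (x, y) \<Rightarrow> h x * u y * k (y - x))) \<partial>(lborel \<Otimes>\<^sub>M lborel)) < \<infinity>" .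
qed

text \<open>The kernels are controlled only away from the origin; the diagonal is a null set.\<close>

lemma AE_pair_neq: "AE p in (lborel \<Otimes>\<^sub>M lborel :: (R3 \<times> R3) measure). snd p - fst p \<noteq> 0"
proof (rule lborel_pair.AE_pair_measure)
  show "{x \<in> space (lborel \<Otimes>\<^sub>M lborel). snd x - fst x \<noteq> (0::R3)} \<in> sets (lborel \<Otimes>\<^sub>M lborel)"
    by measurable
  show "AE x in lborel. AE y in lborel. snd (x, y) - fst (x, y) \<noteq> (0::R3)"
  proof (rule AE_I2)
    fix x :: R3
    show "AE y in lborel. snd (x, y) - fst (x, y) \<noteq> 0"
      using AE_lborel_singleton[of x] by eventually_elim simp
  qed
qed

lemma convolution_tendsto:
  fixes h u :: "R3 \<Rightarrow> complex" and k :: "nat \<Rightarrow> R3 \<Rightarrow> complex"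
  assumes u: "locally_integrable u" and h[measurable]: "h \<in> borel_measurable borel"
    and hb: "\<And>x. norm (h x) \<le> C" "\<And>x. norm x > r \<Longrightarrow> h x = 0"
    and k[measurable]: "\<And>n. k n \<in> borel_measurable borel" "k' \<in> borel_measurable borel"
    and D: "integrable lborel D" "\<And>w. norm w > R \<Longrightarrow> D w = 0" "\<And>n w. w \<noteq> 0 \<Longrightarrow> norm (k n w) \<le> D w"
    and lim: "\<And>w. w \<noteq> 0 \<Longrightarrow> (\<lambda>n. k n w) \<longlonglongrightarrow> k' w"
  shows "(\<lambda>n. \<integral>(x, y). h x * u y * k n (y - x) \<partial>(lborel \<Otimes>\<^sub>M lborel))
    \<longlonglongrightarrow> (\<integral>(x, y). h x * u y * k' (y - x) \<partial>(lborel \<Otimes>\<^sub>M lborel))"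
proof (rule integral_dominated_convergence)
  have [measurable]: "u \<in> borel_measurable borel" by (rule locally_integrable_measurable[OF u])
  show "(\<lambda>(x, y). h x * u y * k' (y - x)) \<in> borel_measurable (lborel \<Otimes>\<^sub>M lborel)"
    "(\<lambda>(x, y). h x * u y * k n (y - x)) \<in> borel_measurable (lborel \<Otimes>\<^sub>M lborel)" for n
    by (intro convolution_measurable; measurable)+
  have "integrable lborel (\<lambda>w. complex_of_real (D w))" using D(1) by simp
  note conv = convolution_integrable[OF u h hb this, where R = R]
  show "integrable (lborel \<Otimes>\<^sub>M lborel) (\<lambda>p. norm (case p of (x, y) \<Rightarrow> h x * u y * complex_of_real (D (y - x))))"
    by (intro integrable_norm conv) (use D(2) in simp_all)
  show "AE p in lborel \<Otimes>\<^sub>M lborel. (\<lambda>n. case p of (x, y) \<Rightarrow> h x * u y * k n (y - x)) \<longlonglongrightarrow> (case p of (x, y) \<Rightarrow> h x * u y * k' (y - x))"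
    using AE_pair_neq by eventually_elim (auto intro!: tendsto_mult lim)
  show "AE p in lborel \<Otimes>\<^sub>M lborel. norm (case p of (x, y) \<Rightarrow> h x * u y * k n (y - x))
      \<le> norm (case p of (x, y) \<Rightarrow> h x * u y * complex_of_real (D (y - x)))" for n
    using AE_pair_neq by eventually_elim
      (auto simp: norm_mult intro!: mult_left_mono order_trans[OF D(3)])
qed

lemma convolution_locally_integrable:
  assumes u: "locally_integrable u" and k: "integrable lborel k" "\<And>w. norm w > R \<Longrightarrow> k w = 0"
  shows "locally_integrable (\<lambda>x. \<integral>y. u y * k (y - x) \<partial>lborel)"
  unfolding locally_integrable_def set_integrable_def
proof
  fix r
  have "integrable (lborel \<Otimes>\<^sub>M lborel) (\<lambda>(x, y). complex_of_real (indicator (cball 0 r) x) * u y * k (y - x))"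
    by (rule convolution_integrable[OF u _ _ _ k, where C = 1 and r = r]) (auto simp: indicator_def)
  from lborel_pair.integrable_fst[OF this]
  show "integrable lborel (\<lambda>x. indicator (cball 0 r) x *\<^sub>R (\<integral>y. u y * k (y - x) \<partial>lborel))"
    by (simp add: scaleR_conv_of_real mult.assoc)
qed

lemma convolution_fubini:
  assumes u: "locally_integrable u" and h: "h \<in> test_functions" and k: "integrable lborel k" "\<And>w. norm w > R \<Longrightarrow> k w = 0"
  shows "(\<integral>(x, y). h x * u y * k (y - x) \<partial>(lborel \<Otimes>\<^sub>M lborel)) = (\<integral>x. h x * (\<integral>y. u y * k (y - x) \<partial>lborel) \<partial>lborel)"
    "(\<integral>(x, y). h x * u y * k (y - x) \<partial>(lborel \<Otimes>\<^sub>M lborel)) = (\<integral>y. u y * (\<integral>x. h x * k (y - x) \<partial>lborel) \<partial>lborel)"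
    "integrable (lborel \<Otimes>\<^sub>M lborel) (\<lambda>(x, y). h x * u y * k (y - x))"
proof -
  obtain C where C: "\<And>x. norm (h x) \<le> C" using test_functionD(4)[OF h] by auto
  obtain r where r: "\<And>x. norm x > r \<Longrightarrow> h x = 0" using test_functionD(5)[OF h] by auto
  show int: "integrable (lborel \<Otimes>\<^sub>M lborel) (\<lambda>(x, y). h x * u y * k (y - x))"
    by (rule convolution_integrable[OF u test_functionD(6)[OF h] C r k])
  show "(\<integral>(x, y). h x * u y * k (y - x) \<partial>(lborel \<Otimes>\<^sub>M lborel)) = (\<integral>x. h x * (\<integral>y. u y * k (y - x) \<partial>lborel) \<partial>lborel)"
    by (subst lborel_pair.integral_fst[OF int, symmetric]) (simp add: mult.assoc)
  show "(\<integral>(x, y). h x * u y * k (y - x) \<partial>(lborel \<Otimes>\<^sub>M lborel)) = (\<integral>y. u y * (\<integral>x. h x * k (y - x) \<partial>lborel) \<partial>lborel)"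
  proof -
    have eq: "h x * u y * k (y - x) = u y * (h x * k (y - x))" for x y by simp
    show ?thesis
      by (subst lborel_pair.integral_snd[OF int, symmetric]) (simp only: eq integral_mult_right_zero)
  qed
qed

lemma integrable_inverse_norm_ball:
  "integrable lborel (\<lambda>w::R3. indicator (cball 0 R) w * (a + b / norm w))"
proof -
  have "integrable lborel (\<lambda>w::R3. indicator (cball 0 R) w * (1 / norm w))"
  proof (cases "R \<ge> 0")
    case True
    show ?thesis
    proof (rule integrableI_nonneg)
      have "(\<integral>\<^sup>+w. ennreal (indicator (cball 0 R) w * (1 / norm (w::R3))) \<partial>lborel)
          = (\<integral>\<^sup>+w. ennreal (1 / norm (w::R3)) * indicator {0..R} (norm w) \<partial>lborel)"
        by (intro nn_integral_cong) (auto simp: indicator_def)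
      also have "\<dots> = ennreal (2 * pi * R\<^sup>2 - 2 * pi * 0\<^sup>2)"
        by (rule nn_integral_radial_FTC[where g = "\<lambda>r. 1 / r"])
          (use True in \<open>auto intro!: derivative_eq_intros simp: power2_eq_square\<close>)
      finally show "(\<integral>\<^sup>+w. ennreal (indicator (cball 0 R) w * (1 / norm (w::R3))) \<partial>lborel) < \<infinity>"
        by simp
    qed auto
  qed (auto simp: cball_empty)
  then have "integrable lborel (\<lambda>w::R3. a * indicator (cball 0 R) w + b * (indicator (cball 0 R) w * (1 / norm w)))"
    by (intro Bochner_Integration.integrable_add integrable_mult_right integrable_indicator_cball)
  then show ?thesis by (simp add: algebra_simps)
qed


section \<open>The parametrix in the limit of vanishing regularisation\<close>

text \<open>An antiderivative of $4\pi r^2 \cdot 3 (1+r^2)^{-5/2}$ is $4\pi (r / \sqrt{1+r^2})^3$.  This value produces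
  the factor $4\pi$ in the representation of solutions.\<close>

lemma nn_integral_delta_profile: "(\<integral>\<^sup>+v. ennreal (3 / sqrt (1 + (norm (v::R3))\<^sup>2) ^ 5) \<partial>lborel) = ennreal (4 * pi)"
proof -
  have pos: "1 + r\<^sup>2 > 0" for r :: real by (simp add: add_pos_nonneg)
  have d: "((\<lambda>r. 4 * pi * (r / sqrt (1 + r\<^sup>2)) ^ 3) has_real_derivative 4 * pi * r\<^sup>2 * (3 / sqrt (1 + r\<^sup>2) ^ 5)) (at r)" for r
  proof -
    define s where "s = sqrt (1 + r\<^sup>2)"
    have s: "s > 0" "s\<^sup>2 = 1 + r\<^sup>2" using pos[of r] by (simp_all add: s_def)
    have ds: "((\<lambda>r. sqrt (1 + r\<^sup>2)) has_real_derivative r / s) (at r)"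
      using pos[of r] by (auto intro!: derivative_eq_intros simp: s_def divide_simps)
    have "((\<lambda>r. r / sqrt (1 + r\<^sup>2)) has_real_derivative (s - r * (r / s)) / s\<^sup>2) (at r)"
      using DERIV_divide[OF DERIV_ident ds] s(1) unfolding s_def[symmetric] power2_eq_square[of s] by simp
    moreover have "(s - r * (r / s)) / s\<^sup>2 = 1 / s ^ 3"
    proof -
      have "s - r * (r / s) = (s\<^sup>2 - r\<^sup>2) / s" using s(1) by (simp add: field_simps power2_eq_square)
      then show ?thesis using s by (simp add: eval_nat_numeral)
    qed
    ultimately have "((\<lambda>r. r / sqrt (1 + r\<^sup>2)) has_real_derivative 1 / s ^ 3) (at r)" by simp
    show ?thesis
      by (rule DERIV_cong[OF DERIV_cmult[OF DERIV_power[OF \<open>((\<lambda>r. r / sqrt (1 + r\<^sup>2)) has_real_derivative 1 / s ^ 3) (at r)\<close>]]])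
        (unfold s_def[symmetric], use s(1) in \<open>simp add: power_divide eval_nat_numeral\<close>)
  qed
  have lim: "((\<lambda>r. r / sqrt (1 + r\<^sup>2)) \<longlongrightarrow> 1) at_top"
  proof -
    have "((\<lambda>r::real. 1 / sqrt (1 + (inverse r)\<^sup>2)) \<longlongrightarrow> 1 / sqrt (1 + 0\<^sup>2)) at_top"
      by (intro tendsto_intros tendsto_inverse_0_at_top filterlim_ident) simp
    moreover have "\<forall>\<^sub>F r in at_top. 1 / sqrt (1 + (inverse r)\<^sup>2) = r / sqrt (1 + r\<^sup>2)"
      using eventually_gt_at_top[of 0]
    proof eventually_elim
      case (elim r)
      have "1 + (inverse r)\<^sup>2 = (1 + r\<^sup>2) / r\<^sup>2" using elim by (simp add: field_simps)
      then show ?case using elim by (simp add: real_sqrt_divide)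
    qed
    ultimately show ?thesis by (auto intro: Lim_transform_eventually)
  qed
  have "((\<lambda>r. 4 * pi * (r / sqrt (1 + r\<^sup>2)) ^ 3) \<longlongrightarrow> 4 * pi * 1 ^ 3) at_top"
    by (intro tendsto_intros lim)
  from nn_integral_radial_FTC_at_top[OF _ order_refl d _ this]
  have "(\<integral>\<^sup>+v. ennreal (3 / sqrt (1 + (norm (v::R3))\<^sup>2) ^ 5) * indicator {0..} (norm v) \<partial>lborel) = ennreal (4 * pi)"
    by simp
  then show ?thesis by simp
qed

text \<open>An antiderivative of $4\pi r^2 (1+r^2)^{-2}$ is $2\pi (\arctan r - r/(1+r^2))$.\<close>

lemma integrable_delta_majorant: "integrable lborel (\<lambda>v::R3. 1 / sqrt (1 + (norm v)\<^sup>2) ^ 4)"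
proof (rule integrableI_nonneg)
  have pos: "1 + r\<^sup>2 \<noteq> 0" for r :: real using zero_le_power2[of r] by linarith
  have s4: "sqrt (1 + r\<^sup>2) ^ 4 = (1 + r\<^sup>2)\<^sup>2" for r :: real
    using power_mult[of "sqrt (1 + r\<^sup>2)" 2 2] by simp
  have d: "((\<lambda>r. 2 * pi * (arctan r - r / (1 + r\<^sup>2))) has_real_derivative 4 * pi * r\<^sup>2 * (1 / sqrt (1 + r\<^sup>2) ^ 4)) (at r)" for r
  proof -
    have "((\<lambda>r. 2 * pi * (arctan r - r / (1 + r\<^sup>2))) has_real_derivative
        2 * pi * (1 / (1 + r\<^sup>2) - ((1 + r\<^sup>2) - r * (2 * r)) / ((1 + r\<^sup>2) * (1 + r\<^sup>2)))) (at r)"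
      using pos[of r] by (auto intro!: derivative_eq_intros simp: inverse_eq_divide)
    moreover have "2 * pi * (1 / (1 + r\<^sup>2) - ((1 + r\<^sup>2) - r * (2 * r)) / ((1 + r\<^sup>2) * (1 + r\<^sup>2))) = 4 * pi * r\<^sup>2 * (1 / sqrt (1 + r\<^sup>2) ^ 4)"
      unfolding s4 using pos[of r] by (simp add: divide_simps) (simp add: power2_eq_square algebra_simps)
    ultimately show ?thesis by simp
  qed
  have "((\<lambda>r::real. inverse r / (1 + (inverse r)\<^sup>2)) \<longlongrightarrow> 0 / (1 + 0\<^sup>2)) at_top"
    by (intro tendsto_intros tendsto_inverse_0_at_top filterlim_ident) simp
  moreover have "\<forall>\<^sub>F r::real in at_top. inverse r / (1 + (inverse r)\<^sup>2) = r / (1 + r\<^sup>2)"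
    using eventually_gt_at_top[of "0::real"]
  proof eventually_elim
    case (elim r)
    then show ?case using pos[of r] pos[of "inverse r"] by (simp add: divide_simps power2_eq_square add.commute)
  qed
  ultimately have lim: "((\<lambda>r::real. r / (1 + r\<^sup>2)) \<longlongrightarrow> 0) at_top" by (auto intro: Lim_transform_eventually)
  have "((\<lambda>r. 2 * pi * (arctan r - r / (1 + r\<^sup>2))) \<longlongrightarrow> 2 * pi * (pi / 2 - 0)) at_top"
    by (intro tendsto_intros lim tendsto_arctan_at_top)
  from nn_integral_radial_FTC_at_top[OF _ order_refl d _ this]
  have "(\<integral>\<^sup>+v. ennreal (1 / sqrt (1 + (norm (v::R3))\<^sup>2) ^ 4) * indicator {0..} (norm v) \<partial>lborel) = ennreal (2 * pi * (pi / 2) - 0)"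
    by simp
  then show "(\<integral>\<^sup>+v. ennreal (1 / sqrt (1 + (norm (v::R3))\<^sup>2) ^ 4) \<partial>lborel) < \<infinity>" by simp
qed auto

lemma helmholtz_kernel_tendsto: "s > 0 \<Longrightarrow> (f \<longlongrightarrow> s) F \<Longrightarrow> ((\<lambda>n. helmholtz_kernel k (f n)) \<longlongrightarrow> helmholtz_kernel k s) F"
  using isCont_tendsto_compose has_vector_derivative_continuous[OF helmholtz_kernel_has_derivative] by blast

lemma helmholtz_kernel1_tendsto: "s > 0 \<Longrightarrow> (f \<longlongrightarrow> s) F \<Longrightarrow> ((\<lambda>n. helmholtz_kernel1 k (f n)) \<longlongrightarrow> helmholtz_kernel1 k s) F"
  using isCont_tendsto_compose has_vector_derivative_continuous[OF helmholtz_kernel1_has_derivative] by blast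

lemma cutoff_tendsto:
  assumes "w \<noteq> 0" "e \<longlonglongrightarrow> 0"
  shows "(\<lambda>n. cutoff_kernel k R (e n) w) \<longlonglongrightarrow> cutoff_kernel k R 0 w" "(\<lambda>n. cutoff_error k R (e n) w) \<longlonglongrightarrow> cutoff_error k R 0 w"
proof -
  have s: "(\<lambda>n. sqrt ((norm w)\<^sup>2 + (e n)\<^sup>2)) \<longlonglongrightarrow> sqrt ((norm w)\<^sup>2 + 0\<^sup>2)"
    by (intro tendsto_intros assms)
  have "sqrt ((norm w)\<^sup>2 + 0\<^sup>2) > 0" using assms by simp
  note t = helmholtz_kernel_tendsto[OF this s] helmholtz_kernel1_tendsto[OF this s]
  show "(\<lambda>n. cutoff_kernel k R (e n) w) \<longlonglongrightarrow> cutoff_kernel k R 0 w" "(\<lambda>n. cutoff_error k R (e n) w) \<longlonglongrightarrow> cutoff_error k R 0 w"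
    unfolding cutoff_kernel_def cutoff_error_def by (intro tendsto_intros t)+
qed

lemma kernel_integrable:
  fixes f :: "R3 \<Rightarrow> complex"
  assumes [measurable]: "f \<in> borel_measurable borel"
    and "\<And>w. w \<noteq> 0 \<Longrightarrow> norm (f w) \<le> a + b / norm w" "\<And>w. norm w > R \<Longrightarrow> f w = 0"
  shows "integrable lborel f"
proof (rule Bochner_Integration.integrable_bound[OF integrable_inverse_norm_ball[of R a b]])
  show "AE w in lborel. norm (f w) \<le> norm (indicator (cball 0 R) w * (a + b / norm w))"
    using AE_lborel_singleton[of "0::R3"]
  proof eventually_elim
    case (elim w)
    then show ?case using assms(2)[of w] assms(3)[of w] by (cases "norm w > R") auto
  qed
qed simp

lemma cutoff_integrable:
  assumes "Re k \<le> 0" "R > 0"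
  shows "integrable lborel (cutoff_kernel k R e)" "integrable lborel (cutoff_error k R e)"
proof -
  obtain C where C: "\<And>w. w \<noteq> 0 \<Longrightarrow> norm (cutoff_kernel k R e w) \<le> C / norm w" using cutoff_kernel_bound[OF assms(1)] assms(2) by blast
  show "integrable lborel (cutoff_kernel k R e)"
    by (rule kernel_integrable[of _ 0 C R]) (use C kernels_vanish_outside assms in auto)
  obtain B where B: "\<And>w. w \<noteq> 0 \<Longrightarrow> norm (cutoff_error k R e w) \<le> B / R\<^sup>2 * (1 + 1 / norm w)"
    using cutoff_error_bound[OF assms(1)] assms(2) by blast
  have B': "norm (cutoff_error k R e w) \<le> B / R\<^sup>2 + (B / R\<^sup>2) / norm w" if "w \<noteq> 0" for w
    using B[OF that] by (simp add: distrib_left)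
  show "integrable lborel (cutoff_error k R e)"
    by (rule kernel_integrable[of _ "B / R\<^sup>2" "B / R\<^sup>2" R]) (use B' kernels_vanish_outside assms in auto)
qed

lemma approx_delta_integrable:
  assumes "Re k \<le> 0" "R > 0" "e > 0"
  shows "integrable lborel (approx_delta k R e)"
proof -
  obtain C where C: "C \<ge> 0" "\<And>t. t \<ge> 0 \<Longrightarrow> \<bar>cutoff 0 t\<bar> \<le> C" using cutoff_bounded by blast
  define B where "B = 4 * e\<^sup>2 * C * (((norm k)\<^sup>2 / e ^ 3 + 3 * norm k / e ^ 4 + 3 / e ^ 5) / 4)"
  have "norm (approx_delta k R e w) \<le> B + 0 / norm w" for w
  proof -
    let ?s = "sqrt ((norm w)\<^sup>2 + e\<^sup>2)"
    have s: "e \<le> ?s" using sqrt_ge_norm(2)[of e w] assms by simp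
    then have s0: "?s > 0" using assms by linarith
    have "norm (helmholtz_kernel2 k ?s) \<le> ((norm k)\<^sup>2 / ?s ^ 3 + 3 * norm k / ?s ^ 4 + 3 / ?s ^ 5) / 4"
      by (rule helmholtz_kernel_bounds[OF assms(1) s0])
    also have "\<dots> \<le> ((norm k)\<^sup>2 / e ^ 3 + 3 * norm k / e ^ 4 + 3 / e ^ 5) / 4"
      using s assms by (intro divide_right_mono add_mono frac_le power_mono) auto
    finally have "norm (helmholtz_kernel2 k ?s) \<le> ((norm k)\<^sup>2 / e ^ 3 + 3 * norm k / e ^ 4 + 3 / e ^ 5) / 4" .
    moreover have "\<bar>4 * e\<^sup>2 * cutoff 0 ((norm w)\<^sup>2 / R\<^sup>2)\<bar> \<le> 4 * e\<^sup>2 * C"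
      unfolding abs_mult using C by (intro mult_mono) auto
    ultimately have "norm (approx_delta k R e w) \<le> B"
      unfolding approx_delta_def norm_mult norm_of_real B_def using C by (intro mult_mono) auto
    then show ?thesis by simp
  qed
  then show ?thesis by (intro kernel_integrable[of _ B 0 R]) (use kernels_vanish_outside assms in auto)
qed

text \<open>The approximation of $4\pi\delta$ in units of its width $e$, with the Jacobian $e^3$.\<close>

definition scaled_delta :: "complex \<Rightarrow> real \<Rightarrow> real \<Rightarrow> R3 \<Rightarrow> complex" where
  "scaled_delta k R e v = of_real (e ^ 3) * approx_delta k R e (e *\<^sub>R v)"

lemma scaled_delta_eq:
  assumes "e > 0"
  shows "scaled_delta k R e v = of_real (cutoff 0 ((e * norm v)\<^sup>2 / R\<^sup>2)) * exp (k * of_real (e * sqrt (1 + (norm v)\<^sup>2))) *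
    (k\<^sup>2 * of_real (e\<^sup>2 / sqrt (1 + (norm v)\<^sup>2) ^ 3) - 3 * k * of_real (e / sqrt (1 + (norm v)\<^sup>2) ^ 4)
      + of_real (3 / sqrt (1 + (norm v)\<^sup>2) ^ 5))"
proof -
  define \<sigma> where "\<sigma> = sqrt (1 + (norm v)\<^sup>2)"
  have \<sigma>: "\<sigma> > 0" by (simp add: \<sigma>_def add_pos_nonneg)
  have "(norm (e *\<^sub>R v))\<^sup>2 + e\<^sup>2 = e\<^sup>2 * (1 + (norm v)\<^sup>2)" by (simp add: power_mult_distrib algebra_simps)
  then have s: "sqrt ((norm (e *\<^sub>R v))\<^sup>2 + e\<^sup>2) = e * \<sigma>" using assms by (simp add: real_sqrt_mult \<sigma>_def)
  have t: "(norm (e *\<^sub>R v))\<^sup>2 / R\<^sup>2 = (e * norm v)\<^sup>2 / R\<^sup>2" by (simp add: power_mult_distrib)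
  define X where "X = k\<^sup>2 / of_real (e * \<sigma>) ^ 3 - 3 * k / of_real (e * \<sigma>) ^ 4 + 3 / of_real (e * \<sigma>) ^ 5"
  have X: "of_real (e ^ 3 * (4 * e\<^sup>2)) * X / 4
    = k\<^sup>2 * of_real (e\<^sup>2 / \<sigma> ^ 3) - 3 * k * of_real (e / \<sigma> ^ 4) + of_real (3 / \<sigma> ^ 5)"
    using \<sigma> assms by (simp add: X_def field_simps eval_nat_numeral)
  have "scaled_delta k R e v = of_real (cutoff 0 ((e * norm v)\<^sup>2 / R\<^sup>2)) * exp (k * of_real (e * \<sigma>)) * (of_real (e ^ 3 * (4 * e\<^sup>2)) * X / 4)"
    unfolding scaled_delta_def approx_delta_def s t helmholtz_kernel2_def X_def[symmetric] by simp
  then show ?thesis unfolding X \<sigma>_def .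
qed

text \<open>The term of order $e^2 \sigma^{-3}$, where $\sigma = \sqrt{1+|v|^2}$, is not integrable on its own.  The
  cutoff rescues it: on its support $e \sigma \le 1 + R$, so that one factor $e$ can be exchanged for
  $\sigma^{-1}$.\<close>

lemma scaled_delta_bound:
  assumes "Re k \<le> 0" "R > 0"
  shows "\<exists>C\<ge>0. \<forall>e v. 0 < e \<longrightarrow> e \<le> 1 \<longrightarrow> norm (scaled_delta k R e v) \<le> C * (1 / sqrt (1 + (norm v)\<^sup>2) ^ 4)"
proof -
  obtain C where C: "C \<ge> 0" "\<And>t. t \<ge> 0 \<Longrightarrow> \<bar>cutoff 0 t\<bar> \<le> C" using cutoff_bounded by blast
  define K where "K = (norm k)\<^sup>2 * (1 + R) + 3 * norm k + 3"
  have K: "K \<ge> 0" using assms by (simp add: K_def)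
  have "norm (scaled_delta k R e v) \<le> (C * K) * (1 / sqrt (1 + (norm v)\<^sup>2) ^ 4)" if e: "0 < e" "e \<le> 1" for e v
  proof (cases "e * norm v > R")
    case True
    then have "scaled_delta k R e v = 0"
      using kernels_vanish_outside(2)[OF assms(2), of "e *\<^sub>R v"] e by (simp add: scaled_delta_def)
    then show ?thesis using C K by simp
  next
    case False
    define \<sigma> where "\<sigma> = sqrt (1 + (norm v)\<^sup>2)"
    have \<sigma>: "\<sigma> \<ge> 1" by (simp add: \<sigma>_def)
    have "\<sigma> \<le> 1 + norm v" unfolding \<sigma>_def by (rule real_le_lsqrt) (auto simp: power2_eq_square algebra_simps)
    then have "e * \<sigma> \<le> e * (1 + norm v)" using e by (intro mult_left_mono) auto
    then have e\<sigma>: "e * \<sigma> \<le> 1 + R" using False e by (simp add: algebra_simps)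
    have ee: "e * (e * \<sigma>) \<le> 1 * (1 + R)" using e e\<sigma> \<sigma> assms by (intro mult_mono) auto
    have 1: "e\<^sup>2 / \<sigma> ^ 3 \<le> (1 + R) * (1 / \<sigma> ^ 4)"
    proof -
      have "e\<^sup>2 / \<sigma> ^ 3 = (e * (e * \<sigma>)) * (1 / \<sigma> ^ 4)" using \<sigma> by (simp add: field_simps eval_nat_numeral)
      also have "\<dots> \<le> (1 + R) * (1 / \<sigma> ^ 4)" using ee \<sigma> by (intro mult_right_mono) auto
      finally show ?thesis .
    qed
    have 2: "e / \<sigma> ^ 4 \<le> 1 * (1 / \<sigma> ^ 4)" using e \<sigma> by (simp add: divide_right_mono)
    have 3: "3 / \<sigma> ^ 5 \<le> 3 * (1 / \<sigma> ^ 4)"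
      using \<sigma> power_increasing[of 4 5 \<sigma>] by (simp add: frac_le)
    have E: "norm (exp (k * of_real (e * \<sigma>))) \<le> 1" using assms e \<sigma> by (intro norm_exp_le) auto
    have "norm (k\<^sup>2 * of_real (e\<^sup>2 / \<sigma> ^ 3) - 3 * k * of_real (e / \<sigma> ^ 4) + of_real (3 / \<sigma> ^ 5))
       \<le> norm (k\<^sup>2 * of_real (e\<^sup>2 / \<sigma> ^ 3)) + norm (3 * k * of_real (e / \<sigma> ^ 4)) + norm (complex_of_real (3 / \<sigma> ^ 5))"
      by (intro norm_triangle_le add_mono norm_triangle_ineq4) simp
    also have "\<dots> = (norm k)\<^sup>2 * (e\<^sup>2 / \<sigma> ^ 3) + 3 * norm k * (e / \<sigma> ^ 4) + 3 / \<sigma> ^ 5"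
      using e \<sigma> by (simp add: norm_mult norm_power norm_divide)
    also have "\<dots> \<le> (norm k)\<^sup>2 * ((1 + R) * (1 / \<sigma> ^ 4)) + 3 * norm k * (1 * (1 / \<sigma> ^ 4)) + 3 * (1 / \<sigma> ^ 4)"
      by (intro add_mono mult_left_mono 1 2 3) auto
    also have "\<dots> = K * (1 / \<sigma> ^ 4)" by (simp add: K_def add_divide_distrib distrib_left)
    finally have B: "norm (k\<^sup>2 * of_real (e\<^sup>2 / \<sigma> ^ 3) - 3 * k * of_real (e / \<sigma> ^ 4) + of_real (3 / \<sigma> ^ 5)) \<le> K * (1 / \<sigma> ^ 4)" .
    have "norm (complex_of_real (cutoff 0 ((e * norm v)\<^sup>2 / R\<^sup>2)) * exp (k * of_real (e * \<sigma>))) \<le> C * 1"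
      unfolding norm_mult norm_of_real by (rule mult_mono[OF C(2) E]) (use C in auto)
    then have "norm (scaled_delta k R e v) \<le> C * 1 * (K * (1 / \<sigma> ^ 4))"
      unfolding scaled_delta_eq[OF e(1)] \<sigma>_def[symmetric] norm_mult[of "_ * _" "_ + _"]
      by (rule mult_mono[OF _ B]) (use C in auto)
    then show ?thesis unfolding \<sigma>_def by simp
  qed
  then show ?thesis using C K by (intro exI[of _ "C * K"]) auto
qed

lemma scaled_delta_tendsto:
  assumes "\<And>n. e n > 0" "e \<longlonglongrightarrow> 0"
  shows "(\<lambda>n. scaled_delta k R (e n) v) \<longlonglongrightarrow> of_real (3 / sqrt (1 + (norm v)\<^sup>2) ^ 5)"
proof -
  have cutoff: "(\<lambda>n. cutoff 0 ((e n * norm v)\<^sup>2 / R\<^sup>2)) \<longlonglongrightarrow> cutoff 0 0"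
  proof (rule isCont_tendsto_compose[OF DERIV_isCont[OF cutoff_has_derivative]])
    have "(\<lambda>n. (e n * norm v)\<^sup>2 * inverse (R\<^sup>2)) \<longlonglongrightarrow> (0 * norm v)\<^sup>2 * inverse (R\<^sup>2)"
      by (intro tendsto_intros assms)
    then show "(\<lambda>n. (e n * norm v)\<^sup>2 / R\<^sup>2) \<longlonglongrightarrow> 0" by (simp add: divide_inverse)
  qed
  have d: "(\<lambda>n. f (e n) / c) \<longlonglongrightarrow> 0" if "(\<lambda>n. f (e n)) \<longlonglongrightarrow> 0" for f :: "real \<Rightarrow> real" and c
    using tendsto_mult[OF that tendsto_const[of "inverse c"]] by (simp add: divide_inverse)
  have "(\<lambda>n. (e n)\<^sup>2) \<longlonglongrightarrow> 0\<^sup>2" by (intro tendsto_intros assms)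
  then have e2: "(\<lambda>n. (e n)\<^sup>2) \<longlonglongrightarrow> 0" by simp
  define s where "s = sqrt (1 + (norm v)\<^sup>2)"
  have "(\<lambda>n. of_real (cutoff 0 ((e n * norm v)\<^sup>2 / R\<^sup>2)) * exp (k * of_real (e n * s)) *
    (k\<^sup>2 * of_real ((e n)\<^sup>2 / s ^ 3) - 3 * k * of_real (e n / s ^ 4) + of_real (3 / s ^ 5)))
    \<longlonglongrightarrow> of_real (cutoff 0 0) * exp (k * of_real (0 * s)) * (k\<^sup>2 * of_real 0 - 3 * k * of_real 0 + of_real (3 / s ^ 5))"
    by (intro tendsto_intros cutoff assms d[of "\<lambda>e. e\<^sup>2"] d[of "\<lambda>e. e"] e2)
  then show ?thesis using assms(1) by (simp add: scaled_delta_eq s_def cutoff_0_0)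
qed

text \<open>Convolution with the test function $h$ first, in the scaled variable $v$, gives functions of $y$ that
  converge pointwise to $4\pi h$, are bounded and live on a common ball.\<close>

lemma approx_delta_tendsto:
  fixes u h :: "R3 \<Rightarrow> complex"
  assumes u: "locally_integrable u" and h: "h \<in> test_functions" and k: "Re k \<le> 0" and R: "R > 0"
    and e: "\<And>n. e n > 0" "\<And>n. e n \<le> 1" "e \<longlonglongrightarrow> 0"
  shows "(\<lambda>n. \<integral>(x, y). h x * u y * approx_delta k R (e n) (y - x) \<partial>(lborel \<Otimes>\<^sub>M lborel))
    \<longlonglongrightarrow> (\<integral>x. h x * (4 * pi * u x) \<partial>lborel)"
proof -
  have [measurable]: "h \<in> borel_measurable borel" "u \<in> borel_measurable borel"
    using test_functionD(6)[OF h] locally_integrable_measurable[OF u] by auto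
  have [measurable]: "scaled_delta k R (e n) \<in> borel_measurable borel" for n
    unfolding scaled_delta_def[abs_def] by measurable
  obtain C where C: "C \<ge> 0" "\<And>x. norm (h x) \<le> C" using test_functionD(4)[OF h] by auto
  obtain r where r: "r > 0" "\<And>x. norm x > r \<Longrightarrow> h x = 0" using test_functionD(5)[OF h] by auto
  obtain B where B: "B \<ge> 0" "\<And>n v. norm (scaled_delta k R (e n) v) \<le> B * (1 / sqrt (1 + (norm v)\<^sup>2) ^ 4)"
    using scaled_delta_bound[OF k R] e by metis
  define T where "T n y = (\<integral>x. h x * approx_delta k R (e n) (y - x) \<partial>lborel)" for n y
  have T: "T n y = (\<integral>v. h (y - e n *\<^sub>R v) * scaled_delta k R (e n) v \<partial>lborel)" for n y
    unfolding T_def using e(1)[of n]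
    by (subst integral_lborel_affine[of "- e n" _ y]) (auto simp: scaled_delta_def mult_ac intro!: Bochner_Integration.integral_cong)
  define D where "D v = C * (B * (1 / sqrt (1 + (norm v)\<^sup>2) ^ 4))" for v :: R3
  have Dint: "integrable lborel D" unfolding D_def by (intro integrable_mult_right integrable_delta_majorant)
  have Db: "norm (h (y - e n *\<^sub>R v) * scaled_delta k R (e n) v) \<le> D v" for n y v
    unfolding D_def norm_mult using C B by (intro mult_mono) auto
  have Tb: "norm (T n y) \<le> (\<integral>v. D v \<partial>lborel)" for n y
  proof -
    have "integrable lborel (\<lambda>v. h (y - e n *\<^sub>R v) * scaled_delta k R (e n) v)"
      by (rule Bochner_Integration.integrable_bound[OF Dint]) (use Db in \<open>auto intro!: AE_I2 order_trans[OF Db abs_ge_self]\<close>)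
    then have "norm (T n y) \<le> (\<integral>v. norm (h (y - e n *\<^sub>R v) * scaled_delta k R (e n) v) \<partial>lborel)"
      unfolding T by (intro integral_norm_bound)
    also have "\<dots> \<le> (\<integral>v. D v \<partial>lborel)"
      using \<open>integrable lborel (\<lambda>v. h (y - e n *\<^sub>R v) * scaled_delta k R (e n) v)\<close> Dint Db by (intro integral_mono) auto
    finally show ?thesis .
  qed
  have T0: "T n y = 0" if "norm y > r + R" for n y
  proof -
    have "h x * approx_delta k R (e n) (y - x) = 0" for x
    proof (cases "norm x > r")
      case False
      then have "norm (y - x) > R" using that norm_triangle_ineq[of x "y - x"] by simp
      then show ?thesis using kernels_vanish_outside(2)[OF R] by simp
    qed (simp add: r)
    then have "(\<lambda>x. h x * approx_delta k R (e n) (y - x)) = (\<lambda>x. 0)" by (rule ext)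
    then show ?thesis by (simp add: T_def)
  qed
  have lim: "(\<lambda>n. T n y) \<longlonglongrightarrow> h y * (4 * pi)" for y
  proof -
    have "(\<lambda>n. T n y) \<longlonglongrightarrow> (\<integral>v. h y * of_real (3 / sqrt (1 + (norm (v::R3))\<^sup>2) ^ 5) \<partial>lborel)"
      unfolding T
    proof (rule integral_dominated_convergence[OF _ _ Dint])
      show "AE v in lborel. (\<lambda>n. h (y - e n *\<^sub>R v) * scaled_delta k R (e n) v) \<longlonglongrightarrow> h y * of_real (3 / sqrt (1 + (norm v)\<^sup>2) ^ 5)"
      proof (intro AE_I2 tendsto_mult scaled_delta_tendsto e)
        fix v
        have "isCont h y" using test_functionD(2)[OF h] by (simp add: continuous_on_eq_continuous_at)
        moreover have "(\<lambda>n. y - e n *\<^sub>R v) \<longlonglongrightarrow> y - 0 *\<^sub>R v" by (intro tendsto_intros e)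
        ultimately show "(\<lambda>n. h (y - e n *\<^sub>R v)) \<longlonglongrightarrow> h y" by (intro isCont_tendsto_compose[of y h]) simp_all
      qed
    qed (use Db in auto)
    moreover have "(\<integral>v. complex_of_real (3 / sqrt (1 + (norm (v::R3))\<^sup>2) ^ 5) \<partial>lborel) = of_real (4 * pi)"
    proof -
      have "(\<integral>v. 3 / sqrt (1 + (norm (v::R3))\<^sup>2) ^ 5 \<partial>lborel) = 4 * pi"
        by (subst integral_eq_nn_integral) (auto simp: nn_integral_delta_profile)
      then show ?thesis by (simp only: integral_complex_of_real)
    qed
    ultimately show ?thesis by (simp only: integral_mult_right_zero)
  qed
  have "(\<lambda>n. \<integral>y. u y * T n y \<partial>lborel) \<longlonglongrightarrow> (\<integral>y. u y * (h y * (4 * pi)) \<partial>lborel)"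
  proof (rule integral_dominated_convergence)
    have [measurable]: "T n \<in> borel_measurable borel" for n
      unfolding T_def[abs_def] by measurable
    show "(\<lambda>y. u y * T n y) \<in> borel_measurable lborel" for n by measurable
    show "(\<lambda>y. u y * (h y * (4 * pi))) \<in> borel_measurable lborel" by measurable
    show "integrable lborel (\<lambda>y. (\<integral>v. D v \<partial>lborel) * norm (indicator (cball 0 (r + R)) y *\<^sub>R u y))"
      using u by (intro integrable_mult_right integrable_norm) (simp add: locally_integrable_def set_integrable_def)
    show "AE y in lborel. (\<lambda>n. u y * T n y) \<longlonglongrightarrow> u y * (h y * (4 * pi))"
      by (intro AE_I2 tendsto_mult tendsto_const lim)
    show "AE y in lborel. norm (u y * T n y) \<le> (\<integral>v. D v \<partial>lborel) * norm (indicator (cball 0 (r + R)) y *\<^sub>R u y)" for n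
    proof (intro AE_I2)
      fix y
      show "norm (u y * T n y) \<le> (\<integral>v. D v \<partial>lborel) * norm (indicator (cball 0 (r + R)) y *\<^sub>R u y)"
      proof (cases "norm y > r + R")
        case False
        then show ?thesis using mult_right_mono[OF Tb[of n y] norm_ge_zero[of "u y"]] by (simp add: norm_mult mult.commute)
      qed (simp add: T0)
    qed
  qed
  moreover have "(\<integral>(x, y). h x * u y * approx_delta k R (e n) (y - x) \<partial>(lborel \<Otimes>\<^sub>M lborel)) = (\<integral>y. u y * T n y \<partial>lborel)" for n
    unfolding T_def by (rule convolution_fubini(2)[OF u h approx_delta_integrable[OF k R e(1)] kernels_vanish_outside(2)[OF R]])
  ultimately show ?thesis by (simp add: mult_ac)
qed

text \<open>The weak equation is tested with $y \mapsto \chi(|y-x|/R)\, e^{ks}/s$, where $s^2 = |y-x|^2 + e^2$, and the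
  result is integrated against a test function of $x$.  As $e \to 0$ the three terms converge, and the
  fundamental lemma removes the test function.\<close>

lemma parametrix:
  fixes u F :: "R3 \<Rightarrow> complex"
  assumes u: "locally_integrable u" and F: "locally_integrable F" and k: "Re k \<le> 0" and R: "R > 0"
    and weak: "\<And>\<phi>. \<phi> \<in> test_functions \<Longrightarrow>
      (\<integral>x. u x * (test_laplacian \<phi> x - k\<^sup>2 * \<phi> x) \<partial>lborel) = (\<integral>x. F x * \<phi> x \<partial>lborel)"
  shows "AE x in lborel. 4 * pi * u x = (\<integral>y. u y * cutoff_error k R 0 (y - x) \<partial>lborel) - (\<integral>y. F y * cutoff_kernel k R 0 (y - x) \<partial>lborel)"
proof -
  define e where "e n = 1 / real (Suc n)" for n
  have e: "e n > 0" "e n \<le> 1" "e \<longlonglongrightarrow> 0" for n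
    using LIMSEQ_inverse_real_of_nat by (auto simp: e_def[abs_def] inverse_eq_divide)
  define U where "U x = (\<integral>y. u y * cutoff_error k R 0 (y - x) \<partial>lborel)" for x
  define P where "P x = (\<integral>y. F y * cutoff_kernel k R 0 (y - x) \<partial>lborel)" for x
  have locU: "locally_integrable U" unfolding U_def
    by (rule convolution_locally_integrable[OF u cutoff_integrable(2)[OF k R] kernels_vanish_outside(3)[OF R]])
  have locP: "locally_integrable P" unfolding P_def
    by (rule convolution_locally_integrable[OF F cutoff_integrable(1)[OF k R] kernels_vanish_outside(1)[OF R]])
  have loc4: "locally_integrable (\<lambda>x. 4 * pi * u x)"
  proof -
    have "integrable lborel (\<lambda>x. complex_of_real (4 * pi) * (indicator (cball 0 r) x *\<^sub>R u x))" for r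
      using u by (intro integrable_mult_right) (simp add: locally_integrable_def set_integrable_def)
    then show ?thesis by (simp add: locally_integrable_def set_integrable_def mult_ac)
  qed
  have loc: "locally_integrable (\<lambda>x. U x - 4 * pi * u x - P x)"
    using locU locP loc4 unfolding locally_integrable_def by (intro allI set_integral_diff) auto
  have "AE x in lborel. U x - 4 * pi * u x - P x = 0"
  proof (rule du_Bois_Reymond[OF loc])
    fix h assume h: "h \<in> test_functions"
    obtain C where C: "\<And>x. norm (h x) \<le> C" using test_functionD(4)[OF h] by auto
    obtain r where r: "\<And>x. norm x > r \<Longrightarrow> h x = 0" using test_functionD(5)[OF h] by auto
    note hm = test_functionD(6)[OF h]
    obtain B where B: "\<And>e w. w \<noteq> 0 \<Longrightarrow> norm (cutoff_error k R e w) \<le> B / R\<^sup>2 * (1 + 1 / norm w)"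
      using cutoff_error_bound[OF k] R by blast
    obtain A where A: "\<And>e w. w \<noteq> 0 \<Longrightarrow> norm (cutoff_kernel k R e w) \<le> A / norm w" using cutoff_kernel_bound[OF k] R by blast
    have 1: "(\<lambda>n. \<integral>(x, y). h x * u y * cutoff_error k R (e n) (y - x) \<partial>(lborel \<Otimes>\<^sub>M lborel))
      \<longlonglongrightarrow> (\<integral>(x, y). h x * u y * cutoff_error k R 0 (y - x) \<partial>(lborel \<Otimes>\<^sub>M lborel))"
    proof (rule convolution_tendsto[OF u hm C r _ _ integrable_inverse_norm_ball[of R "B / R\<^sup>2" "B / R\<^sup>2"], where R = R])
      show "norm (cutoff_error k R (e n) w) \<le> indicator (cball 0 R) w * (B / R\<^sup>2 + B / R\<^sup>2 / norm w)" if "w \<noteq> 0" for n w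
        using B[OF that, of "e n"] kernels_vanish_outside(3)[OF R, of w] by (cases "norm w > R") (auto simp: distrib_left)
    qed (auto intro!: cutoff_tendsto e)
    have 2: "(\<lambda>n. \<integral>(x, y). h x * F y * cutoff_kernel k R (e n) (y - x) \<partial>(lborel \<Otimes>\<^sub>M lborel))
      \<longlonglongrightarrow> (\<integral>(x, y). h x * F y * cutoff_kernel k R 0 (y - x) \<partial>(lborel \<Otimes>\<^sub>M lborel))"
    proof (rule convolution_tendsto[OF F hm C r _ _ integrable_inverse_norm_ball[of R 0 A], where R = R])
      show "norm (cutoff_kernel k R (e n) w) \<le> indicator (cball 0 R) w * (0 + A / norm w)" if "w \<noteq> 0" for n w
        using A[OF that, of "e n"] kernels_vanish_outside(1)[OF R, of w] by (cases "norm w > R") auto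
    qed (auto intro!: cutoff_tendsto e)
    note 3 = approx_delta_tendsto[OF u h k R e]
    have eq: "(\<integral>(x, y). h x * u y * cutoff_error k R (e n) (y - x) \<partial>(lborel \<Otimes>\<^sub>M lborel))
      - (\<integral>(x, y). h x * u y * approx_delta k R (e n) (y - x) \<partial>(lborel \<Otimes>\<^sub>M lborel))
      = (\<integral>(x, y). h x * F y * cutoff_kernel k R (e n) (y - x) \<partial>(lborel \<Otimes>\<^sub>M lborel))" for n
    proof -
      note ci = cutoff_integrable(2)[OF k R, of "e n"] and pi = approx_delta_integrable[OF k R e(1)[of n]]
      have d: "integrable lborel (\<lambda>w. cutoff_error k R (e n) w - approx_delta k R (e n) w)"
        "\<And>w. norm w > R \<Longrightarrow> cutoff_error k R (e n) w - approx_delta k R (e n) w = 0"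
        using ci pi kernels_vanish_outside[OF R] by auto
      have "(\<integral>(x, y). h x * u y * cutoff_error k R (e n) (y - x) \<partial>(lborel \<Otimes>\<^sub>M lborel))
        - (\<integral>(x, y). h x * u y * approx_delta k R (e n) (y - x) \<partial>(lborel \<Otimes>\<^sub>M lborel))
        = (\<integral>(x, y). h x * u y * (cutoff_error k R (e n) (y - x) - approx_delta k R (e n) (y - x)) \<partial>(lborel \<Otimes>\<^sub>M lborel))"
        using Bochner_Integration.integral_diff[OF convolution_fubini(3)[OF u h ci kernels_vanish_outside(3)[OF R]] convolution_fubini(3)[OF u h pi kernels_vanish_outside(2)[OF R]]]
        by (simp add: case_prod_unfold right_diff_distrib)
      also have "\<dots> = (\<integral>x. h x * (\<integral>y. u y * (cutoff_error k R (e n) (y - x) - approx_delta k R (e n) (y - x)) \<partial>lborel) \<partial>lborel)"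
        by (rule convolution_fubini(1)[OF u h d])
      also have "\<dots> = (\<integral>x. h x * (\<integral>y. F y * cutoff_kernel k R (e n) (y - x) \<partial>lborel) \<partial>lborel)"
      proof -
        have "(\<integral>y. u y * (cutoff_error k R (e n) (y - x) - approx_delta k R (e n) (y - x)) \<partial>lborel)
          = (\<integral>y. F y * cutoff_kernel k R (e n) (y - x) \<partial>lborel)" for x
          using weak[OF cutoff_kernel_test_function(1)[OF e(1)[of n] R, where k = k and x = x]]
          unfolding cutoff_kernel_test_function(2)[OF e(1)[of n] R, where k = k and x = x] .
        then show ?thesis by (simp only:)
      qed
      also have "\<dots> = (\<integral>(x, y). h x * F y * cutoff_kernel k R (e n) (y - x) \<partial>(lborel \<Otimes>\<^sub>M lborel))"
        by (rule convolution_fubini(1)[OF F h cutoff_integrable(1)[OF k R] kernels_vanish_outside(1)[OF R], symmetric])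
      finally show ?thesis .
    qed
    have "(\<integral>(x, y). h x * u y * cutoff_error k R 0 (y - x) \<partial>(lborel \<Otimes>\<^sub>M lborel)) - (\<integral>x. h x * (4 * pi * u x) \<partial>lborel)
      = (\<integral>(x, y). h x * F y * cutoff_kernel k R 0 (y - x) \<partial>(lborel \<Otimes>\<^sub>M lborel))"
      using tendsto_diff[OF 1 3] unfolding eq by (rule LIMSEQ_unique[OF _ 2])
    also have "(\<integral>(x, y). h x * u y * cutoff_error k R 0 (y - x) \<partial>(lborel \<Otimes>\<^sub>M lborel)) = (\<integral>x. U x * h x \<partial>lborel)"
      unfolding U_def by (subst convolution_fubini(1)[OF u h cutoff_integrable(2)[OF k R] kernels_vanish_outside(3)[OF R]]) (simp_all add: mult.commute)
    also have "(\<integral>(x, y). h x * F y * cutoff_kernel k R 0 (y - x) \<partial>(lborel \<Otimes>\<^sub>M lborel)) = (\<integral>x. P x * h x \<partial>lborel)"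
      unfolding P_def by (subst convolution_fubini(1)[OF F h cutoff_integrable(1)[OF k R] kernels_vanish_outside(1)[OF R]]) (simp_all add: mult.commute)
    also have "(\<integral>x. h x * (4 * pi * u x) \<partial>lborel) = (\<integral>x. 4 * pi * u x * h x \<partial>lborel)"
      by (simp add: mult.commute)
    finally have 4: "(\<integral>x. U x * h x \<partial>lborel) - (\<integral>x. 4 * pi * u x * h x \<partial>lborel) = (\<integral>x. P x * h x \<partial>lborel)" .
    have "(\<integral>x. (U x - 4 * pi * u x - P x) * h x \<partial>lborel)
       = (\<integral>x. U x * h x - 4 * pi * u x * h x - P x * h x \<partial>lborel)" by (simp add: left_diff_distrib)
    also have "\<dots> = (\<integral>x. U x * h x \<partial>lborel) - (\<integral>x. 4 * pi * u x * h x \<partial>lborel) - (\<integral>x. P x * h x \<partial>lborel)"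
      using integrable_mult_test[OF locU h] integrable_mult_test[OF loc4 h] integrable_mult_test[OF locP h]
      by (subst Bochner_Integration.integral_diff; simp)+
    finally show "(\<integral>x. (U x - 4 * pi * u x - P x) * h x \<partial>lborel) = 0" using 4 by simp
  qed
  then show ?thesis by eventually_elim (simp add: U_def P_def algebra_simps)
qed

section \<open>Square-integrable solutions of the Helmholtz equation\<close>

lemma square_integrable_shift:
  assumes "square_integrable c"
  shows "square_integrable (\<lambda>y. c (y - x))" "(\<integral>y. (norm (c (y - x)))\<^sup>2 \<partial>lborel) = (\<integral>y. (norm (c y))\<^sup>2 \<partial>lborel)"
proof -
  have [measurable]: "c \<in> borel_measurable borel" using assms by (simp add: square_integrable_def)
  have nn: "(\<integral>\<^sup>+y. ennreal ((norm (c (y - x)))\<^sup>2) \<partial>lborel) = (\<integral>\<^sup>+y. ennreal ((norm (c y))\<^sup>2) \<partial>lborel)"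
    by (rule nn_integral_lborel_shift[of "\<lambda>y. ennreal ((norm (c y))\<^sup>2)"]) measurable
  have int: "integrable lborel (\<lambda>y. (norm (c (y - x)))\<^sup>2)"
    using assms nn by (intro integrableI_nonneg) (auto simp: square_integrable_def integrable_iff_bounded)
  then show "square_integrable (\<lambda>y. c (y - x))" by (simp add: square_integrable_def)
  show "(\<integral>y. (norm (c (y - x)))\<^sup>2 \<partial>lborel) = (\<integral>y. (norm (c y))\<^sup>2 \<partial>lborel)"
    by (simp add: integral_eq_nn_integral nn)
qed

text \<open>The inequality $2ab \le d a^2 + b^2/d$ replaces the Cauchy--Schwarz inequality; the free parameter
  allows balancing the two terms.\<close>

lemma convolution_bound_L2:
  assumes u: "square_integrable u" and c: "square_integrable c" and d: "d > 0"
  shows "norm (\<integral>y. u y * c (y - x) \<partial>lborel) \<le> (d * (\<integral>y. (norm (u y))\<^sup>2 \<partial>lborel) + (\<integral>y. (norm (c y))\<^sup>2 \<partial>lborel) / d) / 2"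
proof -
  have int: "integrable lborel (\<lambda>y. u y * c (y - x))"
    by (intro square_integrable_mult u square_integrable_shift c)
  have i1: "integrable lborel (\<lambda>y. (norm (u y))\<^sup>2)" using u by (simp add: square_integrable_def)
  have i2: "integrable lborel (\<lambda>y. (norm (c (y - x)))\<^sup>2)" using square_integrable_shift(1)[OF c] by (simp add: square_integrable_def)
  have "norm (\<integral>y. u y * c (y - x) \<partial>lborel) \<le> (\<integral>y. norm (u y * c (y - x)) \<partial>lborel)"
    by (rule integral_norm_bound)
  also have "\<dots> \<le> (\<integral>y. (d * (norm (u y))\<^sup>2 + (norm (c (y - x)))\<^sup>2 / d) / 2 \<partial>lborel)"
  proof (rule integral_mono)
    show "integrable lborel (\<lambda>y. norm (u y * c (y - x)))" using int by simp
    show "integrable lborel (\<lambda>y. (d * (norm (u y))\<^sup>2 + (norm (c (y - x)))\<^sup>2 / d) / 2)" using i1 i2 by simp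
    show "norm (u y * c (y - x)) \<le> (d * (norm (u y))\<^sup>2 + (norm (c (y - x)))\<^sup>2 / d) / 2" for y
    proof -
      let ?a = "norm (u y)" and ?b = "norm (c (y - x))"
      have "0 \<le> (d * ?a - ?b)\<^sup>2 / d" using d by simp
      also have "\<dots> = d * ?a\<^sup>2 + ?b\<^sup>2 / d - 2 * (?a * ?b)"
        using d by (simp add: power2_diff power_mult_distrib add_divide_distrib diff_divide_distrib) (simp add: power2_eq_square)
      finally show ?thesis by (simp add: norm_mult)
    qed
  qed
  also have "\<dots> = (d * (\<integral>y. (norm (u y))\<^sup>2 \<partial>lborel) + (\<integral>y. (norm (c y))\<^sup>2 \<partial>lborel) / d) / 2"
    using i1 i2 by (simp add: square_integrable_shift(2)[OF c])
  finally show ?thesis .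
qed

lemma nn_integral_inverse_square_ball:
  assumes "R \<ge> 0"
  shows "(\<integral>\<^sup>+w. ennreal (1 / (norm (w::R3))\<^sup>2) * indicator {0..R} (norm w) \<partial>lborel) = ennreal (4 * pi * R)"
proof -
  have "(\<integral>\<^sup>+w. ennreal (1 / (norm (w::R3))\<^sup>2) * indicator {0..R} (norm w) \<partial>lborel)
     = (\<integral>\<^sup>+r. ennreal (4 * pi * r\<^sup>2) * indicator {0..} r * (ennreal (1 / r\<^sup>2) * indicator {0..R} r) \<partial>lborel)"
    by (rule nn_integral_radial[of "\<lambda>r. ennreal (1 / r\<^sup>2) * indicator {0..R} r"]) measurable
  also have "\<dots> = (\<integral>\<^sup>+r. ennreal (4 * pi) * indicator {0..R} r \<partial>lborel)"
  proof (rule nn_integral_cong_AE)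
    show "AE r in lborel. ennreal (4 * pi * r\<^sup>2) * indicator {0..} r * (ennreal (1 / r\<^sup>2) * indicator {0..R} r)
        = ennreal (4 * pi) * indicator {0..R} r"
      using AE_lborel_singleton[of "0::real"]
      by eventually_elim (auto simp: indicator_def simp flip: ennreal_mult)
  qed
  also have "\<dots> = ennreal (4 * pi * R)"
    using assms by (subst nn_integral_cmult_indicator) (auto simp: ennreal_mult)
  finally show ?thesis .
qed

lemma inverse_square_ball:
  assumes "R \<ge> 0"
  shows "integrable lborel (\<lambda>w::R3. indicator (cball 0 R) w * (1 / (norm w)\<^sup>2))"
    "(\<integral>w. indicator (cball 0 R) w * (1 / (norm (w::R3))\<^sup>2) \<partial>lborel) = 4 * pi * R"
proof -
  have "(\<integral>\<^sup>+w. ennreal (indicator (cball 0 R) w * (1 / (norm (w::R3))\<^sup>2)) \<partial>lborel)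
     = (\<integral>\<^sup>+w. ennreal (1 / (norm (w::R3))\<^sup>2) * indicator {0..R} (norm w) \<partial>lborel)"
    by (intro nn_integral_cong) (auto simp: indicator_def)
  then have nn: "(\<integral>\<^sup>+w. ennreal (indicator (cball 0 R) w * (1 / (norm (w::R3))\<^sup>2)) \<partial>lborel) = ennreal (4 * pi * R)"
    using nn_integral_inverse_square_ball[OF assms] by simp
  show "integrable lborel (\<lambda>w::R3. indicator (cball 0 R) w * (1 / (norm w)\<^sup>2))"
  proof (rule integrableI_nonneg)
    show "(\<integral>\<^sup>+w. ennreal (indicator (cball 0 R) w * (1 / (norm (w::R3))\<^sup>2)) \<partial>lborel) < \<infinity>" unfolding nn by simp
  qed auto
  show "(\<integral>w. indicator (cball 0 R) w * (1 / (norm (w::R3))\<^sup>2) \<partial>lborel) = 4 * pi * R"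
  proof (subst integral_eq_nn_integral)
    show "enn2real (\<integral>\<^sup>+w. ennreal (indicator (cball 0 R) w * (1 / (norm (w::R3))\<^sup>2)) \<partial>lborel) = 4 * pi * R"
      unfolding nn using assms by simp
  qed auto
qed

lemma kernel_square_integrable:
  fixes f :: "R3 \<Rightarrow> complex"
  assumes f[measurable]: "f \<in> borel_measurable borel" and b: "b \<ge> 0" and R: "R \<ge> 1"
    and bound: "\<And>w. w \<noteq> 0 \<Longrightarrow> norm (f w) \<le> b * (1 + 1 / norm w)" "\<And>w. norm w > R \<Longrightarrow> f w = 0"
  shows "square_integrable f" "(\<integral>w. (norm (f w))\<^sup>2 \<partial>lborel) \<le> 12 * pi * b\<^sup>2 * R ^ 3"
proof -
  define D where "D w = 2 * b\<^sup>2 * (indicator (cball 0 R) w + indicator (cball 0 R) w * (1 / (norm w)\<^sup>2))" for w :: R3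
  have Dint: "integrable lborel D" unfolding D_def
    using R by (intro integrable_mult_right Bochner_Integration.integrable_add integrable_indicator_cball inverse_square_ball) simp
  have fD: "AE w in lborel. (norm (f w))\<^sup>2 \<le> D w"
    using AE_lborel_singleton[of "0::R3"]
  proof eventually_elim
    case (elim w)
    show ?case
    proof (cases "norm w > R")
      case True
      then show ?thesis using bound(2) by (simp add: D_def)
    next
      case False
      have "(norm (f w))\<^sup>2 \<le> (b * (1 + 1 / norm w))\<^sup>2" using bound(1)[OF elim] by (intro power_mono) auto
      also have "\<dots> = b\<^sup>2 * (1 + 1 / norm w)\<^sup>2" by (simp add: power_mult_distrib)
      also have "(1 + 1 / norm w)\<^sup>2 \<le> 2 * (1 + 1 / (norm w)\<^sup>2)"
        using sum_squares_bound[of 1 "1 / norm w"] by (simp add: power2_sum power_divide)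
      finally have "(norm (f w))\<^sup>2 \<le> b\<^sup>2 * (2 * (1 + 1 / (norm w)\<^sup>2))" by (simp add: mult_left_mono)
      then show ?thesis using False by (simp add: D_def algebra_simps)
    qed
  qed
  have int: "integrable lborel (\<lambda>w. (norm (f w))\<^sup>2)"
    by (rule Bochner_Integration.integrable_bound[OF Dint]) (use fD in \<open>auto elim!: eventually_mono\<close>)
  then show "square_integrable f" by (simp add: square_integrable_def)
  have "(\<integral>w. (norm (f w))\<^sup>2 \<partial>lborel) \<le> (\<integral>w. D w \<partial>lborel)"
    by (rule integral_mono_AE[OF int Dint fD])
  also have "\<dots> = 2 * b\<^sup>2 * (4 / 3 * pi * R ^ 3 + 4 * pi * R)"
  proof -
    have "measure lborel (cball (0::R3) R) = 4 / 3 * pi * R ^ 3"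
      using R unfolding measure_def by (subst emeasure_cball_R3) auto
    then show ?thesis unfolding D_def
      using R integrable_indicator_cball inverse_square_ball[of R]
      by (simp add: Bochner_Integration.integral_add)
  qed
  also have "\<dots> \<le> 2 * b\<^sup>2 * (2 * pi * R ^ 3 + 4 * pi * R ^ 3)"
  proof -
    have "R \<le> R ^ 3" using R self_le_power[of R 3] by simp
    then have "4 * pi * R \<le> 4 * pi * R ^ 3" by (intro mult_left_mono) auto
    moreover have "4 / 3 * pi * R ^ 3 \<le> 2 * pi * R ^ 3" using R by (intro mult_right_mono) auto
    ultimately show ?thesis by (intro mult_left_mono add_mono) auto
  qed
  also have "\<dots> = 12 * pi * b\<^sup>2 * R ^ 3" by (simp add: algebra_simps)
  finally show "(\<integral>w. (norm (f w))\<^sup>2 \<partial>lborel) \<le> 12 * pi * b\<^sup>2 * R ^ 3" .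
qed

text \<open>With $k = 0$ and $R = 1$ both kernels of the parametrix are square integrable, and the convolution of
  two square-integrable functions is bounded.\<close>

lemma weak_laplacian_bounded:
  fixes u l :: "R3 \<Rightarrow> complex"
  assumes u: "square_integrable u" and l: "square_integrable l"
    and weak: "\<And>\<phi>. \<phi> \<in> test_functions \<Longrightarrow> (\<integral>x. u x * test_laplacian \<phi> x \<partial>lborel) = (\<integral>x. l x * \<phi> x \<partial>lborel)"
  shows "\<exists>C. AE x in lborel. norm (u x) \<le> C"
proof -
  obtain A where A: "A \<ge> 0" "\<And>w. w \<noteq> 0 \<Longrightarrow> norm (cutoff_kernel 0 1 0 w) \<le> A / norm w"
    using cutoff_kernel_bound[of 0] by auto
  obtain B where B: "B \<ge> 0" "\<And>w. w \<noteq> 0 \<Longrightarrow> norm (cutoff_error 0 1 0 w) \<le> B / 1\<^sup>2 * (1 + 1 / norm w)"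
  proof -
    obtain B where "B \<ge> 0" and B: "\<forall>R>0. \<forall>e w. w \<noteq> 0 \<longrightarrow> norm (cutoff_error 0 R e w) \<le> B / R\<^sup>2 * (1 + 1 / norm w)"
      using cutoff_error_bound[of 0] by auto
    show ?thesis by (rule that[OF \<open>B \<ge> 0\<close>]) (use B zero_less_one in blast)
  qed
  have c: "square_integrable (cutoff_error 0 1 0)" by (rule kernel_square_integrable[of _ B 1]) (use B kernels_vanish_outside[of 1] in auto)
  have A': "norm (cutoff_kernel 0 1 0 w) \<le> A * (1 + 1 / norm w)" if "w \<noteq> 0" for w
    using A(2)[OF that] A(1) by (simp add: algebra_simps)
  have p: "square_integrable (cutoff_kernel 0 1 0)" by (rule kernel_square_integrable[of _ A 1]) (use A A' kernels_vanish_outside[of 1] in auto)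
  have "AE x in lborel. 4 * pi * u x = (\<integral>y. u y * cutoff_error 0 1 0 (y - x) \<partial>lborel) - (\<integral>y. l y * cutoff_kernel 0 1 0 (y - x) \<partial>lborel)"
    by (rule parametrix) (use weak in \<open>simp_all add: square_integrable_imp_locally_integrable u l\<close>)
  then have "AE x in lborel. norm (4 * pi * u x) \<le> (1 * (\<integral>y. (norm (u y))\<^sup>2 \<partial>lborel) + (\<integral>y. (norm (cutoff_error 0 1 0 y))\<^sup>2 \<partial>lborel) / 1) / 2
     + (1 * (\<integral>y. (norm (l y))\<^sup>2 \<partial>lborel) + (\<integral>y. (norm (cutoff_kernel 0 1 0 y))\<^sup>2 \<partial>lborel) / 1) / 2" (is "AE x in lborel. _ \<le> ?C")
  proof eventually_elim
    case (elim x)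
    show ?case unfolding elim
      by (rule order_trans[OF norm_triangle_ineq4 add_mono[OF convolution_bound_L2[OF u c zero_less_one] convolution_bound_L2[OF l p zero_less_one]]])
  qed
  then have "AE x in lborel. norm (u x) \<le> ?C / (4 * pi)"
    by eventually_elim (simp add: norm_mult field_simps)
  then show ?thesis by blast
qed

text \<open>The squared $L^2$ norm of the cutoff error is of order $(R^{-2})^2 R^3 = R^{-1}$.\<close>

lemma cutoff_error_convolution_tendsto_0:
  assumes u: "square_integrable u" and k: "Re k \<le> 0"
  shows "(\<lambda>n. \<integral>y. u y * cutoff_error k (real (Suc n)) 0 (y - x) \<partial>lborel) \<longlonglongrightarrow> 0"
proof -
  obtain B where B: "B \<ge> 0" "\<And>R w. R > 0 \<Longrightarrow> w \<noteq> 0 \<Longrightarrow> norm (cutoff_error k R 0 w) \<le> B / R\<^sup>2 * (1 + 1 / norm w)"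
    using cutoff_error_bound[OF k] by blast
  define I where "I = (\<integral>y. (norm (u y))\<^sup>2 \<partial>lborel)"
  define f where "f t = (t * I + 12 * pi * B\<^sup>2 * t) / 2" for t :: real
  have bound: "norm (\<integral>y. u y * cutoff_error k (real (Suc n)) 0 (y - x) \<partial>lborel) \<le> f (sqrt (inverse (real (Suc n))))" for n
  proof -
    define R where "R = real (Suc n)"
    have R: "R \<ge> 1" by (simp add: R_def)
    have c: "square_integrable (cutoff_error k R 0)" "(\<integral>w. (norm (cutoff_error k R 0 w))\<^sup>2 \<partial>lborel) \<le> 12 * pi * (B / R\<^sup>2)\<^sup>2 * R ^ 3"
      by (rule kernel_square_integrable[of _ "B / R\<^sup>2" R]; use B R kernels_vanish_outside[of R] in auto)+
    \<comment> \<open>Weight $R^{-1/2}$ balances $\|u\|^2$ against the squared norm of the kernel, of order $R^{-1}$.\<close>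
    define t where "t = sqrt (inverse R)"
    have t: "t > 0" "t\<^sup>2 = 1 / R" using R by (simp_all add: t_def divide_inverse)
    have "12 * pi * (B / R\<^sup>2)\<^sup>2 * R ^ 3 = 12 * pi * B\<^sup>2 * t\<^sup>2" using R unfolding t by (simp add: field_simps eval_nat_numeral)
    then have c2: "(\<integral>w. (norm (cutoff_error k R 0 w))\<^sup>2 \<partial>lborel) / t \<le> 12 * pi * B\<^sup>2 * t"
      using c(2) t(1) by (simp add: divide_le_eq power2_eq_square mult.assoc)
    have "norm (\<integral>y. u y * cutoff_error k R 0 (y - x) \<partial>lborel) \<le> (t * I + (\<integral>w. (norm (cutoff_error k R 0 w))\<^sup>2 \<partial>lborel) / t) / 2"
      unfolding I_def by (rule convolution_bound_L2[OF u c(1) t(1)])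
    also have "\<dots> \<le> f t" unfolding f_def by (rule divide_right_mono) (use c2 in auto)
    finally show ?thesis by (simp add: R_def t_def)
  qed
  have "(\<lambda>n. f (sqrt (inverse (real (Suc n))))) \<longlonglongrightarrow> f (sqrt 0)"
    unfolding f_def by (intro tendsto_intros LIMSEQ_inverse_real_of_nat) auto
  then have "(\<lambda>n. f (sqrt (inverse (real (Suc n))))) \<longlonglongrightarrow> 0" by (simp add: f_def)
  then show ?thesis by (rule Lim_null_comparison[rotated]) (use bound in simp)
qed

lemma integrable_imp_locally_integrable: "integrable lborel F \<Longrightarrow> locally_integrable F"
  unfolding locally_integrable_def set_integrable_def by (intro allI integrable_mult_indicator) auto

text \<open>Away from $x$ the kernel is at most $1$; near $x$ it is integrable, and the convolution of two
  integrable functions is finite almost everywhere.\<close>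

lemma newton_potential_finite:
  fixes F :: "R3 \<Rightarrow> complex"
  assumes F: "integrable lborel F"
  shows "AE x in lborel. integrable lborel (\<lambda>y. norm (F y) / norm (y - x))"
proof -
  have [measurable]: "F \<in> borel_measurable borel" using borel_measurable_integrable[OF F] by simp
  define k where "k w = complex_of_real (indicator (cball 0 1) w * (0 + 1 / norm w))" for w :: R3
  have k: "integrable lborel k" "\<And>w. norm w > 1 \<Longrightarrow> k w = 0"
    unfolding k_def complex_of_real_integrable_eq by (rule integrable_inverse_norm_ball) auto
  have "AE x in lborel. integrable lborel (\<lambda>y. complex_of_real (indicator (cball 0 (real n)) x) * F y * k (y - x))" for n
    by (rule lborel_pair.AE_integrable_fst[OF convolution_integrable[OF integrable_imp_locally_integrable[OF F] _ _ _ k, where C = 1 and r = "real n"]])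
      (auto simp: indicator_def)
  then have "AE x in lborel. \<forall>n. integrable lborel (\<lambda>y. complex_of_real (indicator (cball 0 (real n)) x) * F y * k (y - x))"
    unfolding AE_all_countable by blast
  then show ?thesis
  proof eventually_elim
    case (elim x)
    obtain n where n: "norm x < real n" using reals_Archimedean2 by blast
    have i: "integrable lborel (\<lambda>y. F y * k (y - x))"
      using spec[OF elim, of n] n by simp
    show ?case
    proof (rule Bochner_Integration.integrable_bound[OF Bochner_Integration.integrable_add[OF integrable_norm[OF F] integrable_norm[OF i]]])
      have "norm (F y) / norm (y - x) \<le> norm (F y) + norm (F y * k (y - x))" for y
      proof (cases "norm (y - x) \<le> 1")
        case False
        then have "norm (F y) / norm (y - x) \<le> norm (F y) / 1" by (intro divide_left_mono) auto
        then show ?thesis by (simp add: add_increasing2)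
      qed (simp add: k_def norm_mult norm_divide)
      then show "AE y in lborel. norm (norm (F y) / norm (y - x)) \<le> norm (norm (F y) + norm (F y * k (y - x)))"
        by auto
    qed measurable
  qed
qed

text \<open>The parametrix along integer radii $R \to \infty$: the cutoff error disappears in $L^2$ even if
  $\mathrm{Re}\, k = 0$, when the kernel itself does not decay faster than $1/|w|$.  This excludes any
  homogeneous solution.\<close>

lemma helmholtz_representation:
  fixes u F :: "R3 \<Rightarrow> complex"
  assumes u: "square_integrable u" and F: "integrable lborel F" and k: "Re k \<le> 0"
    and weak: "\<And>\<phi>. \<phi> \<in> test_functions \<Longrightarrow>
      (\<integral>x. u x * (test_laplacian \<phi> x - k\<^sup>2 * \<phi> x) \<partial>lborel) = (\<integral>x. F x * \<phi> x \<partial>lborel)"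
  shows "AE x in lborel. integrable lborel (\<lambda>y. norm (F y) / norm (y - x)) \<and> integrable lborel (\<lambda>y. F y * helmholtz_kernel k (norm (y - x)))
    \<and> 4 * pi * u x = - (\<integral>y. F y * helmholtz_kernel k (norm (y - x)) \<partial>lborel)"
proof -
  have [measurable]: "F \<in> borel_measurable borel" using borel_measurable_integrable[OF F] by simp
  obtain A where A: "A \<ge> 0" "\<And>R w. R > 0 \<Longrightarrow> w \<noteq> 0 \<Longrightarrow> norm (cutoff_kernel k R 0 w) \<le> A / norm w"
    using cutoff_kernel_bound[OF k] by blast
  have "AE x in lborel. 4 * pi * u x = (\<integral>y. u y * cutoff_error k (real (Suc n)) 0 (y - x) \<partial>lborel) - (\<integral>y. F y * cutoff_kernel k (real (Suc n)) 0 (y - x) \<partial>lborel)" for n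
    by (rule parametrix[OF square_integrable_imp_locally_integrable[OF u] integrable_imp_locally_integrable[OF F] k _ weak]) auto
  then have "AE x in lborel. \<forall>n. 4 * pi * u x = (\<integral>y. u y * cutoff_error k (real (Suc n)) 0 (y - x) \<partial>lborel) - (\<integral>y. F y * cutoff_kernel k (real (Suc n)) 0 (y - x) \<partial>lborel)"
    unfolding AE_all_countable by blast
  then show ?thesis using newton_potential_finite[OF F]
  proof eventually_elim
    case (elim x)
    note int = elim(2)
    have int': "integrable lborel (\<lambda>y. F y * helmholtz_kernel k (norm (y - x)))"
    proof (rule Bochner_Integration.integrable_bound[OF int])
      have "norm (F y * helmholtz_kernel k (norm (y - x))) \<le> norm (F y) / norm (y - x)" for y
      proof (cases "y = x")
        case False
        then show ?thesis
          using mult_left_mono[OF helmholtz_kernel_bounds(1)[OF k, of "norm (y - x)"] norm_ge_zero[of "F y"]] by (simp add: norm_mult)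
      qed (simp add: helmholtz_kernel_def)
      then show "AE y in lborel. norm (F y * helmholtz_kernel k (norm (y - x))) \<le> norm (norm (F y) / norm (y - x))" by auto
    qed measurable
    have "(\<lambda>n. \<integral>y. F y * cutoff_kernel k (real (Suc n)) 0 (y - x) \<partial>lborel) \<longlonglongrightarrow> (\<integral>y. F y * helmholtz_kernel k (norm (y - x)) \<partial>lborel)"
    proof (rule integral_dominated_convergence[OF _ _ integrable_mult_right[OF int, of A]])
      have cutoff: "(\<lambda>n. cutoff 0 (c / (real (Suc n))\<^sup>2)) \<longlonglongrightarrow> cutoff 0 0" for c
      proof (rule isCont_tendsto_compose[OF DERIV_isCont[OF cutoff_has_derivative]])
        have "(\<lambda>n. c * (inverse (real (Suc n)))\<^sup>2) \<longlonglongrightarrow> c * 0\<^sup>2"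
          by (intro tendsto_intros LIMSEQ_inverse_real_of_nat)
        then show "(\<lambda>n. c / (real (Suc n))\<^sup>2) \<longlonglongrightarrow> 0" by (simp add: divide_inverse power_inverse)
      qed
      have "(\<lambda>n. F y * cutoff_kernel k (real (Suc n)) 0 (y - x)) \<longlonglongrightarrow> F y * (of_real (cutoff 0 0) * helmholtz_kernel k (norm (y - x)))" for y
        unfolding cutoff_kernel_def by (simp del: of_nat_Suc, intro tendsto_intros cutoff)
      then show "AE y in lborel. (\<lambda>n. F y * cutoff_kernel k (real (Suc n)) 0 (y - x)) \<longlonglongrightarrow> F y * helmholtz_kernel k (norm (y - x))"
        by (simp add: cutoff_0_0)
      show "AE y in lborel. norm (F y * cutoff_kernel k (real (Suc n)) 0 (y - x)) \<le> A * (norm (F y) / norm (y - x))" for n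
        using AE_lborel_singleton[of x]
      proof eventually_elim
        case (elim y)
        then have "norm (cutoff_kernel k (real (Suc n)) 0 (y - x)) \<le> A / norm (y - x)" by (intro A) auto
        from mult_left_mono[OF this norm_ge_zero[of "F y"]] show ?case by (simp add: norm_mult mult_ac)
      qed
    qed measurable
    note kernel_lim = this
    have "(\<lambda>n. (\<integral>y. u y * cutoff_error k (real (Suc n)) 0 (y - x) \<partial>lborel) - (\<integral>y. F y * cutoff_kernel k (real (Suc n)) 0 (y - x) \<partial>lborel)) \<longlonglongrightarrow>
        0 - (\<integral>y. F y * helmholtz_kernel k (norm (y - x)) \<partial>lborel)"
      by (rule tendsto_diff[OF cutoff_error_convolution_tendsto_0[OF u k] kernel_lim])
    moreover have "(\<lambda>n. (\<integral>y. u y * cutoff_error k (real (Suc n)) 0 (y - x) \<partial>lborel) - (\<integral>y. F y * cutoff_kernel k (real (Suc n)) 0 (y - x) \<partial>lborel)) = (\<lambda>n. 4 * pi * u x)"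
      by (rule ext) (rule spec[OF elim(1), symmetric])
    ultimately have "4 * pi * u x = - (\<integral>y. F y * helmholtz_kernel k (norm (y - x)) \<partial>lborel)"
      by (simp only: LIMSEQ_const_iff diff_0)
    with int int' show ?case by (intro conjI)
  qed
qed

section \<open>A Hardy--Littlewood--Sobolev inequality\<close>

lemma cubic_young:
  fixes \<tau> \<kappa> :: real
  assumes "0 \<le> \<tau>" "0 \<le> \<kappa>"
  shows "\<tau>\<^sup>2 * \<kappa> \<le> 2 / 3 * \<tau> ^ 3 + \<kappa> ^ 3 / 3"
proof -
  have "0 \<le> (\<tau> - \<kappa>)\<^sup>2 * (2 * \<tau> + \<kappa>)" using assms by simp
  also have "\<dots> = 3 * (2 / 3 * \<tau> ^ 3 + \<kappa> ^ 3 / 3 - \<tau>\<^sup>2 * \<kappa>)" by (simp add: algebra_simps eval_nat_numeral)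
  finally show ?thesis by simp
qed

text \<open>For $\tau \le 1 \le \kappa$ the tangent of the cubic $\kappa^3/3$ at $\kappa = 1$ takes its
  place, because the left-hand side is linear in $\kappa$ with slope $\tau^2 \le 1$.\<close>

lemma cubic_young_truncated:
  fixes \<tau> \<kappa> :: real
  assumes "0 \<le> \<tau>" "\<tau> \<le> 1" "1 \<le> \<kappa>"
  shows "\<tau>\<^sup>2 * \<kappa> \<le> 2 / 3 * \<tau> ^ 3 + (\<kappa> - 2 / 3)"
proof -
  have "\<tau>\<^sup>2 \<le> 1" using assms by (simp add: power_le_one)
  then have "0 \<le> (\<kappa> - 1) * (1 - \<tau>\<^sup>2)" using assms by simp
  moreover have "0 \<le> (1 - \<tau>)\<^sup>2 * (1 + 2 * \<tau>) / 3" using assms by simp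
  moreover have "(\<kappa> - 1) * (1 - \<tau>\<^sup>2) + (1 - \<tau>)\<^sup>2 * (1 + 2 * \<tau>) / 3 = 2 / 3 * \<tau> ^ 3 + (\<kappa> - 2 / 3) - \<tau>\<^sup>2 * \<kappa>"
    by (simp add: field_simps eval_nat_numeral)
  ultimately show ?thesis by linarith
qed

text \<open>The maximum over $0 \le s \le a$ of $s/r^2 - \mu s^{3/2}$, where the multiplier
  $\mu = 2 / (3 \rho^2 \sqrt a)$ is chosen such that the constraint $s \le a$ becomes active at $r = \rho$.\<close>

definition hls_weight :: "real \<Rightarrow> real \<Rightarrow> real \<Rightarrow> real" where
  "hls_weight a \<rho> r = (if r < \<rho> then a / r\<^sup>2 - 2 * a / (3 * \<rho>\<^sup>2) else a * \<rho> ^ 4 / (3 * r ^ 6))"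

text \<open>After the substitution $\tau^2 = s/a$ and $\kappa = \rho^2/r^2$ this is one of the two cubic
  inequalities above.\<close>

lemma truncated_kernel_bound:
  assumes a: "a > 0" and \<rho>: "\<rho> > 0" and r: "r > 0" and s: "0 \<le> s" "s \<le> a"
  shows "s / r\<^sup>2 \<le> 2 / (3 * \<rho>\<^sup>2 * sqrt a) * s powr (3/2) + hls_weight a \<rho> r" "0 \<le> hls_weight a \<rho> r"
proof -
  \<comment> \<open>Both variables are normalised by the values at which the two regimes meet.\<close>
  define \<tau> where "\<tau> = sqrt (s / a)"
  define \<kappa> where "\<kappa> = \<rho>\<^sup>2 / r\<^sup>2"
  have \<tau>: "0 \<le> \<tau>" "\<tau> \<le> 1" "\<tau>\<^sup>2 = s / a" using a s by (simp_all add: \<tau>_def)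
  have \<kappa>: "0 \<le> \<kappa>" by (simp add: \<kappa>_def)
  have "s powr (3/2) = sqrt s ^ 3"
    using s powr_half_sqrt_powr[of s 3] by (simp add: powr_half_sqrt_powr powr_numeral real_sqrt_power)
  then have s32: "s powr (3/2) = \<tau> ^ 3 * sqrt a ^ 3" using a s by (simp add: \<tau>_def real_sqrt_divide power_divide)
  have e1: "s / r\<^sup>2 = (\<tau>\<^sup>2 * \<kappa>) * (a / \<rho>\<^sup>2)" using a \<rho> by (simp add: \<tau> \<kappa>_def)
  have "sqrt a ^ 3 = a * sqrt a" using a by (simp add: eval_nat_numeral)
  then have e2: "2 / (3 * \<rho>\<^sup>2 * sqrt a) * s powr (3/2) = (2 / 3 * \<tau> ^ 3) * (a / \<rho>\<^sup>2)"
    using a \<rho> unfolding s32 by (simp add: field_simps)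
  have "s / r\<^sup>2 \<le> 2 / (3 * \<rho>\<^sup>2 * sqrt a) * s powr (3/2) + hls_weight a \<rho> r \<and> 0 \<le> hls_weight a \<rho> r"
  proof (cases "r < \<rho>")
    case True
    then have k1: "1 \<le> \<kappa>" using r \<rho> by (simp add: \<kappa>_def power_mono)
    have w: "hls_weight a \<rho> r = (\<kappa> - 2 / 3) * (a / \<rho>\<^sup>2)"
      using True \<rho> r by (simp add: hls_weight_def \<kappa>_def field_simps)
    have "(\<tau>\<^sup>2 * \<kappa>) * (a / \<rho>\<^sup>2) \<le> (2 / 3 * \<tau> ^ 3 + (\<kappa> - 2 / 3)) * (a / \<rho>\<^sup>2)"
      using cubic_young_truncated[OF \<tau>(1,2) k1] a by (intro mult_right_mono) auto
    then show ?thesis unfolding e1 e2 w distrib_right by (intro conjI, assumption) (use k1 a in simp)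
  next
    case False
    have w: "hls_weight a \<rho> r = (\<kappa> ^ 3 / 3) * (a / \<rho>\<^sup>2)"
      using False \<rho> r by (simp add: hls_weight_def \<kappa>_def power_divide field_simps eval_nat_numeral)
    have "(\<tau>\<^sup>2 * \<kappa>) * (a / \<rho>\<^sup>2) \<le> (2 / 3 * \<tau> ^ 3 + \<kappa> ^ 3 / 3) * (a / \<rho>\<^sup>2)"
      using cubic_young[OF \<tau>(1) \<kappa>] a by (intro mult_right_mono) auto
    then show ?thesis unfolding e1 e2 w distrib_right by (intro conjI, assumption) (use \<kappa> a in simp)
  qed
  then show "s / r\<^sup>2 \<le> 2 / (3 * \<rho>\<^sup>2 * sqrt a) * s powr (3/2) + hls_weight a \<rho> r" "0 \<le> hls_weight a \<rho> r" by auto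
qed

lemma hls_weight_borel [measurable]: "hls_weight a \<rho> \<in> borel_measurable borel"
  unfolding hls_weight_def[abs_def] by measurable

lemma nn_integral_hls_weight:
  assumes a: "a > 0" and \<rho>: "\<rho> > 0"
  shows "(\<integral>\<^sup>+w. ennreal (hls_weight a \<rho> (norm (w::R3))) \<partial>lborel) \<le> ennreal (32 * pi / 9 * a * \<rho>)"
proof -
  let ?f = "\<lambda>r. ennreal (4 * pi * r\<^sup>2) * indicator {0..} r * ennreal (hls_weight a \<rho> r)"
  let ?g = "\<lambda>r. ennreal (4 * pi * a - 8 * pi * a / (3 * \<rho>\<^sup>2) * r\<^sup>2) * indicator {0..\<rho>} r"
  let ?h = "\<lambda>r. ennreal (4 * pi * a * \<rho> ^ 4 / (3 * r ^ 4)) * indicator {\<rho>..} r"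
  have "(\<integral>\<^sup>+w. ennreal (hls_weight a \<rho> (norm (w::R3))) \<partial>lborel) = (\<integral>\<^sup>+r. ?f r \<partial>lborel)"
    by (rule nn_integral_radial) measurable
  also have "\<dots> \<le> (\<integral>\<^sup>+r. ?g r + ?h r \<partial>lborel)"
  proof (rule nn_integral_mono_AE)
    show "AE r in lborel. ?f r \<le> ?g r + ?h r"
      using AE_lborel_singleton[of "0::real"]
    proof eventually_elim
      case (elim r)
      show ?case
      proof (cases "r < 0")
        case False
        then have r: "r > 0" using elim by simp
        note w = truncated_kernel_bound(2)[OF a \<rho> r, of 0]
        show ?thesis
        proof (cases "r < \<rho>")
          case True
          have "4 * pi * r\<^sup>2 * hls_weight a \<rho> r = 4 * pi * a - 8 * pi * a / (3 * \<rho>\<^sup>2) * r\<^sup>2"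
            using True r by (simp add: hls_weight_def right_diff_distrib)
          then show ?thesis using True r w a by (simp add: ennreal_mult[symmetric])
        next
          case False
          have "4 * pi * r\<^sup>2 * hls_weight a \<rho> r = 4 * pi * a * \<rho> ^ 4 / (3 * r ^ 4)"
            using False r by (simp add: hls_weight_def eval_nat_numeral)
          then have "?f r = ?h r" using False r w a by (simp add: ennreal_mult[symmetric])
          then show ?thesis by simp
        qed
      qed simp
    qed
  qed
  also have "\<dots> = (\<integral>\<^sup>+r. ?g r \<partial>lborel) + (\<integral>\<^sup>+r. ?h r \<partial>lborel)"
    by (rule nn_integral_add) measurable
  also have "(\<integral>\<^sup>+r. ?g r \<partial>lborel) = ennreal ((4 * pi * a * \<rho> - 8 * pi * a / (9 * \<rho>\<^sup>2) * \<rho> ^ 3) - (4 * pi * a * 0 - 8 * pi * a / (9 * \<rho>\<^sup>2) * 0 ^ 3))"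
  proof (rule nn_integral_FTC_Icc[where F = "\<lambda>r. 4 * pi * a * r - 8 * pi * a / (9 * \<rho>\<^sup>2) * r ^ 3"])
    fix r :: real assume "r \<in> {0..\<rho>}"
    then have r: "0 \<le> r" "r \<le> \<rho>" by auto
    show "((\<lambda>r. 4 * pi * a * r - 8 * pi * a / (9 * \<rho>\<^sup>2) * r ^ 3) has_real_derivative 4 * pi * a - 8 * pi * a / (3 * \<rho>\<^sup>2) * r\<^sup>2) (at r)"
    proof -
      have cube: "((\<lambda>r. A * r - C * r ^ 3) has_real_derivative A - C * (3 * r\<^sup>2)) (at r)" for A C
        by (auto intro!: derivative_eq_intros)
      show ?thesis by (rule DERIV_cong[OF cube]) simp
    qed
    have "r\<^sup>2 / \<rho>\<^sup>2 \<le> 1" using r \<rho> by (simp add: power_mono)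
    then have "8 * pi * a / 3 * (r\<^sup>2 / \<rho>\<^sup>2) \<le> 8 * pi * a / 3 * 1" using a by (intro mult_left_mono) auto
    moreover have "8 * pi * a / (3 * \<rho>\<^sup>2) * r\<^sup>2 = 8 * pi * a / 3 * (r\<^sup>2 / \<rho>\<^sup>2)" by simp
    moreover have "8 * pi * a / 3 * 1 \<le> 4 * pi * a" using a by simp
    ultimately show "0 \<le> 4 * pi * a - 8 * pi * a / (3 * \<rho>\<^sup>2) * r\<^sup>2" by linarith
  qed (use \<rho> in auto)
  also have "(\<integral>\<^sup>+r. ?h r \<partial>lborel) = ennreal (0 - (- (4 * pi * a * \<rho> ^ 4 / 9 * inverse (\<rho> ^ 3))))"
  proof (rule nn_integral_FTC_atLeast[where F = "\<lambda>r. - (4 * pi * a * \<rho> ^ 4 / 9 * inverse (r ^ 3))"])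
    fix r :: real assume r: "\<rho> \<le> r"
    then have "r > 0" using \<rho> by simp
    then show "((\<lambda>r. - (4 * pi * a * \<rho> ^ 4 / 9 * inverse (r ^ 3))) has_real_derivative 4 * pi * a * \<rho> ^ 4 / (3 * r ^ 4)) (at r)"
      by (auto intro!: derivative_eq_intros simp: field_simps eval_nat_numeral)
    show "0 \<le> 4 * pi * a * \<rho> ^ 4 / (3 * r ^ 4)" using a by simp
  next
    have "((\<lambda>r::real. - (4 * pi * a * \<rho> ^ 4 / 9 * (inverse r) ^ 3)) \<longlongrightarrow> - (4 * pi * a * \<rho> ^ 4 / 9 * 0 ^ 3)) at_top"
      by (intro tendsto_intros tendsto_inverse_0_at_top filterlim_ident)
    then show "((\<lambda>r. - (4 * pi * a * \<rho> ^ 4 / 9 * inverse (r ^ 3))) \<longlongrightarrow> 0) at_top" by (simp add: power_inverse)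
  qed measurable
  also have "ennreal ((4 * pi * a * \<rho> - 8 * pi * a / (9 * \<rho>\<^sup>2) * \<rho> ^ 3) - (4 * pi * a * 0 - 8 * pi * a / (9 * \<rho>\<^sup>2) * 0 ^ 3))
      + ennreal (0 - (- (4 * pi * a * \<rho> ^ 4 / 9 * inverse (\<rho> ^ 3)))) = ennreal (28 * pi / 9 * a * \<rho>) + ennreal (4 * pi / 9 * a * \<rho>)"
    using \<rho> by (intro arg_cong2[where f = "(+)"] arg_cong[where f = ennreal]) (simp_all add: field_simps eval_nat_numeral)
  also have "\<dots> = ennreal (32 * pi / 9 * a * \<rho>)"
    using a \<rho> by (simp flip: ennreal_plus add: field_simps)
  finally show ?thesis .
qed

lemma powr_three_halves: "x \<ge> 0 \<Longrightarrow> x powr (3/2) = x * sqrt x"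
  using powr_add[of x 1 "1/2"] by (cases "x = 0") (simp_all add: powr_half_sqrt)

lemma DERIV_mult_sqrt: "((\<lambda>x. x * sqrt x) has_real_derivative 3 / 2 * sqrt x) (at x)" if "x \<ge> 0"
proof (cases "x = 0")
  case True
  have "((\<lambda>h. sqrt h) \<longlongrightarrow> sqrt 0) (at 0)" by (intro tendsto_intros)
  then have "((\<lambda>h. sqrt h) \<longlongrightarrow> 0) (at 0)" by simp
  then have "((\<lambda>h. (0 + h) * sqrt (0 + h) / h) \<longlongrightarrow> 0) (at 0)"
    by (rule Lim_transform_eventually) (auto simp: eventually_at_filter)
  then show ?thesis using True by (simp add: DERIV_def)
next
  case False
  then have "x > 0" using that by simp
  then show ?thesis
    by (auto intro!: derivative_eq_intros simp: field_simps)
qed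

text \<open>The choice $\rho = \sqrt{M/a}/2$ is a rational approximation of the optimal
  $\rho = (3/(8\pi))^{1/3} \sqrt{M/a}$.\<close>

lemma truncated_potential_bound:
  fixes q :: "R3 \<Rightarrow> real"
  assumes [measurable]: "q \<in> borel_measurable borel" and q: "\<And>y. q y \<ge> 0"
    and m: "(\<integral>\<^sup>+y. ennreal (q y powr (3/2)) \<partial>lborel) = ennreal (M powr (3/2))" and M: "M > 0" and a: "a > 0"
  shows "(\<integral>\<^sup>+y. ennreal (min a (q y) / (norm (y - x))\<^sup>2) \<partial>lborel) \<le> ennreal ((8 / 3 + 16 * pi / 9) * sqrt (a * M))"
proof -
  define \<rho> where "\<rho> = sqrt (M / a) / 2"
  have \<rho>: "\<rho> > 0" using M a by (simp add: \<rho>_def)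
  have \<rho>2: "\<rho>\<^sup>2 = M / a / 4" using M a by (simp add: \<rho>_def power_divide)
  define \<mu> where "\<mu> = 2 / (3 * \<rho>\<^sup>2 * sqrt a)"
  have \<mu>: "\<mu> > 0" using \<rho> a by (simp add: \<mu>_def)
  have "(\<integral>\<^sup>+y. ennreal (min a (q y) / (norm (y - x))\<^sup>2) \<partial>lborel)
      \<le> (\<integral>\<^sup>+y. ennreal \<mu> * ennreal (q y powr (3/2)) + ennreal (hls_weight a \<rho> (norm (y - x))) \<partial>lborel)"
  proof (rule nn_integral_mono_AE)
    show "AE y in lborel. ennreal (min a (q y) / (norm (y - x))\<^sup>2) \<le> ennreal \<mu> * ennreal (q y powr (3/2)) + ennreal (hls_weight a \<rho> (norm (y - x)))"
      using AE_lborel_singleton[of x]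
    proof eventually_elim
      case (elim y)
      then have r: "norm (y - x) > 0" by simp
      have s: "0 \<le> min a (q y)" "min a (q y) \<le> a" using q[of y] a by auto
      note b = truncated_kernel_bound[OF a \<rho> r s]
      have "min a (q y) powr (3/2) \<le> q y powr (3/2)" using s by (intro powr_mono2) auto
      then have "\<mu> * min a (q y) powr (3/2) \<le> \<mu> * q y powr (3/2)" using \<mu> by (intro mult_left_mono) auto
      then have "min a (q y) / (norm (y - x))\<^sup>2 \<le> \<mu> * q y powr (3/2) + hls_weight a \<rho> (norm (y - x))"
        using b(1) unfolding \<mu>_def by linarith
      then show ?case using \<mu> b(2) by (simp flip: ennreal_mult ennreal_plus add: ennreal_leI)
    qed
  qed
  also have "\<dots> = ennreal \<mu> * ennreal (M powr (3/2)) + (\<integral>\<^sup>+y. ennreal (hls_weight a \<rho> (norm (y - x))) \<partial>lborel)"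
    by (simp add: nn_integral_add nn_integral_cmult m)
  also have "(\<integral>\<^sup>+y. ennreal (hls_weight a \<rho> (norm (y - x))) \<partial>lborel) = (\<integral>\<^sup>+w. ennreal (hls_weight a \<rho> (norm (w::R3))) \<partial>lborel)"
    by (rule nn_integral_lborel_shift[of "\<lambda>w. ennreal (hls_weight a \<rho> (norm w))"]) measurable
  also have "ennreal \<mu> * ennreal (M powr (3/2)) + \<dots> \<le> ennreal (\<mu> * M powr (3/2)) + ennreal (32 * pi / 9 * a * \<rho>)"
    using nn_integral_hls_weight[OF a \<rho>] \<mu> by (simp add: ennreal_mult add_left_mono)
  also have "\<dots> = ennreal (\<mu> * M powr (3/2) + 32 * pi / 9 * a * \<rho>)"
    using \<mu> a \<rho> by (intro ennreal_plus[symmetric]) auto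
  also have "\<mu> * M powr (3/2) = 8 / 3 * sqrt (a * M)"
  proof -
    have "M powr (3/2) = M * sqrt M" using M by (simp add: powr_three_halves)
    then have "\<mu> * M powr (3/2) = 8 / 3 * (a / sqrt a) * sqrt M" using M a by (simp add: \<mu>_def \<rho>2 field_simps)
    also have "a / sqrt a = sqrt a" using a by (simp add: real_div_sqrt)
    finally show ?thesis by (simp add: real_sqrt_mult)
  qed
  also have "32 * pi / 9 * a * \<rho> = 16 * pi / 9 * sqrt (a * M)"
  proof -
    have "a * sqrt (M / a) = sqrt (a * M)"
    proof -
      have "a * sqrt (M / a) = (a / sqrt a) * sqrt M" by (simp add: real_sqrt_divide)
      also have "a / sqrt a = sqrt a" using a by (simp add: real_div_sqrt)
      finally show ?thesis by (simp add: real_sqrt_mult)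
    qed
    then show ?thesis by (simp add: \<rho>_def)
  qed
  also have "8 / 3 * sqrt (a * M) + 16 * pi / 9 * sqrt (a * M) = (8 / 3 + 16 * pi / 9) * sqrt (a * M)"
    by (simp add: distrib_right)
  finally show ?thesis .
qed

text \<open>The rectangle $[0,s] \times [0,t]$ is split along the diagonal.\<close>

lemma mult_layer_cake:
  fixes s t :: real
  assumes "0 \<le> s" "0 \<le> t"
  shows "ennreal (s * t) = (\<integral>\<^sup>+a. ennreal (min a t) * indicator {0..s} a \<partial>lborel) + (\<integral>\<^sup>+a. ennreal (min a s) * indicator {0..t} a \<partial>lborel)"
proof -
  have *: "ennreal (s * t) = (\<integral>\<^sup>+a. ennreal (min a t) * indicator {0..s} a \<partial>lborel) + (\<integral>\<^sup>+a. ennreal (min a s) * indicator {0..t} a \<partial>lborel)"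
    if st: "0 \<le> t" "t \<le> s" for s t :: real
  proof -
    have id: "(\<integral>\<^sup>+a. ennreal a * indicator {0..t} a \<partial>lborel) = ennreal (t\<^sup>2 / 2 - 0\<^sup>2 / 2)"
      using st by (intro nn_integral_FTC_Icc) (auto intro!: derivative_eq_intros)
    have "(\<integral>\<^sup>+a. ennreal (min a s) * indicator {0..t} a \<partial>lborel) = (\<integral>\<^sup>+a. ennreal a * indicator {0..t} a \<partial>lborel)"
      using st by (intro nn_integral_cong) (auto simp: indicator_def)
    then have 1: "(\<integral>\<^sup>+a. ennreal (min a s) * indicator {0..t} a \<partial>lborel) = ennreal (t\<^sup>2 / 2)" using id by simp
    have "(\<integral>\<^sup>+a. ennreal (min a t) * indicator {0..s} a \<partial>lborel)
        = (\<integral>\<^sup>+a. ennreal a * indicator {0..t} a + ennreal t * indicator {t<..s} a \<partial>lborel)"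
      using st by (intro nn_integral_cong) (auto simp: indicator_def)
    also have "\<dots> = (\<integral>\<^sup>+a. ennreal a * indicator {0..t} a \<partial>lborel) + ennreal t * emeasure lborel {t<..s}"
      by (subst nn_integral_add) (auto simp: nn_integral_cmult_indicator)
    also have "\<dots> = ennreal (t\<^sup>2 / 2 + t * (s - t))"
      using st by (simp add: id ennreal_mult ennreal_plus)
    finally have 2: "(\<integral>\<^sup>+a. ennreal (min a t) * indicator {0..s} a \<partial>lborel) = ennreal (t\<^sup>2 / 2 + t * (s - t))" .
    have "ennreal (s * t) = ennreal ((t\<^sup>2 / 2 + t * (s - t)) + t\<^sup>2 / 2)"
      by (simp add: power2_eq_square algebra_simps)
    also have "\<dots> = ennreal (t\<^sup>2 / 2 + t * (s - t)) + ennreal (t\<^sup>2 / 2)"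
      using st by (intro ennreal_plus) auto
    finally show ?thesis unfolding 1 2 .
  qed
  show ?thesis
  proof (cases "t \<le> s")
    case True
    then show ?thesis using *[of t s] assms by simp
  next
    case False
    then show ?thesis using *[of s t] assms by (simp add: add.commute mult.commute)
  qed
qed

text \<open>A layer-cake argument.  Splitting the product $q(x) q(y)$ along the diagonal of the two level
  parameters leaves, for each level $a$ of one factor, the potential of the other factor truncated at $a$,
  which is of order $\sqrt{a M}$.  Integration over $0 \le a \le q(x)$ gains the factor $2/3$ compared with
  the cruder splitting into $q(y) \le q(x)$ and $q(x) \le q(y)$.\<close>

lemma hls_inequality:
  fixes q :: "R3 \<Rightarrow> real"
  assumes [measurable]: "q \<in> borel_measurable borel" and q: "\<And>y. q y \<ge> 0"
    and m: "(\<integral>\<^sup>+y. ennreal (q y powr (3/2)) \<partial>lborel) = ennreal (M powr (3/2))" and M: "M > 0"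
  shows "(\<integral>\<^sup>+x. \<integral>\<^sup>+y. ennreal (q x * q y / (norm (y - x))\<^sup>2) \<partial>lborel \<partial>lborel) \<le> ennreal ((32 / 9 + 64 * pi / 27) * M\<^sup>2)"
proof -
  define B where "B = 8 / 3 + 16 * pi / 9"
  have B: "B \<ge> 0" by (simp add: B_def)
  define f where "f x y = (\<integral>\<^sup>+a. ennreal (min a (q y)) * indicator {0..q x} a \<partial>lborel) * ennreal (1 / (norm (y - x))\<^sup>2)" for x y
  have fm [measurable]: "(\<lambda>(x, y). f x y) \<in> borel_measurable (lborel \<Otimes>\<^sub>M lborel)"
    unfolding f_def indicator_def of_bool_def atLeastAtMost_iff by measurable
  have "(\<integral>\<^sup>+x. \<integral>\<^sup>+y. ennreal (q x * q y / (norm (y - x))\<^sup>2) \<partial>lborel \<partial>lborel) = (\<integral>\<^sup>+x. \<integral>\<^sup>+y. f x y + f y x \<partial>lborel \<partial>lborel)"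
  proof (intro nn_integral_cong)
    fix x y
    have "ennreal (q x * q y / (norm (y - x))\<^sup>2) = ennreal (q x * q y) * ennreal (1 / (norm (y - x))\<^sup>2)"
      using q by (simp flip: ennreal_mult)
    then show "ennreal (q x * q y / (norm (y - x))\<^sup>2) = f x y + f y x"
      unfolding mult_layer_cake[OF q q] f_def by (simp add: distrib_right norm_minus_commute)
  qed
  also have "\<dots> = (\<integral>\<^sup>+x. \<integral>\<^sup>+y. f x y \<partial>lborel \<partial>lborel) + (\<integral>\<^sup>+x. \<integral>\<^sup>+y. f y x \<partial>lborel \<partial>lborel)"
    by (subst nn_integral_add[symmetric]) (auto simp: nn_integral_add)
  also have "(\<integral>\<^sup>+x. \<integral>\<^sup>+y. f y x \<partial>lborel \<partial>lborel) = (\<integral>\<^sup>+x. \<integral>\<^sup>+y. f x y \<partial>lborel \<partial>lborel)"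
    by (rule lborel_pair.Fubini'[OF fm])
  also have "(\<integral>\<^sup>+x. \<integral>\<^sup>+y. f x y \<partial>lborel \<partial>lborel) \<le> (\<integral>\<^sup>+x. ennreal (2 / 3 * B * sqrt M) * ennreal (q x powr (3/2)) \<partial>lborel)"
  proof (intro nn_integral_mono)
    fix x
    have "(\<integral>\<^sup>+y. f x y \<partial>lborel) = (\<integral>\<^sup>+y. \<integral>\<^sup>+a. ennreal (min a (q y) / (norm (y - x))\<^sup>2) * indicator {0..q x} a \<partial>lborel \<partial>lborel)"
    proof (intro nn_integral_cong)
      fix y
      have "f x y = (\<integral>\<^sup>+a. ennreal (min a (q y)) * indicator {0..q x} a * ennreal (1 / (norm (y - x))\<^sup>2) \<partial>lborel)"
        unfolding f_def by (rule nn_integral_multc[symmetric]) measurable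
      also have "\<dots> = (\<integral>\<^sup>+a. ennreal (min a (q y) / (norm (y - x))\<^sup>2) * indicator {0..q x} a \<partial>lborel)"
        using q by (intro nn_integral_cong) (auto simp: indicator_def simp flip: ennreal_mult)
      finally show "f x y = \<dots>" .
    qed
    also have "\<dots> = (\<integral>\<^sup>+a. \<integral>\<^sup>+y. ennreal (min a (q y) / (norm (y - x))\<^sup>2) * indicator {0..q x} a \<partial>lborel \<partial>lborel)"
      by (rule lborel_pair.Fubini') (unfold indicator_def of_bool_def atLeastAtMost_iff, measurable)
    also have "\<dots> = (\<integral>\<^sup>+a. (\<integral>\<^sup>+y. ennreal (min a (q y) / (norm (y - x))\<^sup>2) \<partial>lborel) * indicator {0..q x} a \<partial>lborel)"
      by (intro nn_integral_cong nn_integral_multc) measurable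
    also have "\<dots> \<le> (\<integral>\<^sup>+a. ennreal (B * sqrt M * sqrt a) * indicator {0..q x} a \<partial>lborel)"
    proof (intro nn_integral_mono_AE)
      show "AE a in lborel. (\<integral>\<^sup>+y. ennreal (min a (q y) / (norm (y - x))\<^sup>2) \<partial>lborel) * indicator {0..q x} a \<le> ennreal (B * sqrt M * sqrt a) * indicator {0..q x} a"
        using AE_lborel_singleton[of "0::real"]
      proof eventually_elim
        case (elim a)
        show ?case
        proof (cases "a > 0")
          case True
          then show ?thesis
            using truncated_potential_bound[OF assms(1) q m M True, of x]
            by (auto simp: indicator_def B_def real_sqrt_mult mult_ac)
        qed (use elim in auto)
      qed
    qed
    also have "\<dots> = ennreal (2 / 3 * (B * sqrt M) * (q x * sqrt (q x)) - 2 / 3 * (B * sqrt M) * (0 * sqrt 0))"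
      using B M q by (intro nn_integral_FTC_Icc DERIV_cong[OF DERIV_cmult[OF DERIV_mult_sqrt]]) auto
    also have "\<dots> = ennreal (2 / 3 * B * sqrt M) * ennreal (q x powr (3/2))"
      using B M q[of x] by (simp flip: ennreal_mult add: powr_three_halves mult_ac)
    finally show "(\<integral>\<^sup>+y. f x y \<partial>lborel) \<le> ennreal (2 / 3 * B * sqrt M) * ennreal (q x powr (3/2))" .
  qed
  also have "\<dots> = ennreal (2 / 3 * B * sqrt M) * ennreal (M powr (3/2))"
    by (simp add: nn_integral_cmult m)
  also have "\<dots> = ennreal (2 / 3 * B * M\<^sup>2)"
  proof -
    have "M powr (3/2) = M * sqrt M" using M by (simp add: powr_three_halves)
    then have "2 / 3 * B * sqrt M * M powr (3/2) = 2 / 3 * B * (M * (sqrt M * sqrt M))" by simp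
    also have "\<dots> = 2 / 3 * B * M\<^sup>2" using M by (simp add: power2_eq_square)
    finally show ?thesis using B M by (simp flip: ennreal_mult)
  qed
  finally have "(\<integral>\<^sup>+x. \<integral>\<^sup>+y. ennreal (q x * q y / (norm (y - x))\<^sup>2) \<partial>lborel \<partial>lborel) \<le> ennreal (2 / 3 * B * M\<^sup>2) + ennreal (2 / 3 * B * M\<^sup>2)"
    by (simp add: add_mono)
  also have "\<dots> = ennreal ((32 / 9 + 64 * pi / 27) * M\<^sup>2)"
    using B by (simp flip: ennreal_plus add: B_def algebra_simps)
  finally show ?thesis .
qed

section \<open>The eigenvalue bound\<close>

text \<open>The maximum, about $1.144$, is attained near $t = 2.285$; any bound up to $1.327$ would do below.  Only for
  $t > \pi/2$ is the cosine negative, and there $e^{-t}$ is already small.\<close>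

lemma exp_neg_cos_bound:
  fixes t :: real
  assumes "t \<ge> 0"
  shows "1 + (exp (- t))\<^sup>2 - 2 * exp (- t) * cos t \<le> 33 / 25"
proof -
  define x where "x = exp (- t)"
  have x: "0 < x" "x \<le> 1" using assms by (simp_all add: x_def)
  \<comment> \<open>The bounds $(17/16)^n \le e^{n/16}$ are sharp enough for all values of $e^t$ below.\<close>
  have e16: "17 / 16 \<le> exp (1 / 16 :: real)" using exp_ge_add_one_self[of "1/16"] by simp
  have expn: "(17 / 16) ^ n \<le> exp (real n * (1 / 16))" for n
    using power_mono[OF e16, of n] unfolding exp_of_nat_mult by simp
  have "1 + x\<^sup>2 - 2 * x * cos t \<le> 33 / 25"
  proof -
    consider "t \<le> 1" | "1 \<le> t" "t \<le> pi / 2" | "pi / 2 \<le> t" "t \<le> 2" | "2 \<le> t" by linarith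
    then show ?thesis
    proof cases
      case 1
      have "cos (pi / 3) \<le> cos t" using 1 assms pi_gt3 by (intro cos_monotone_0_pi_le) auto
      then have "1 \<le> 2 * cos t" by (simp add: cos_60)
      then have "x * x \<le> x * (2 * cos t)" using x by (intro mult_left_mono) auto
      then show ?thesis by (simp add: power2_eq_square)
    next
      case 2
      have "cos t \<ge> 0" using 2 by (intro cos_ge_zero) auto
      then have c: "2 * x * cos t \<ge> 0" using x by simp
      have "exp 1 \<ge> (2::real)" using exp_ge_add_one_self[of 1] by simp
      moreover have "exp t \<ge> exp 1" using 2 by simp
      ultimately have "2 \<le> exp t" by linarith
      then have "x \<le> 1 / 2" by (simp add: x_def exp_minus field_simps)
      then have "x\<^sup>2 \<le> (1 / 2)\<^sup>2" using x by (intro power_mono) auto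
      then show ?thesis using c by (simp add: power2_eq_square)
    next
      case 3
      have "- cos t = sin (t - pi / 2)" by (simp add: sin_diff)
      also have "\<dots> \<le> t - pi / 2" using 3 by (intro sin_x_le_x) auto
      also have "\<dots> \<le> 43 / 100" using 3 pi_approx by simp
      finally have c: "- cos t \<le> 43 / 100" .
      have "(17 / 16) ^ 24 \<le> exp (3 / 2 :: real)" using expn[of 24] by simp
      moreover have "exp (3 / 2) \<le> exp t" using 3 pi_gt3 by simp
      moreover have "4 \<le> (17 / 16 :: real) ^ 24" by (simp add: power_divide)
      ultimately have "4 \<le> exp t" by linarith
      then have x4: "x \<le> 1 / 4" by (simp add: x_def exp_minus field_simps)
      have "x * (x + 2 * (- cos t)) \<le> x * (111 / 100)" using x c x4 by (intro mult_left_mono) auto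
      also have "\<dots> \<le> 1 / 4 * (111 / 100)" using x4 by (intro mult_right_mono) auto
      finally have "x * (x + 2 * (- cos t)) \<le> 111 / 400" by simp
      then show ?thesis by (simp add: power2_eq_square algebra_simps)
    next
      case 4
      have "(17 / 16) ^ 32 \<le> exp (2 :: real)" using expn[of 32] by simp
      moreover have "exp 2 \<le> exp t" using 4 by simp
      moreover have "69 / 10 \<le> (17 / 16 :: real) ^ 32" by (simp add: power_divide)
      ultimately have "69 / 10 \<le> exp t" by linarith
      then have x4: "x \<le> 10 / 69" by (simp add: x_def exp_minus field_simps)
      have "- (2 * x * cos t) \<le> 2 * x" using x cos_ge_minus_one[of t] mult_left_mono[of "- cos t" 1 "2 * x"] by simp
      moreover have "x\<^sup>2 \<le> (10 / 69)\<^sup>2" using x x4 by (intro power_mono) auto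
      ultimately show ?thesis using x4 by (simp add: power2_eq_square)
    qed
  qed
  then show ?thesis by (simp add: x_def)
qed

text \<open>With $A = r\,\mathrm{Re}\, p$ and $B = r\,\mathrm{Im}\, p$, the inequality
  $e^{-2A} + e^{-2B} \le 1 + e^{-2(A+B)}$ reduces the two parameters to their sum.\<close>

lemma exp_difference_bound:
  assumes "0 \<le> Re p" "0 \<le> Im p" "0 \<le> r"
  shows "norm (exp (\<i> * p * of_real r) - exp (- p * of_real r)) \<le> sqrt (33 / 25)"
proof -
  define A where "A = Re p * r"
  define B where "B = Im p * r"
  have AB: "A \<ge> 0" "B \<ge> 0" using assms by (simp_all add: A_def B_def)
  have "(norm (exp (\<i> * p * of_real r) - exp (- p * of_real r)))\<^sup>2
     = (exp (- B) * cos A - exp (- A) * cos B)\<^sup>2 + (exp (- B) * sin A + exp (- A) * sin B)\<^sup>2"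
    by (simp add: cmod_power2 Re_exp Im_exp A_def B_def)
  also have "\<dots> = (exp (- B))\<^sup>2 * ((sin A)\<^sup>2 + (cos A)\<^sup>2) + (exp (- A))\<^sup>2 * ((sin B)\<^sup>2 + (cos B)\<^sup>2)
      - 2 * (exp (- A) * exp (- B)) * (cos A * cos B - sin A * sin B)"
  proof -
    have "(e * c - f * d)\<^sup>2 + (e * s + f * t)\<^sup>2 = e\<^sup>2 * (s\<^sup>2 + c\<^sup>2) + f\<^sup>2 * (t\<^sup>2 + d\<^sup>2) - 2 * (f * e) * (c * d - s * t)"
      for c d e f s t :: real by (simp add: power2_eq_square algebra_simps)
    then show ?thesis .
  qed
  also have "\<dots> = (exp (- B))\<^sup>2 + (exp (- A))\<^sup>2 - 2 * exp (- (A + B)) * cos (A + B)"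
  proof -
    have "exp (- A) * exp (- B) = exp (- (A + B))" by (metis exp_add minus_add_distrib)
    then show ?thesis unfolding sin_cos_squared_add cos_add[symmetric] by simp
  qed
  also have "\<dots> \<le> 1 + (exp (- (A + B)))\<^sup>2 - 2 * exp (- (A + B)) * cos (A + B)"
  proof -
    have "0 \<le> (1 - (exp (- A))\<^sup>2) * (1 - (exp (- B))\<^sup>2)"
      using AB by (intro mult_nonneg_nonneg) (auto simp: power_le_one)
    moreover have "(exp (- (A + B)))\<^sup>2 = (exp (- A))\<^sup>2 * (exp (- B))\<^sup>2"
      by (simp add: exp_add exp_diff exp_minus power_mult_distrib power_divide divide_inverse power_inverse)
    ultimately show ?thesis by (simp add: algebra_simps)
  qed
  also have "\<dots> \<le> 33 / 25" using AB by (intro exp_neg_cos_bound) simp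
  finally show ?thesis by (rule real_le_rsqrt)
qed

text \<open>In the closed first quadrant both $i p$ and $-p$ have nonpositive real part.\<close>

lemma fourth_root:
  fixes z :: complex
  obtains p where "p ^ 4 = z" "0 \<le> Re p" "0 \<le> Im p"
proof
  define p where "p = of_real (root 4 (norm z)) * cis (Arg2pi z / 4)"
  have "cis (Arg2pi z / 4) ^ 4 = cis (real 4 * (Arg2pi z / 4))" by (rule Complex.DeMoivre)
  then have "p ^ 4 = of_real (norm z) * cis (Arg2pi z)"
    by (simp add: p_def power_mult_distrib flip: of_real_power)
  also have "\<dots> = z" by (metis Arg2pi_eq cis_conv_exp)
  finally show "p ^ 4 = z" .
  have "0 \<le> Arg2pi z / 4" "Arg2pi z / 4 \<le> pi / 2" using Arg2pi_ge_0[of z] Arg2pi_lt_2pi[of z] by auto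
  then have "0 \<le> cos (Arg2pi z / 4)" "0 \<le> sin (Arg2pi z / 4)" by (auto intro!: cos_ge_zero sin_ge_zero)
  then show "0 \<le> Re p" "0 \<le> Im p" by (simp_all add: p_def)
qed

text \<open>Cubing turns this into a rational inequality in $\pi$.  The two sides differ by less than one per cent.\<close>

lemma hls_constant_suffices: "33 / 25 / (64 * pi\<^sup>2) * (32 / 9 + 64 * pi / 27) \<le> 1 / 8 * (1 / (4 * pi) powr (2/3))"
proof -
  define P where "P = (4 * pi) powr (2/3)"
  have P: "P > 0" by (simp add: P_def)
  have "P ^ 3 = (4 * pi) powr (2/3 * 3)" unfolding P_def by (subst powr_realpow[symmetric]) (simp_all only: powr_powr, auto)
  then have P3: "P ^ 3 = 16 * pi\<^sup>2" by (simp add: power_mult_distrib)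
  have "(33 / 25 / 8 * (32 / 9 + 64 * pi / 27) * P) ^ 3 \<le> (pi\<^sup>2) ^ 3"
  proof -
    have "33 / 25 / 8 * (32 / 9 + 64 * pi / 27) \<le> 33 / 25 / 8 * (32 / 9 + 64 * (315 / 100) / 27)"
      using pi_approx by (intro mult_left_mono add_left_mono divide_right_mono) auto
    also have "\<dots> \<le> 182 / 100" by simp
    finally have "(33 / 25 / 8 * (32 / 9 + 64 * pi / 27)) ^ 3 \<le> (182 / 100) ^ 3"
      by (rule power_mono) simp
    then have "(33 / 25 / 8 * (32 / 9 + 64 * pi / 27) * P) ^ 3 \<le> (182 / 100) ^ 3 * (16 * pi\<^sup>2)"
      unfolding power_mult_distrib[of _ P] P3 by (rule mult_right_mono) simp
    also have "\<dots> \<le> pi ^ 4 * pi\<^sup>2"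
    proof (rule mult_right_mono[of "(182 / 100) ^ 3 * 16", simplified mult.assoc])
      have "(314 / 100) ^ 4 \<le> pi ^ 4" using pi_approx by (intro power_mono) auto
      then show "(182 / 100) ^ 3 * 16 \<le> pi ^ 4" by (simp add: power_divide)
    qed simp
    finally show ?thesis by (simp add: eval_nat_numeral)
  qed
  then have "33 / 25 / 8 * (32 / 9 + 64 * pi / 27) * P \<le> pi\<^sup>2"
    by (rule power_le_imp_le_base[of _ 2, unfolded eval_nat_numeral, folded eval_nat_numeral]) simp
  then show ?thesis using P unfolding P_def[symmetric] by (simp add: field_simps)
qed


text \<open>Let $N = \int q w^2$.  The kernel $q(x) w(x) |x-y|^{-1} q(y) w(y)$ is the product of
  $\sqrt{q(x) q(y)}\, w(x) w(y)$, whose square has the double integral $N^2$, and of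
  $\sqrt{q(x) q(y)}\, |x-y|^{-1}$, to whose square the Hardy--Littlewood--Sobolev inequality applies.  The
  finite positive number $N$ cancels.\<close>

lemma birman_schwinger_bound:
  fixes q w :: "R3 \<Rightarrow> real"
  assumes [measurable]: "q \<in> borel_measurable borel" "w \<in> borel_measurable borel"
    and q: "\<And>y. q y \<ge> 0" and w: "\<And>y. w y \<ge> 0"
    and m: "(\<integral>\<^sup>+y. ennreal (q y powr (3/2)) \<partial>lborel) = ennreal (M powr (3/2))" and M: "M > 0"
    and c: "c \<ge> 0" and pot: "AE x in lborel. ennreal (w x) \<le> ennreal c * (\<integral>\<^sup>+y. ennreal (q y * w y / norm (y - x)) \<partial>lborel)"
    and N: "(\<integral>\<^sup>+x. ennreal (q x * (w x)\<^sup>2) \<partial>lborel) < \<infinity>" "(\<integral>\<^sup>+x. ennreal (q x * (w x)\<^sup>2) \<partial>lborel) \<noteq> 0"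
  shows "1 \<le> c\<^sup>2 * ((32 / 9 + 64 * pi / 27) * M\<^sup>2)"
proof -
  define N where "N = (\<integral>\<^sup>+x. ennreal (q x * (w x)\<^sup>2) \<partial>lborel)"
  define n where "n = enn2real N"
  have n: "N = ennreal n" "n > 0"
    using N unfolding n_def N_def[symmetric] by (auto simp: enn2real_positive_iff zero_less_iff_neq_zero)
  define H where "H = (32 / 9 + 64 * pi / 27) * M\<^sup>2"
  have H: "H \<ge> 0" by (simp add: H_def)
  define f where "f p = ennreal (sqrt (q (fst p) * q (snd p)) * (w (fst p) * w (snd p)))" for p
  define g where "g p = ennreal (sqrt (q (fst p) * q (snd p)) / norm (snd p - fst p))" for p
  have [measurable]: "f \<in> borel_measurable (lborel \<Otimes>\<^sub>M lborel)" "g \<in> borel_measurable (lborel \<Otimes>\<^sub>M lborel)"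
    unfolding f_def[abs_def] g_def[abs_def] by measurable
  have fg: "f (x, y) * g (x, y) = ennreal (q x * w x) * ennreal (q y * w y / norm (y - x))" for x y
  proof -
    have "sqrt (q x * q y) * (w x * w y) * (sqrt (q x * q y) / norm (y - x))
        = (sqrt (q x * q y) * sqrt (q x * q y)) * (w x * w y) / norm (y - x)" by simp
    also have "\<dots> = (q x * w x) * (q y * w y / norm (y - x))" using q by simp
    finally show ?thesis using q w by (simp add: f_def g_def flip: ennreal_mult)
  qed
  have f2: "(\<integral>\<^sup>+p. f p ^ 2 \<partial>(lborel \<Otimes>\<^sub>M lborel)) = N * N"
  proof -
    have "(\<integral>\<^sup>+p. f p ^ 2 \<partial>(lborel \<Otimes>\<^sub>M lborel)) = (\<integral>\<^sup>+x. \<integral>\<^sup>+y. f (x, y) ^ 2 \<partial>lborel \<partial>lborel)"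
      by (rule lborel.nn_integral_fst[symmetric]) measurable
    also have "\<dots> = (\<integral>\<^sup>+x. \<integral>\<^sup>+y. ennreal (q x * (w x)\<^sup>2) * ennreal (q y * (w y)\<^sup>2) \<partial>lborel \<partial>lborel)"
    proof (intro nn_integral_cong)
      fix x y
      have "(sqrt (q x * q y) * (w x * w y))\<^sup>2 = (q x * (w x)\<^sup>2) * (q y * (w y)\<^sup>2)"
        using q by (simp add: power_mult_distrib)
      then show "f (x, y) ^ 2 = ennreal (q x * (w x)\<^sup>2) * ennreal (q y * (w y)\<^sup>2)"
        using q w by (simp add: f_def ennreal_power flip: ennreal_mult)
    qed
    also have "\<dots> = (\<integral>\<^sup>+x. ennreal (q x * (w x)\<^sup>2) * N \<partial>lborel)"
      unfolding N_def by (intro nn_integral_cong nn_integral_cmult) measurable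
    also have "\<dots> = N * N" unfolding N_def by (rule nn_integral_multc) measurable
    finally show ?thesis .
  qed
  have g2: "(\<integral>\<^sup>+p. g p ^ 2 \<partial>(lborel \<Otimes>\<^sub>M lborel)) \<le> ennreal H"
  proof -
    have "(\<integral>\<^sup>+p. g p ^ 2 \<partial>(lborel \<Otimes>\<^sub>M lborel)) = (\<integral>\<^sup>+x. \<integral>\<^sup>+y. g (x, y) ^ 2 \<partial>lborel \<partial>lborel)"
      by (rule lborel.nn_integral_fst[symmetric]) measurable
    also have "\<dots> = (\<integral>\<^sup>+x. \<integral>\<^sup>+y. ennreal (q x * q y / (norm (y - x))\<^sup>2) \<partial>lborel \<partial>lborel)"
      using q by (intro nn_integral_cong) (simp add: g_def power_divide ennreal_power)
    also have "\<dots> \<le> ennreal H" unfolding H_def by (rule hls_inequality[OF assms(1) q m M])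
    finally show ?thesis .
  qed
  have "N \<le> (\<integral>\<^sup>+x. ennreal c * (ennreal (q x * w x) * (\<integral>\<^sup>+y. ennreal (q y * w y / norm (y - x)) \<partial>lborel)) \<partial>lborel)"
    unfolding N_def
  proof (rule nn_integral_mono_AE)
    show "AE x in lborel. ennreal (q x * (w x)\<^sup>2) \<le> ennreal c * (ennreal (q x * w x) * (\<integral>\<^sup>+y. ennreal (q y * w y / norm (y - x)) \<partial>lborel))"
      using pot
    proof eventually_elim
      case (elim x)
      have "ennreal (q x * (w x)\<^sup>2) = ennreal (q x * w x) * ennreal (w x)"
        using q w by (simp add: power2_eq_square mult_ac flip: ennreal_mult)
      also have "\<dots> \<le> ennreal (q x * w x) * (ennreal c * (\<integral>\<^sup>+y. ennreal (q y * w y / norm (y - x)) \<partial>lborel))"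
        by (intro mult_left_mono elim) auto
      finally show ?case by (simp add: mult_ac)
    qed
  qed
  also have "\<dots> = ennreal c * (\<integral>\<^sup>+x. \<integral>\<^sup>+y. f (x, y) * g (x, y) \<partial>lborel \<partial>lborel)"
    unfolding fg by (simp add: nn_integral_cmult)
  also have "(\<integral>\<^sup>+x. \<integral>\<^sup>+y. f (x, y) * g (x, y) \<partial>lborel \<partial>lborel) = (\<integral>\<^sup>+p. f p * g p \<partial>(lborel \<Otimes>\<^sub>M lborel))"
    by (rule lborel.nn_integral_fst) measurable
  finally have "N\<^sup>2 \<le> (ennreal c * (\<integral>\<^sup>+p. f p * g p \<partial>(lborel \<Otimes>\<^sub>M lborel)))\<^sup>2"
    by (intro power_mono) auto
  also have "\<dots> = ennreal (c\<^sup>2) * (\<integral>\<^sup>+p. f p * g p \<partial>(lborel \<Otimes>\<^sub>M lborel))\<^sup>2"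
    using c by (simp add: power_mult_distrib ennreal_power)
  also have "\<dots> \<le> ennreal (c\<^sup>2) * (N * N * ennreal H)"
  proof (rule mult_left_mono)
    have "(\<integral>\<^sup>+p. f p * g p \<partial>(lborel \<Otimes>\<^sub>M lborel))\<^sup>2 \<le> N * N * (\<integral>\<^sup>+p. g p ^ 2 \<partial>(lborel \<Otimes>\<^sub>M lborel))"
      unfolding f2[symmetric] by (rule Cauchy_Schwarz_nn_integral) measurable
    also have "\<dots> \<le> N * N * ennreal H" by (rule mult_left_mono[OF g2]) simp
    finally show "(\<integral>\<^sup>+p. f p * g p \<partial>(lborel \<Otimes>\<^sub>M lborel))\<^sup>2 \<le> N * N * ennreal H" .
  qed simp
  finally have "ennreal (n\<^sup>2) \<le> ennreal (n\<^sup>2 * (c\<^sup>2 * H))"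
    using n(2) c H unfolding n(1) by (simp add: power2_eq_square mult_ac flip: ennreal_mult)
  then have "n\<^sup>2 * 1 \<le> n\<^sup>2 * (c\<^sup>2 * H)" using H by (simp add: ennreal_le_iff)
  then show ?thesis using n(2) unfolding H_def by (subst (asm) mult_le_cancel_left_pos) auto
qed

text \<open>Either $b^2 \le a$ or $a < b^2$.\<close>

lemma mult_le_young: "a \<ge> 0 \<Longrightarrow> b \<ge> 0 \<Longrightarrow> a * b \<le> a powr (3/2) + b ^ 3" for a b :: real
proof -
  assume ab: "a \<ge> 0" "b \<ge> 0"
  show ?thesis
  proof (cases "b \<le> sqrt a")
    case True
    then have "a * b \<le> a powr (3/2)" using ab by (simp add: powr_three_halves mult_left_mono)
    then show ?thesis using ab by (simp add: add_increasing2)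
  next
    case False
    then have "a \<le> b\<^sup>2" using ab by (metis linear real_le_lsqrt real_sqrt_le_iff real_sqrt_abs abs_of_nonneg)
    then have "a * b \<le> b\<^sup>2 * b" using ab by (intro mult_right_mono) auto
    then show ?thesis using ab by (simp add: power3_eq_cube power2_eq_square add_increasing)
  qed
qed

text \<open>Both fourth roots $k = i r$ and $k = -r$ yield a representation of $\Delta\psi + k^2\psi$; in the
  difference the Laplacian cancels.\<close>

lemma eigenfunction_potential_bound:
  assumes p: "square_integrable p" and l: "square_integrable l" and F: "integrable lborel (\<lambda>x. W x * p x)" and z: "z \<noteq> 0"
    and lap: "\<forall>\<phi>\<in>test_functions. (\<integral>x. p x * test_laplacian \<phi> x \<partial>lborel) = (\<integral>x. l x * \<phi> x \<partial>lborel)"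
    and eq: "\<forall>\<phi>\<in>test_functions. (\<integral>x. l x * test_laplacian \<phi> x \<partial>lborel) + (\<integral>x. W x * p x * \<phi> x \<partial>lborel)
       = z * (\<integral>x. p x * \<phi> x \<partial>lborel)"
  shows "AE x in lborel. ennreal (norm (p x)) \<le> ennreal (sqrt (33 / 25) / (8 * pi * sqrt (norm z))) *
      (\<integral>\<^sup>+y. ennreal (norm (W y) * norm (p y) / norm (y - x)) \<partial>lborel)"
proof -
  define F where "F x = - (W x * p x)" for x
  have Fint: "integrable lborel F" unfolding F_def using F by simp
  obtain r where r: "r ^ 4 = z" "0 \<le> Re r" "0 \<le> Im r" using fourth_root by blast
  have weak: "(\<integral>x. (l x + k\<^sup>2 * p x) * (test_laplacian \<phi> x - k\<^sup>2 * \<phi> x) \<partial>lborel) = (\<integral>x. F x * \<phi> x \<partial>lborel)"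
    if k: "k ^ 4 = z" and \<phi>: "\<phi> \<in> test_functions" for k \<phi>
  proof -
    note L = test_function_square_integrable[OF \<phi>] test_laplacian_test[OF \<phi>]
    note i = square_integrable_mult[OF l L(2)] square_integrable_mult[OF l L(1)] square_integrable_mult[OF p L(2)] square_integrable_mult[OF p L(1)]
    have "(\<integral>x. (l x + k\<^sup>2 * p x) * (test_laplacian \<phi> x - k\<^sup>2 * \<phi> x) \<partial>lborel)
      = (\<integral>x. (l x * test_laplacian \<phi> x - k\<^sup>2 * (l x * \<phi> x)) + (k\<^sup>2 * (p x * test_laplacian \<phi> x) - z * (p x * \<phi> x)) \<partial>lborel)"
      unfolding k[symmetric] by (intro Bochner_Integration.integral_cong) (simp_all add: algebra_simps eval_nat_numeral)
    also have "\<dots> = ((\<integral>x. l x * test_laplacian \<phi> x \<partial>lborel) - k\<^sup>2 * (\<integral>x. l x * \<phi> x \<partial>lborel))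
        + (k\<^sup>2 * (\<integral>x. p x * test_laplacian \<phi> x \<partial>lborel) - z * (\<integral>x. p x * \<phi> x \<partial>lborel))"
      using i by simp
    also have "\<dots> = - (\<integral>x. W x * p x * \<phi> x \<partial>lborel)"
      using bspec[OF lap \<phi>] bspec[OF eq \<phi>] by (simp add: algebra_simps)
    finally show ?thesis by (simp add: F_def)
  qed
  have k: "(\<i> * r) ^ 4 = z" "(- r) ^ 4 = z" using r(1) by (simp_all add: power_mult_distrib)
  have L: "square_integrable (\<lambda>x. l x + k\<^sup>2 * p x)" for k by (intro square_integrable_add square_integrable_cmult p l)
  have h: "AE x in lborel. integrable lborel (\<lambda>y. norm (F y) / norm (y - x)) \<and> integrable lborel (\<lambda>y. F y * helmholtz_kernel k (norm (y - x)))
    \<and> 4 * pi * (l x + k\<^sup>2 * p x) = - (\<integral>y. F y * helmholtz_kernel k (norm (y - x)) \<partial>lborel)"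
    if "k ^ 4 = z" "Re k \<le> 0" for k
    by (rule helmholtz_representation[OF L Fint that(2) weak[OF that(1)]])
  have R: "Re (\<i> * r) \<le> 0" "Re (- r) \<le> 0" using r by simp_all
  show ?thesis using h[OF k(1) R(1)] h[OF k(2) R(2)]
  proof eventually_elim
    case (elim x)
    let ?K = "\<lambda>k y. helmholtz_kernel k (norm (y - x))"
    have i0: "integrable lborel (\<lambda>y. norm (F y) / norm (y - x))"
      and i1: "integrable lborel (\<lambda>y. F y * ?K (\<i> * r) y)" and i2: "integrable lborel (\<lambda>y. F y * ?K (- r) y)"
      and e1: "4 * pi * (l x + (\<i> * r)\<^sup>2 * p x) = - (\<integral>y. F y * ?K (\<i> * r) y \<partial>lborel)"
      and e2: "4 * pi * (l x + (- r)\<^sup>2 * p x) = - (\<integral>y. F y * ?K (- r) y \<partial>lborel)"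
      using elim by (simp_all add: power_mult_distrib)
    have "8 * pi * r\<^sup>2 * p x = 4 * pi * (l x + (- r)\<^sup>2 * p x) - 4 * pi * (l x + (\<i> * r)\<^sup>2 * p x)"
      by (simp add: power_mult_distrib algebra_simps)
    also have "\<dots> = (\<integral>y. F y * ?K (\<i> * r) y - F y * ?K (- r) y \<partial>lborel)"
      unfolding e1 e2 using i1 i2 by simp
    finally have "norm (8 * pi * r\<^sup>2 * p x) = norm (\<integral>y. F y * ?K (\<i> * r) y - F y * ?K (- r) y \<partial>lborel)" by simp
    also have "\<dots> \<le> (\<integral>y. norm (F y * ?K (\<i> * r) y - F y * ?K (- r) y) \<partial>lborel)" by (rule integral_norm_bound)
    also have "\<dots> \<le> (\<integral>y. sqrt (33 / 25) * (norm (F y) / norm (y - x)) \<partial>lborel)"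
    proof (rule integral_mono)
      show "integrable lborel (\<lambda>y. norm (F y * ?K (\<i> * r) y - F y * ?K (- r) y))"
        by (intro integrable_norm Bochner_Integration.integrable_diff i1 i2)
      show "integrable lborel (\<lambda>y. sqrt (33 / 25) * (norm (F y) / norm (y - x)))"
        by (intro integrable_mult_right i0)
      fix y
      have "norm (F y * ?K (\<i> * r) y - F y * ?K (- r) y)
          = norm (F y) * (norm (exp (\<i> * r * of_real (norm (y - x))) - exp (- r * of_real (norm (y - x)))) / norm (y - x))"
        by (simp add: helmholtz_kernel_def norm_mult norm_divide flip: right_diff_distrib diff_divide_distrib)
      also have "\<dots> \<le> norm (F y) * (sqrt (33 / 25) / norm (y - x))"
        by (intro mult_left_mono divide_right_mono exp_difference_bound r) auto
      finally show "norm (F y * ?K (\<i> * r) y - F y * ?K (- r) y) \<le> sqrt (33 / 25) * (norm (F y) / norm (y - x))"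
        by (simp add: mult_ac)
    qed
    also have "\<dots> = sqrt (33 / 25) * (\<integral>y. norm (F y) / norm (y - x) \<partial>lborel)"
      by (rule integral_mult_right_zero)
    finally have "8 * pi * (norm r)\<^sup>2 * norm (p x) \<le> sqrt (33 / 25) * (\<integral>y. norm (F y) / norm (y - x) \<partial>lborel)"
      by (simp add: norm_mult norm_power)
    moreover have "(norm r)\<^sup>2 = sqrt (norm z)"
    proof -
      have "((norm r)\<^sup>2)\<^sup>2 = norm z" unfolding r(1)[symmetric] by (simp add: norm_power)
      from real_sqrt_unique[OF this] show ?thesis by simp
    qed
    ultimately have "norm (p x) \<le> sqrt (33 / 25) / (8 * pi * sqrt (norm z)) * (\<integral>y. norm (F y) / norm (y - x) \<partial>lborel)"
      using z by (simp add: field_simps)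
    then have "ennreal (norm (p x)) \<le> ennreal (sqrt (33 / 25) / (8 * pi * sqrt (norm z))) * ennreal (\<integral>y. norm (F y) / norm (y - x) \<partial>lborel)"
      by (simp flip: ennreal_mult add: ennreal_leI)
    also have "ennreal (\<integral>y. norm (F y) / norm (y - x) \<partial>lborel) = (\<integral>\<^sup>+y. ennreal (norm (F y) / norm (y - x)) \<partial>lborel)"
      using i0 by (intro nn_integral_eq_integral[symmetric]) auto
    finally show ?case by (simp add: F_def norm_mult)
  qed
qed

theorem corollary1:
  fixes V :: "real ^ 3 \<Rightarrow> complex"
  assumes "V \<in> Lp (3/2)"
  shows "point_spectrum (H_op V) \<subseteq>
    {z. cmod z \<le> 1/8 * (1 / (4 * pi) powr (2/3)) * (Lp_norm (3/2) V)\<^sup>2}"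
proof
  fix z assume "z \<in> point_spectrum (H_op V)"
  then obtain \<psi> where nz: "\<not> (AE x in lebesgue. \<psi> x = 0)" and op: "(\<psi>, \<lambda>x. z * \<psi> x) \<in> H_op V"
    by (auto simp: point_spectrum_def)
  have V: "V \<in> borel_measurable lebesgue" "integrable lebesgue (\<lambda>x. cmod (V x) powr (3/2))"
    using assms by (auto simp: Lp_def)
  define M where "M = Lp_norm (3/2) V"
  have "cmod z \<le> 1/8 * (1 / (4 * pi) powr (2/3)) * M\<^sup>2"
  proof (cases "z = 0")
    case False
    obtain p l W where p: "square_integrable p" and l: "square_integrable l" and W: "W \<in> borel_measurable borel" "AE x in lborel. V x = W x"
      and \<psi>p: "AE x in lborel. \<psi> x = p x"
      and lap: "\<forall>\<phi>\<in>test_functions. (\<integral>x. p x * test_laplacian \<phi> x \<partial>lborel) = (\<integral>x. l x * \<phi> x \<partial>lborel)"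
      and eq: "\<forall>\<phi>\<in>test_functions. (\<integral>x. l x * test_laplacian \<phi> x \<partial>lborel) + (\<integral>x. W x * p x * \<phi> x \<partial>lborel)
         = z * (\<integral>x. p x * \<phi> x \<partial>lborel)"
      using eigenfunction_weak_equation[OF V(1) op] .
    have [measurable]: "W \<in> borel_measurable borel" "p \<in> borel_measurable borel" using W p by (auto simp: square_integrable_def)
    define I where "I = (\<integral>x. cmod (V x) powr (3/2) \<partial>lebesgue)"
    have VW: "AE x in lborel. cmod (V x) powr (3/2) = cmod (W x) powr (3/2)" using W(2) by eventually_elim simp
    have Wint: "integrable lborel (\<lambda>x. cmod (W x) powr (3/2))"
      using integrable_lebesgue_eq[OF _ _ VW] V(2) borel_measurable_integrable[OF V(2)] by simp
    have "I = (\<integral>x. cmod (W x) powr (3/2) \<partial>lebesgue)"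
      unfolding I_def using VW
      by (intro integral_cong_AE[OF borel_measurable_integrable[OF V(2)] measurable_lebesgueI]) (auto simp: AE_lebesgue_iff)
    then have I: "I = (\<integral>x. cmod (W x) powr (3/2) \<partial>lborel)" by (simp add: integral_completion)
    then have I0: "I \<ge> 0" by simp
    have M: "M = I powr (2/3)" by (simp add: M_def Lp_norm_def I_def)
    then have M32: "M powr (3/2) = I" using I0 by (simp add: powr_powr)
    have m: "(\<integral>\<^sup>+y. ennreal (cmod (W y) powr (3/2)) \<partial>lborel) = ennreal (M powr (3/2))"
      unfolding M32 I using Wint by (intro nn_integral_eq_integral) auto
    obtain C where C: "AE x in lborel. norm (p x) \<le> C"
      using weak_laplacian_bounded[OF p l] lap by blast
    have p2: "integrable lborel (\<lambda>x. (norm (p x))\<^sup>2)" using p by (simp add: square_integrable_def)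
    \<comment> \<open>$|V\psi| \le |V|^{3/2} + |\psi|^3$, and $|\psi|^3 \le C |\psi|^2$.\<close>
    have F: "integrable lborel (\<lambda>x. W x * p x)"
    proof (rule Bochner_Integration.integrable_bound)
      show "integrable lborel (\<lambda>x. cmod (W x) powr (3/2) + C * (norm (p x))\<^sup>2)"
        using Wint p2 by simp
      show "AE x in lborel. norm (W x * p x) \<le> norm (cmod (W x) powr (3/2) + C * (norm (p x))\<^sup>2)"
        using C
      proof eventually_elim
        case (elim x)
        have "norm (W x) * norm (p x) \<le> norm (W x) powr (3/2) + norm (p x) ^ 3" by (rule mult_le_young) auto
        also have "norm (p x) ^ 3 \<le> C * (norm (p x))\<^sup>2"
          using elim by (simp add: power3_eq_cube power2_eq_square mult_right_mono flip: mult.assoc)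
        finally show ?case by (simp add: norm_mult)
      qed
    qed measurable
    note pot = eigenfunction_potential_bound[OF p l F False lap eq]
    let ?N = "\<integral>\<^sup>+x. ennreal (norm (W x) * (norm (p x))\<^sup>2) \<partial>lborel"
    \<comment> \<open>$N$ is finite because $\psi$ is bounded and $V\psi$ is integrable.\<close>
    have "?N \<le> (\<integral>\<^sup>+x. ennreal C * ennreal (norm (W x * p x)) \<partial>lborel)"
    proof (rule nn_integral_mono_AE)
      show "AE x in lborel. ennreal (norm (W x) * (norm (p x))\<^sup>2) \<le> ennreal C * ennreal (norm (W x * p x))"
        using C
      proof eventually_elim
        case (elim x)
        have "norm (W x) * norm (p x) * norm (p x) \<le> norm (W x) * norm (p x) * C" using elim by (intro mult_left_mono) auto
        moreover have "C \<ge> 0" using elim norm_ge_zero[of "p x"] by linarith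
        ultimately show ?case by (simp add: norm_mult power2_eq_square mult_ac ennreal_leI flip: ennreal_mult)
      qed
    qed
    also have "\<dots> < \<infinity>"
      using F by (simp add: nn_integral_cmult integrable_iff_bounded ennreal_mult_less_top)
    finally have N1: "?N < \<infinity>" .
    \<comment> \<open>If $N = 0$, then $V\psi = 0$ almost everywhere, and the potential bound forces $\psi = 0$.\<close>
    have N0: "?N \<noteq> 0"
    proof
      assume "?N = 0"
      then have "AE x in lborel. ennreal (norm (W x) * (norm (p x))\<^sup>2) = 0" by (subst (asm) nn_integral_0_iff_AE) auto
      then have WP: "AE y in lborel. norm (W y) * norm (p y) = 0" by eventually_elim auto
      have "(\<integral>\<^sup>+y. ennreal (norm (W y) * norm (p y) / norm (y - x)) \<partial>lborel) = 0" for x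
        using WP by (subst nn_integral_0_iff_AE) (auto elim!: eventually_mono)
      then have "AE x in lborel. p x = 0" using pot by (auto elim!: eventually_mono)
      then have "AE x in lborel. \<psi> x = 0" using \<psi>p by eventually_elim simp
      then show False using nz by (simp add: AE_lebesgue_iff)
    qed
    have "I \<noteq> 0"
    proof
      assume "I = 0"
      then have "AE x in lborel. cmod (W x) powr (3/2) = 0"
        using integral_nonneg_eq_0_iff_AE[OF Wint] I by auto
      then have "AE x in lborel. ennreal (norm (W x) * (norm (p x))\<^sup>2) = 0" by eventually_elim auto
      then show False using N0 by (subst (asm) nn_integral_0_iff_AE) auto
    qed
    then have M0: "M > 0" using I0 by (simp add: M)
    define c where "c = sqrt (33 / 25) / (8 * pi * sqrt (norm z))"
    have "1 \<le> c\<^sup>2 * ((32 / 9 + 64 * pi / 27) * M\<^sup>2)"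
      by (rule birman_schwinger_bound[OF _ _ _ _ m M0 _ pot[folded c_def] N1 N0]) (auto simp: c_def)
    moreover have "c\<^sup>2 = 33 / 25 / (64 * pi\<^sup>2) / norm z"
      by (simp add: c_def power_divide power_mult_distrib)
    ultimately have "norm z \<le> 33 / 25 / (64 * pi\<^sup>2) * (32 / 9 + 64 * pi / 27) * M\<^sup>2"
      using False by (simp add: field_simps)
    also have "\<dots> \<le> 1/8 * (1 / (4 * pi) powr (2/3)) * M\<^sup>2"
      by (rule mult_right_mono[OF hls_constant_suffices]) simp
    finally show ?thesis .
  qed simp
  then show "z \<in> {z. cmod z \<le> 1/8 * (1 / (4 * pi) powr (2/3)) * (Lp_norm (3/2) V)\<^sup>2}"
    by (simp add: M_def)
qed

end
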